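(* The base polytope $B(M)$ of a matroid $M$ is Gorenstein if and only if there exists an integer $\delta\geq 2$ such that: when $\delta>2$, matroid $M$ is a direct sum of loops, coloops, and $G'_\delta$-matroids with some (possibly none) good $(\delta-1)$-ears contracted; when $\delta=2$, matroid $M$ is a direct sum of loops, coloops, and $G'_2$-matroids.
   Context: **Base polytope.** For a matroid $M$ on a finite ground set $E$, $B(M)\subset\mathbb{R}^E$ is the convex hull of the indicator vectors $\sum_{e\in B}\chi_e$ of all bases $B$ of $M$. **Gorenstein polytopes.** A lattice polytope $P\subset\mathbb{R}^d$ has the integer decomposition property if for every positive integer $k$ each vector of $kP\cap\mathbb{Z}^d$ is a sum of $k$ vectors of $P\cap\mathbb{Z}^d$ (matroid base polytopes have this property). Let $\delta$ be a positive integer. A full-dimensional lattice polytope $P\subset\mathbb{R}^d$ with the integer decomposition property is $\delta$-Gorenstein if there is a lattice point $v\in\delta P$ such that for every supporting (facet-defining) hyperplane of the cone over $P$ its reduced equation $h$ (the integral linear form that is nonnegative on the cone and takes all integer values on the lattice) satisfies $h(v)=1$; here the cone over $P$ is the cone generated by $P\times\{1\}$, and $v\in\delta P$ is regarded as the point $(v,\delta)$ of this cone. A lattice polytope that is not necessarily full-dimensional is $\delta$-Gorenstein if it is so in the affine lattice it spans. $P$ is Gorenstein if it is $\delta$-Gorenstein for some positive integer $\delta$. **$G_\delta$-families.** Fix an integer $\delta\geq2$. A family $\mathcal{G}$ of subsets of a finite set $E$ is a $G_\delta$-family if: (1) $\{e\}\in\mathcal{G}$ for every $e\in E$; (2) for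 all $G_i,G_j\in\mathcal{G}$ with $G_i\cap G_j\neq\emptyset$ and $G_i\cup G_j\neq E$, both $G_i\cap G_j$ and $G_i\cup G_j$ belong to $\mathcal{G}$; (3) $|E|=\frac{\delta g_0}{\delta-1}$ for some integer $g_0\equiv0\pmod{\delta-1}$; (4) every $G_i\in\mathcal{G}$ has cardinality $\frac{\delta g_i-1}{\delta-1}$ for some integer $g_i\equiv1\pmod{\delta-1}$. **The matroid of a family.** For a $G_\delta$-family $\mathcal{G}$ let $\tilde{\mathcal{G}}$ be the family of all nonempty intersections of sets from $\mathcal{G}$, including $E$ as the intersection of zero sets. For $F\in\tilde{\mathcal{G}}$ let $c(F)$ be the least $k\ge 0$ such that $F$ is an intersection in $E$ of $k$ sets from $\mathcal{G}$ (so $c(E)=0$), and let $r(F)=\frac1\delta\left((\delta-1)|F|+c(F)\right)$, which is an integer. The matroid $M_{\mathcal{G}}$ has ground set $E$, and its circuits are the inclusion-minimal sets among all $(r(F)+1)$-element subsets of $F$, over all $F\in\tilde{\mathcal{G}}$ (this does define a matroid). **$G'_\delta$-matroids for $\delta>2$.** A $G'_\delta$-family is a $G_\delta$-family $\mathcal{G}$ such that moreover (5) for every $e\in E$ the set $E\setminus e$ is the disjoint union of exactly $\delta-1$ sets that are inclusion-maximal among the members of $\mathcal{G}$ contained in $E\setminus e$. A $G'_\delta$-matroid is the matroid $M_{\mathcal{G}}$ of a $G'_\delta$-family $\mathcal{G}$. **$G'_2$-matroids.** A family $\mathcal{G}'$ of subsets of a finite set $E$ is a $G'_2$-family if: (1')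 for every $e\in E$, $\{e\}\in\mathcal{G}'$ and $E\setminus e\notin\mathcal{G}'$; (2') for all $G_i,G_j\in\mathcal{G}'$ with $G_i\cap G_j\neq\emptyset$ and $G_i\cup G_j\neq E$ one has $G_i\cap G_j\in\mathcal{G}'$, and if in addition $G_i\cup G_j\neq E\setminus e$ for every $e\in E$, then $G_i\cup G_j\in\mathcal{G}'$; (3) $|E|=2g_0$ for some integer $g_0$; (4) every $G_i\in\mathcal{G}'$ has cardinality $2g_i-1$ for some integer $g_i$. A $G'_2$-matroid is the matroid $M_{\mathcal{G}'}$ of a $G'_2$-family $\mathcal{G}'$, defined as follows: let $\tilde{\mathcal{G}'}$ be the family of all nonempty intersections of sets from $\mathcal{G}'$, including $E$ as the intersection of zero sets; for $F\in\tilde{\mathcal{G}'}$ let $c'(F)$ be the least $k\ge 0$ such that $F$ is an intersection in $E$ of $k$ sets from $\mathcal{G}'$ (so $c'(E)=0$), and let $r'(F)=\frac12\left(|F|+c'(F)\right)$, which is an integer; then $M_{\mathcal{G}'}$ has ground set $E$, and its circuits are the inclusion-minimal sets among all $(r'(F)+1)$-element subsets of $F$, over all $F\in\tilde{\mathcal{G}'}$. **Ears.** A matroid is connected if it is not a direct sum of two or more matroids with nonempty ground sets (so one-element matroids are connected). An $s$-ear in a matroid is a set of $s$ elements of the ground set such that every circuit contains either none or all of them. An ear in a connected matroid is bad if contracting all its elements leaves a connected matroid, and good otherwise ($G'_\delta$-matroids are connected). Contracting an $s$-ear $\{e_1,\dots,e_s\}$ of $M$ means passing to $M/\{e_2,\dots,e_s\}$,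 i.e. contracting all but one of its elements. "Some good $(\delta-1)$-ears contracted" means that this is done for each ear in a collection of pairwise disjoint good $(\delta-1)$-ears.
   Formalization: In condition (1') of a G'_2-family, E\e ∉ G' is required only when |E| ≠ 2: for |E| = 2 it contradicts {e} ∈ G', and the claim as written fails for U_{1,2}, whose base polytope is a unit segment and hence Gorenstein. *)

theory Defs
  imports "HOL-Analysis.Analysis" "HOL-Number_Theory.Cong"
begin

section \<open>Matroids\<close>

text \<open>Matroids are given by their independent sets. The record also serves for constructions whose
  result still has to be shown to satisfy the axioms.\<close>

record 'a matroid =
  ground :: "'a set"
  indeps :: "'a set set"

definition is_matroid :: "'a matroid \<Rightarrow> bool" where
  "is_matroid M \<longleftrightarrow>
     finite (ground M) \<and> indeps M \<subseteq> Pow (ground M) \<and> {} \<in> indeps M \<and>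
     (\<forall>I\<in>indeps M. \<forall>J. J \<subseteq> I \<longrightarrow> J \<in> indeps M) \<and>
     (\<forall>I\<in>indeps M. \<forall>J\<in>indeps M. card I < card J \<longrightarrow> (\<exists>e\<in>J - I. insert e I \<in> indeps M))"

definition bases :: "'a matroid \<Rightarrow> 'a set set" where
  "bases M = {B \<in> indeps M. \<forall>I\<in>indeps M. B \<subseteq> I \<longrightarrow> I = B}"

definition circuits :: "'a matroid \<Rightarrow> 'a set set" where
  "circuits M = {C. C \<subseteq> ground M \<and> C \<notin> indeps M \<and> (\<forall>D. D \<subset> C \<longrightarrow> D \<in> indeps M)}"

definition matroid_of_circuits :: "'a set \<Rightarrow> 'a set set \<Rightarrow> 'a matroid" where
  "matroid_of_circuits E \<C> = \<lparr>ground = E, indeps = {I. I \<subseteq> E \<and> (\<forall>C\<in>\<C>. \<not> C \<subseteq> I)}\<rparr>"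

definition contraction :: "'a matroid \<Rightarrow> 'a set \<Rightarrow> 'a matroid" where
  "contraction M K = \<lparr>ground = ground M - K,
     indeps = {I. I \<subseteq> ground M - K \<and>
       (\<exists>B. B \<subseteq> K \<and> B \<in> indeps M \<and> (\<forall>B'\<in>indeps M. B \<subseteq> B' \<and> B' \<subseteq> K \<longrightarrow> B' = B) \<and>
            I \<union> B \<in> indeps M)}\<rparr>"

definition is_direct_sum :: "'a matroid \<Rightarrow> 'a matroid set \<Rightarrow> bool" where
  "is_direct_sum M \<N> \<longleftrightarrow>
     disjoint_family_on ground \<N> \<and> ground M = (\<Union>N\<in>\<N>. ground N) \<and>
     indeps M = {I. I \<subseteq> ground M \<and> (\<forall>N\<in>\<N>. I \<inter> ground N \<in> indeps N)}"

definition connected_matroid :: "'a matroid \<Rightarrow> bool" where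
  "connected_matroid M \<longleftrightarrow>
     \<not> (\<exists>\<N>. 2 \<le> card \<N> \<and> (\<forall>N\<in>\<N>. is_matroid N \<and> ground N \<noteq> {}) \<and> is_direct_sum M \<N>)"

definition is_loop :: "'a matroid \<Rightarrow> bool" where
  "is_loop M \<longleftrightarrow> (\<exists>e. M = \<lparr>ground = {e}, indeps = {{}}\<rparr>)"

definition is_coloop :: "'a matroid \<Rightarrow> bool" where
  "is_coloop M \<longleftrightarrow> (\<exists>e. M = \<lparr>ground = {e}, indeps = {{}, {e}}\<rparr>)"

definition matroid_iso :: "'a matroid \<Rightarrow> 'b matroid \<Rightarrow> bool" where
  "matroid_iso M N \<longleftrightarrow> (\<exists>f. bij_betw f (ground M) (ground N) \<and>
     (\<forall>X. X \<subseteq> ground M \<longrightarrow> (X \<in> indeps M \<longleftrightarrow> f ` X \<in> indeps N)))"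


section \<open>Gorenstein lattice polytopes\<close>

definition integer_points :: "(real ^ 'n) set" where
  "integer_points = {x. \<forall>i. x $ i \<in> \<int>}"

definition lattice_polytope :: "(real ^ 'n) set \<Rightarrow> bool" where
  "lattice_polytope P \<longleftrightarrow> (\<exists>V. finite V \<and> V \<subseteq> integer_points \<and> P = convex hull V)"

definition cone_over :: "(real ^ 'n) set \<Rightarrow> ((real ^ 'n) \<times> real) set" where
  "cone_over P = convex_cone hull (P \<times> {1})"

text \<open>The lattice generated by \<open>(P \<inter> \<int>\<^sup>n) \<times> {1}\<close>. Its part at height 1 is the affine lattice
  spanned by \<open>P\<close>, so no full-dimensionality of \<open>P\<close> is needed below. If \<open>P\<close> is full-dimensional and
  has the integer decomposition property in \<open>\<int>\<^sup>n\<close>, this is all of \<open>\<int>\<^sup>n \<times> \<int>\<close>.\<close>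

definition spanned_lattice :: "(real ^ 'n) set \<Rightarrow> ((real ^ 'n) \<times> real) set" where
  "spanned_lattice P =
     {\<Sum>p\<in>S. of_int (u p) *\<^sub>R (p, 1) | S (u :: real ^ 'n \<Rightarrow> int).
        finite S \<and> S \<subseteq> P \<inter> integer_points}"

definition integer_decomposition_property :: "(real ^ 'n) set \<Rightarrow> bool" where
  "integer_decomposition_property P \<longleftrightarrow>
     (\<forall>k::nat. 0 < k \<longrightarrow>
       (\<forall>x \<in> (\<lambda>p. real k *\<^sub>R p) ` P. (x, real k) \<in> spanned_lattice P \<longrightarrow>
         (\<exists>w :: nat \<Rightarrow> real ^ 'n.
            (\<forall>i<k. w i \<in> P \<and> (w i, 1) \<in> spanned_lattice P) \<and> x = (\<Sum>i<k. w i))))"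

text \<open>\<open>h\<close> is the reduced equation of the hyperplane (of the linear span of the cone) supporting the
  facet \<open>F\<close>. It is determined only on that linear span, where it is unique.\<close>

definition reduced_equation ::
  "(real ^ 'n) set \<Rightarrow> ((real ^ 'n) \<times> real) set \<Rightarrow> ((real ^ 'n) \<times> real \<Rightarrow> real) \<Rightarrow> bool" where
  "reduced_equation P F h \<longleftrightarrow>
     linear h \<and> (\<forall>x\<in>F. h x = 0) \<and> (\<forall>x\<in>cone_over P. 0 \<le> h x) \<and> h ` spanned_lattice P = \<int>"

definition gorenstein_of_index :: "nat \<Rightarrow> (real ^ 'n) set \<Rightarrow> bool" where
  "gorenstein_of_index \<delta> P \<longleftrightarrow>
     lattice_polytope P \<and> integer_decomposition_property P \<and>
     (\<exists>v \<in> (\<lambda>p. real \<delta> *\<^sub>R p) ` P. (v, real \<delta>) \<in> spanned_lattice P \<and>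
        (\<forall>F. F facet_of cone_over P \<longrightarrow> (\<exists>h. reduced_equation P F h \<and> h (v, real \<delta>) = 1)))"

definition gorenstein :: "(real ^ 'n) set \<Rightarrow> bool" where
  "gorenstein P \<longleftrightarrow> (\<exists>\<delta>>0. gorenstein_of_index \<delta> P)"

text \<open>The ground set may be a proper subset of the finite type; then \<open>\<real>\<^sup>E\<close> appears as a coordinate
  subspace, which is harmless because Gorensteinness is intrinsic to the spanned affine lattice.\<close>

definition base_polytope :: "'e::finite matroid \<Rightarrow> (real ^ 'e) set" where
  "base_polytope M = convex hull ((\<lambda>B. \<Sum>e\<in>B. axis e 1) ` bases M)"


section \<open>Families of sets and their matroids\<close>

definition G_family :: "nat \<Rightarrow> 'a set \<Rightarrow> 'a set set \<Rightarrow> bool" where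
  "G_family \<delta> E \<G> \<longleftrightarrow>
     2 \<le> \<delta> \<and> finite E \<and> \<G> \<subseteq> Pow E \<and>
     (\<forall>e\<in>E. {e} \<in> \<G>) \<and>
     (\<forall>A\<in>\<G>. \<forall>B\<in>\<G>. A \<inter> B \<noteq> {} \<and> A \<union> B \<noteq> E \<longrightarrow> A \<inter> B \<in> \<G> \<and> A \<union> B \<in> \<G>) \<and>
     (\<exists>g::int. [g = 0] (mod (int \<delta> - 1)) \<and>
        real (card E) = real \<delta> * of_int g / (real \<delta> - 1)) \<and>
     (\<forall>A\<in>\<G>. \<exists>g::int. [g = 1] (mod (int \<delta> - 1)) \<and>
        real (card A) = (real \<delta> * of_int g - 1) / (real \<delta> - 1))"

definition intersection_family :: "'a set \<Rightarrow> 'a set set \<Rightarrow> 'a set set" where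
  "intersection_family E \<G> = {F. F \<noteq> {} \<and> (\<exists>\<H>. \<H> \<subseteq> \<G> \<and> F = E \<inter> \<Inter>\<H>)}"

definition intersection_number :: "'a set \<Rightarrow> 'a set set \<Rightarrow> 'a set \<Rightarrow> nat" where
  "intersection_number E \<G> F =
     (LEAST k. \<exists>\<H>. \<H> \<subseteq> \<G> \<and> finite \<H> \<and> card \<H> = k \<and> F = E \<inter> \<Inter>\<H>)"

text \<open>For the families considered here the division by \<open>\<delta>\<close> is exact.\<close>

definition family_rank :: "nat \<Rightarrow> 'a set \<Rightarrow> 'a set set \<Rightarrow> 'a set \<Rightarrow> nat" where
  "family_rank \<delta> E \<G> F = ((\<delta> - 1) * card F + intersection_number E \<G> F) div \<delta>"

definition family_dependents :: "nat \<Rightarrow> 'a set \<Rightarrow> 'a set set \<Rightarrow> 'a set set" where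
  "family_dependents \<delta> E \<G> =
     {C. \<exists>F\<in>intersection_family E \<G>. C \<subseteq> F \<and> card C = family_rank \<delta> E \<G> F + 1}"

definition family_matroid :: "nat \<Rightarrow> 'a set \<Rightarrow> 'a set set \<Rightarrow> 'a matroid" where
  "family_matroid \<delta> E \<G> = matroid_of_circuits E
     {C \<in> family_dependents \<delta> E \<G>. \<forall>D\<in>family_dependents \<delta> E \<G>. D \<subseteq> C \<longrightarrow> D = C}"

definition G'_family :: "nat \<Rightarrow> 'a set \<Rightarrow> 'a set set \<Rightarrow> bool" where
  "G'_family \<delta> E \<G> \<longleftrightarrow> G_family \<delta> E \<G> \<and>
     (\<forall>e\<in>E. \<exists>\<H>. card \<H> = \<delta> - 1 \<and> disjoint \<H> \<and> \<Union>\<H> = E - {e} \<and>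
        (\<forall>H\<in>\<H>. H \<in> \<G> \<and> (\<forall>A\<in>\<G>. H \<subseteq> A \<and> A \<subseteq> E - {e} \<longrightarrow> A = H)))"

definition G'_matroid :: "nat \<Rightarrow> 'a matroid \<Rightarrow> bool" where
  "G'_matroid \<delta> M \<longleftrightarrow> (\<exists>E \<G>. G'_family \<delta> E \<G> \<and> M = family_matroid \<delta> E \<G>)"

text \<open>The guard \<open>card E \<noteq> 2\<close>, absent from the usual wording, is needed: for a two-element \<open>E\<close> the sets \<open>E - {e}\<close> are themselves
  singletons, so requiring \<open>{e} \<in> \<G>\<close> and \<open>E - {e} \<notin> \<G>\<close> for all \<open>e\<close> would be contradictory, while
  the uniform matroid of rank 1 on two elements has a unit segment as base polytope (Gorenstein of
  index exactly 2) and has to be counted among the \<open>G'\<^sub>2\<close>-matroids.\<close>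

definition G'2_family :: "'a set \<Rightarrow> 'a set set \<Rightarrow> bool" where
  "G'2_family E \<G> \<longleftrightarrow>
     finite E \<and> \<G> \<subseteq> Pow E \<and>
     (\<forall>e\<in>E. {e} \<in> \<G> \<and> (card E \<noteq> 2 \<longrightarrow> E - {e} \<notin> \<G>)) \<and>
     (\<forall>A\<in>\<G>. \<forall>B\<in>\<G>. A \<inter> B \<noteq> {} \<and> A \<union> B \<noteq> E \<longrightarrow>
        A \<inter> B \<in> \<G> \<and> ((\<forall>e\<in>E. A \<union> B \<noteq> E - {e}) \<longrightarrow> A \<union> B \<in> \<G>)) \<and>
     (\<exists>g::int. int (card E) = 2 * g) \<and>
     (\<forall>A\<in>\<G>. \<exists>g::int. int (card A) = 2 * g - 1)"

definition G'2_matroid :: "'a matroid \<Rightarrow> bool" where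
  "G'2_matroid M \<longleftrightarrow> (\<exists>E \<G>. G'2_family E \<G> \<and> M = family_matroid 2 E \<G>)"


section \<open>Ears\<close>

definition is_ear :: "'a matroid \<Rightarrow> nat \<Rightarrow> 'a set \<Rightarrow> bool" where
  "is_ear M s A \<longleftrightarrow> A \<subseteq> ground M \<and> finite A \<and> card A = s \<and>
     (\<forall>C\<in>circuits M. A \<inter> C = {} \<or> A \<subseteq> C)"

definition good_ear :: "'a matroid \<Rightarrow> nat \<Rightarrow> 'a set \<Rightarrow> bool" where
  "good_ear M s A \<longleftrightarrow> is_ear M s A \<and> \<not> connected_matroid (contraction M A)"

text \<open>\<open>\<rho>\<close> selects the element of each ear that is not contracted.\<close>

definition good_ears_contracted :: "nat \<Rightarrow> 'a matroid \<Rightarrow> 'a matroid \<Rightarrow> bool" where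
  "good_ears_contracted s N M \<longleftrightarrow>
     (\<exists>\<A> \<rho>. disjoint \<A> \<and> (\<forall>A\<in>\<A>. good_ear N s A \<and> \<rho> A \<in> A) \<and>
        M = contraction N (\<Union>A\<in>\<A>. A - {\<rho> A}))"

text \<open>The matroid before contraction can have more elements than the finite type \<open>'e\<close> of the ground
  set of \<open>M\<close>, so it is taken on a finite set of natural numbers, up to isomorphism.\<close>

definition G'_matroid_good_ears_contracted :: "nat \<Rightarrow> 'e matroid \<Rightarrow> bool" where
  "G'_matroid_good_ears_contracted \<delta> M \<longleftrightarrow>
     (\<exists>N N' :: nat matroid. G'_matroid \<delta> N \<and> good_ears_contracted (\<delta> - 1) N N' \<and> matroid_iso M N')"

end

theory Submission
  imports Defs
begin

text \<open>
  The base polytope of a connected matroid with rank function \<open>r\<close> on a set \<open>P\<close> of at least two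
  elements is cut out of the hyperplane of vectors with coordinate sum \<open>r P\<close> by the inequalities
  \<open>x(A) \<le> r A\<close>, and its facets belong to the \<^emph>\<open>flacets\<close>: the proper nonempty
  sets \<open>A\<close> with connected restriction and connected contraction. A lattice point \<open>v\<close> of
  the \<open>\<delta>\<close>-fold dilate is at lattice distance one from all facets if and only if the slack
  \<open>f A = \<delta> * r A - v(A)\<close>, a submodular function that vanishes on \<open>{}\<close> and \<open>P\<close>, is positive
  on all other sets and equal to one on the flacets. Whether a set is a flacet can be read off from \<open>f\<close>:
  a set is not a flacet if it splits, either into two disjoint nonempty sets or as the intersection of
  two larger proper sets covering \<open>P\<close>, in such a way that the slacks of the two sets add up to its own.
  Thus the Gorenstein property becomes a statement about the set function \<open>f\<close> alone
  (\<open>gorenstein_block\<close>), required of every connected component with the same \<open>\<delta>\<close>. The two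
  directions of this translation are \<open>gorenstein_of_blocks\<close> and \<open>blocks_of_gorenstein\<close>. They rest on
  the greedy principle for weights on bases (\<open>max_weight_base_upper_set\<close>), which replaces all dimension
  counts, and the integer decomposition property follows from the discrete sandwich theorem.

  Suppose first that \<open>v\<close> is constantly \<open>\<delta> - 1\<close>. By submodularity, the sets of slack one form a
  crossing family, and the congruences for their cardinalities express that the rank is an integer. The
  splittings show that the slack, and with it the matroid, can be recovered from this family: \<open>f A\<close> is
  the least total number of members needed to write the parts of some partition of \<open>A\<close> as intersections
  of members. Conversely, for any family as in the definition this minimum, called the excess,
  is submodular; this is the Dilworth truncation, applied twice: once to the complements of the members
  avoiding a fixed point, which yields the number \<open>c\<close>, and once to \<open>c\<close> itself
  (\<open>partition_cost_submodular\<close>). The excess defines a matroid as soon as the excess of \<open>E - {e}\<close> is at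
  most \<open>\<delta> - 1\<close>, which is what the condition on the sets \<open>E - {e}\<close> provides, and by construction it
  satisfies the conditions on \<open>f\<close>. For \<open>\<delta> = 2\<close> the complements of single elements have slack one as
  well; leaving them out of the family does not change the matroid.

  In general, every value of \<open>v\<close> is \<open>1\<close> or \<open>\<delta> - 1\<close>, because a connected matroid stays connected
  after deleting or after contracting any given element (\<open>block_element_value\<close>). Replacing each element
  of value \<open>1\<close> by \<open>\<delta> - 1\<close> elements in series makes \<open>v\<close> constantly \<open>\<delta> - 1\<close> and turns the element
  into an ear, which is good because the contraction of the original element is disconnected. Conversely,
  contracting all but one element of a good ear produces again an element of value \<open>1\<close>; goodness is
  exactly what prevents this element from being a flacet of slack \<open>\<delta> - 1\<close>.
\<close>

section \<open>Rank functions\<close>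

definition submodular_on :: "'a set \<Rightarrow> ('a set \<Rightarrow> 'b::{plus,ord}) \<Rightarrow> bool" where
  "submodular_on E f \<longleftrightarrow> (\<forall>A B. A \<subseteq> E \<longrightarrow> B \<subseteq> E \<longrightarrow> f (A \<union> B) + f (A \<inter> B) \<le> f A + f B)"

lemma submodular_onD:
  "submodular_on E f \<Longrightarrow> A \<subseteq> E \<Longrightarrow> B \<subseteq> E \<Longrightarrow> f (A \<union> B) + f (A \<inter> B) \<le> f A + f B"
  unfolding submodular_on_def by blast

text \<open>Restricting one of the two sets uses a submodular inequality that has to be tight.\<close>

lemma submodular_additive_restrict:
  fixes f :: "'a set \<Rightarrow> int"
  assumes sub: "submodular_on E f" and "f {} = 0"
    and "P \<union> Q \<subseteq> E" "P \<inter> Q = {}" and add: "f P + f Q = f (P \<union> Q)"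
    and "X \<subseteq> P" "Y \<subseteq> Q"
  shows "f (X \<union> Y) = f X + f Y"
proof -
  have e: "P \<union> (X \<union> Q) = P \<union> Q" "P \<inter> (X \<union> Q) = X" "Q \<union> (X \<union> Y) = X \<union> Q" "Q \<inter> (X \<union> Y) = Y"
    "X \<inter> Y = {}"
    using assms by auto
  have "f (P \<union> Q) + f X \<le> f P + f (X \<union> Q)"
    using submodular_onD[OF sub, of P "X \<union> Q"] assms e by auto
  moreover have "f (X \<union> Q) + f Y \<le> f Q + f (X \<union> Y)"
    using submodular_onD[OF sub, of Q "X \<union> Y"] assms(3,6,7) e by (auto simp: subset_iff)
  moreover have "f (X \<union> Y) \<le> f X + f Y"
    using submodular_onD[OF sub, of X Y] assms e by auto
  ultimately show ?thesis using add by linarith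
qed

definition rank_function :: "'a set \<Rightarrow> ('a set \<Rightarrow> nat) \<Rightarrow> bool" where
  "rank_function E r \<longleftrightarrow> finite E \<and> r {} = 0 \<and>
     (\<forall>A e. A \<subseteq> E \<longrightarrow> e \<in> E \<longrightarrow> r A \<le> r (insert e A) \<and> r (insert e A) \<le> Suc (r A)) \<and>
     submodular_on E r"

lemma rank_functionD:
  assumes "rank_function E r"
  shows "finite E" "r {} = 0" "submodular_on E r"
    "A \<subseteq> E \<Longrightarrow> e \<in> E \<Longrightarrow> r A \<le> r (insert e A)"
    "A \<subseteq> E \<Longrightarrow> e \<in> E \<Longrightarrow> r (insert e A) \<le> Suc (r A)"
  using assms unfolding rank_function_def by auto

lemma rank_function_subset_induct:
  assumes "rank_function E r" "A \<subseteq> B" "B \<subseteq> E" "P A"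
    "\<And>e C. A \<subseteq> C \<Longrightarrow> C \<subseteq> B \<Longrightarrow> e \<in> B - C \<Longrightarrow> P C \<Longrightarrow> P (insert e C)"
  shows "P B"
proof -
  have fin: "finite (B - A)" using assms rank_functionD(1)[OF assms(1)] by (meson finite_Diff finite_subset)
  have "D \<subseteq> B - A \<Longrightarrow> P (A \<union> D)" if "finite D" for D
    using that
  proof (induction D)
    case empty then show ?case using assms by simp
  next
    case (insert x D)
    have "P (insert x (A \<union> D))"
      by (rule assms(5)) (use insert assms(2) in auto)
    then show ?case by simp
  qed
  from this[OF fin] have "P (A \<union> (B - A))" by simp
  moreover have "A \<union> (B - A) = B" using assms by auto
  ultimately show ?thesis by simp
qed

lemma rank_function_mono:
  assumes "rank_function E r" "A \<subseteq> B" "B \<subseteq> E"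
  shows "r A \<le> r B"
proof (rule rank_function_subset_induct[OF assms])
  fix e C assume "A \<subseteq> C" "C \<subseteq> B" "e \<in> B - C" "r A \<le> r C"
  moreover have "C \<subseteq> E" "e \<in> E" using calculation assms(3) by auto
  ultimately show "r A \<le> r (insert e C)" using rank_functionD(4)[OF assms(1), of C e] by simp
qed simp

lemma rank_function_card_le:
  assumes "rank_function E r" "A \<subseteq> B" "B \<subseteq> E"
  shows "r B + card A \<le> r A + card B"
proof (rule rank_function_subset_induct[OF assms])
  fix e C assume "A \<subseteq> C" "C \<subseteq> B" "e \<in> B - C" "r C + card A \<le> r A + card C"
  moreover have "finite C" using assms calculation rank_functionD(1) by (meson finite_subset)
  moreover have "r (insert e C) \<le> Suc (r C)"
    by (rule rank_functionD(5)[OF assms(1)]) (use assms calculation in auto)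
  ultimately show "r (insert e C) + card A \<le> r A + card (insert e C)" by simp
qed simp

lemma rank_function_le_card:
  "rank_function E r \<Longrightarrow> A \<subseteq> E \<Longrightarrow> r A \<le> card A"
  using rank_function_card_le[of E r "{}" A] rank_functionD(2)[of E r] by simp

text \<open>When the elements of \<open>B\<close> are added one after the other, submodularity bounds each increment of the
  rank by the increment over \<open>A\<close>.\<close>

lemma rank_function_closure:
  assumes "rank_function E r" "A \<subseteq> B" "B \<subseteq> E" "\<And>e. e \<in> B - A \<Longrightarrow> r (insert e A) = r A"
  shows "r B = r A"
proof (rule rank_function_subset_induct[OF assms(1-3)])
  fix e C assume h: "A \<subseteq> C" "C \<subseteq> B" "e \<in> B - C" "r C = r A"
  have eq: "C \<union> insert e A = insert e C" "C \<inter> insert e A = A" using h by auto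
  have "C \<subseteq> E" "insert e A \<subseteq> E" using h assms(2,3) by auto
  then have "r (insert e C) + r A \<le> r C + r (insert e A)"
    using submodular_onD[OF rank_functionD(3)[OF assms(1)], of C "insert e A"] eq by simp
  moreover have "r C \<le> r (insert e C)"
    by (rule rank_functionD(4)[OF assms(1)]) (use h assms in auto)
  moreover have "e \<notin> A" using h by auto
  ultimately show "r (insert e C) = r A" using assms(4)[of e] h by (auto intro: antisym)
qed simp

definition matroid_of_rank :: "'a set \<Rightarrow> ('a set \<Rightarrow> nat) \<Rightarrow> 'a matroid" where
  "matroid_of_rank E r = \<lparr>ground = E, indeps = {I. I \<subseteq> E \<and> r I = card I}\<rparr>"

text \<open>The maximum is taken over all independent subsets, so that the rank of a set that is not
  contained in the ground set is the rank of its trace on the ground set.\<close>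

definition rk :: "'a matroid \<Rightarrow> 'a set \<Rightarrow> nat" where
  "rk M A = Max (card ` {I \<in> indeps M. I \<subseteq> A})"

lemma matroidD:
  assumes "is_matroid M"
  shows "finite (ground M)" "{} \<in> indeps M" "I \<in> indeps M \<Longrightarrow> I \<subseteq> ground M"
    "I \<in> indeps M \<Longrightarrow> J \<subseteq> I \<Longrightarrow> J \<in> indeps M" "finite (indeps M)"
    "I \<in> indeps M \<Longrightarrow> finite I"
    "I \<in> indeps M \<Longrightarrow> J \<in> indeps M \<Longrightarrow> card I < card J \<Longrightarrow> \<exists>e\<in>J - I. insert e I \<in> indeps M"
proof -
  show *: "finite (ground M)" "{} \<in> indeps M" "I \<in> indeps M \<Longrightarrow> I \<subseteq> ground M"
    "I \<in> indeps M \<Longrightarrow> J \<subseteq> I \<Longrightarrow> J \<in> indeps M"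
    "I \<in> indeps M \<Longrightarrow> J \<in> indeps M \<Longrightarrow> card I < card J \<Longrightarrow> \<exists>e\<in>J - I. insert e I \<in> indeps M"
    using assms unfolding is_matroid_def by auto
  have "indeps M \<subseteq> Pow (ground M)" using assms unfolding is_matroid_def by auto
  then show "finite (indeps M)" using * finite_subset by blast
  show "I \<in> indeps M \<Longrightarrow> finite I" using * finite_subset by blast
qed

lemma rk_ge:
  assumes "is_matroid M" "I \<in> indeps M" "I \<subseteq> A"
  shows "card I \<le> rk M A"
  unfolding rk_def by (rule Max_ge) (use assms matroidD(5)[OF assms(1)] in auto)

lemma rk_obtain:
  assumes "is_matroid M"
  obtains I where "I \<in> indeps M" "I \<subseteq> A" "card I = rk M A"
proof -
  have "rk M A \<in> card ` {I \<in> indeps M. I \<subseteq> A}"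
    unfolding rk_def by (rule Max_in) (use matroidD(2,5)[OF assms] in auto)
  then show ?thesis using that by auto
qed

lemma rk_extend:
  assumes "is_matroid M" "I \<in> indeps M" "I \<subseteq> A"
  obtains J where "J \<in> indeps M" "I \<subseteq> J" "J \<subseteq> A" "card J = rk M A"
proof -
  have "\<exists>J. J \<in> indeps M \<and> I \<subseteq> J \<and> J \<subseteq> A \<and> card J = rk M A"
    using assms(2,3)
  proof (induction "rk M A - card I" arbitrary: I rule: less_induct)
    case less
    show ?case
    proof (cases "card I = rk M A")
      case False
      then have lt: "card I < rk M A" using rk_ge[OF assms(1) less.prems] by simp
      obtain K where K: "K \<in> indeps M" "K \<subseteq> A" "card K = rk M A" using rk_obtain[OF assms(1)] .
      then obtain e where e: "e \<in> K - I" "insert e I \<in> indeps M"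
        using matroidD(7)[OF assms(1) less.prems(1) K(1)] lt by auto
      have "card (insert e I) = Suc (card I)" using e matroidD(6)[OF assms(1) less.prems(1)] by auto
      then have "rk M A - card (insert e I) < rk M A - card I" using lt by simp
      moreover have "insert e I \<subseteq> A" using e K less.prems by auto
      ultimately show ?thesis using less.hyps[OF _ e(2)] by blast
    next
      case True
      then show ?thesis using less.prems by blast
    qed
  qed
  then show ?thesis using that by auto
qed

lemma rk_mono:
  assumes "is_matroid M" "A \<subseteq> B" shows "rk M A \<le> rk M B"
proof -
  obtain I where "I \<in> indeps M" "I \<subseteq> A" "card I = rk M A" using rk_obtain[OF assms(1)] .
  then show ?thesis using rk_ge[OF assms(1), of I B] assms(2) by auto
qed

lemma rk_insert_le:
  assumes "is_matroid M" shows "rk M (insert e A) \<le> Suc (rk M A)"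
proof -
  obtain I where I: "I \<in> indeps M" "I \<subseteq> insert e A" "card I = rk M (insert e A)"
    using rk_obtain[OF assms(1)] .
  have "I - {e} \<in> indeps M" by (rule matroidD(4)[OF assms I(1)]) auto
  then have "card (I - {e}) \<le> rk M A" using rk_ge[OF assms] I by auto
  moreover have "card I \<le> Suc (card (I - {e}))" by (cases "e \<in> I") (simp_all add: card_Diff_singleton_if)
  ultimately show ?thesis using I by simp
qed

lemma rk_Int_ground: "is_matroid M \<Longrightarrow> rk M (A \<inter> ground M) = rk M A"
proof -
  assume "is_matroid M"
  then have "{I \<in> indeps M. I \<subseteq> A \<inter> ground M} = {I \<in> indeps M. I \<subseteq> A}"
    using matroidD(3) by auto
  then show ?thesis unfolding rk_def by simp
qed

lemma rk_submodular:
  assumes "is_matroid M"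
  shows "rk M (A \<union> B) + rk M (A \<inter> B) \<le> rk M A + rk M B"
proof -
  obtain I where I: "I \<in> indeps M" "I \<subseteq> A \<inter> B" "card I = rk M (A \<inter> B)" using rk_obtain[OF assms(1)] .
  then have "I \<subseteq> A \<union> B" by auto
  then obtain J where J: "J \<in> indeps M" "I \<subseteq> J" "J \<subseteq> A \<union> B" "card J = rk M (A \<union> B)"
    using rk_extend[OF assms I(1)] by blast
  have fin: "finite J" using matroidD(6)[OF assms J(1)] .
  have "J \<inter> A \<in> indeps M" "J \<inter> B \<in> indeps M" by (rule matroidD(4)[OF assms J(1)], auto)+
  then have "card (J \<inter> A) \<le> rk M A" "card (J \<inter> B) \<le> rk M B" using rk_ge[OF assms] by auto
  moreover have "card (J \<inter> A) + card (J \<inter> B) = card J + card (J \<inter> A \<inter> B)"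
  proof -
    have "(J \<inter> A) \<union> (J \<inter> B) = J" "(J \<inter> A) \<inter> (J \<inter> B) = J \<inter> A \<inter> B" using J by auto
    moreover have "finite (J \<inter> A)" "finite (J \<inter> B)" using fin by simp_all
    ultimately show ?thesis using card_Un_Int[of "J \<inter> A" "J \<inter> B"] by simp
  qed
  moreover have "card I \<le> card (J \<inter> A \<inter> B)" by (rule card_mono) (use fin I J in auto)
  ultimately show ?thesis using I J by linarith
qed

lemma rank_function_rk:
  assumes "is_matroid M" shows "rank_function (ground M) (rk M)"
proof -
  have "rk M {} = 0"
  proof -
    obtain I where "I \<in> indeps M" "I \<subseteq> {}" "card I = rk M {}" using rk_obtain[OF assms(1)] .
    then show ?thesis by auto
  qed
  then show ?thesis unfolding rank_function_def submodular_on_def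
    using matroidD(1)[OF assms] rk_mono[OF assms subset_insertI] rk_insert_le[OF assms] rk_submodular[OF assms]
    by auto
qed

lemma rk_le_card: "is_matroid M \<Longrightarrow> finite A \<Longrightarrow> rk M A \<le> card A"
  by (metis card_mono rk_obtain)

lemma indep_iff_rk:
  assumes "is_matroid M"
  shows "I \<in> indeps M \<longleftrightarrow> I \<subseteq> ground M \<and> rk M I = card I"
proof
  assume I: "I \<in> indeps M"
  then show "I \<subseteq> ground M \<and> rk M I = card I"
    using rk_ge[OF assms I order_refl] rk_le_card[OF assms matroidD(6)[OF assms I]] matroidD(3)[OF assms I]
    by auto
next
  assume h: "I \<subseteq> ground M \<and> rk M I = card I"
  obtain J where J: "J \<in> indeps M" "J \<subseteq> I" "card J = rk M I" using rk_obtain[OF assms(1)] .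
  have "finite I" using h matroidD(1)[OF assms] finite_subset by blast
  then have "J = I" using J h by (simp add: card_subset_eq)
  then show "I \<in> indeps M" using J by simp
qed

lemma matroid_of_rank:
  assumes "rank_function E r"
  shows is_matroid_matroid_of_rank: "is_matroid (matroid_of_rank E r)"
    and rk_matroid_of_rank: "A \<subseteq> E \<Longrightarrow> rk (matroid_of_rank E r) A = r A"
proof -
  note R = rank_functionD[OF assms]
  have down: "r J = card J" if "I \<subseteq> E" "r I = card I" "J \<subseteq> I" for I J
    using rank_function_card_le[OF assms that(3,1)] rank_function_le_card[OF assms, of J] that by auto
  have aug: "\<exists>e\<in>J - I. r (insert e I) = card (insert e I)"
    if "I \<subseteq> E" "r I = card I" "J \<subseteq> E" "card I < r J" for I J
  proof (rule ccontr)
    assume n: "\<not> ?thesis"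
    have "r (insert e I) = r I" if e: "e \<in> J - I" for e
    proof -
      have "finite I" using \<open>I \<subseteq> E\<close> R(1) finite_subset by blast
      then have "card (insert e I) = Suc (r I)" using e \<open>r I = card I\<close> by simp
      then have "r (insert e I) \<noteq> Suc (r I)" using n e by metis
      moreover have "e \<in> E" using e \<open>J \<subseteq> E\<close> by blast
      then have "r I \<le> r (insert e I)" "r (insert e I) \<le> Suc (r I)"
        using R(4,5)[of I e] \<open>I \<subseteq> E\<close> by simp_all
      ultimately show ?thesis by linarith
    qed
    then have *: "r (insert e I) = r I" if "e \<in> (I \<union> J) - I" for e using that by blast
    have "r (I \<union> J) = r I"
      by (rule rank_function_closure[OF assms _ _ *]) (use that in blast)+
    moreover have "r J \<le> r (I \<union> J)"
      by (rule rank_function_mono[OF assms]) (use that in blast)+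
    ultimately show False using that(2,4) by linarith
  qed
  show mat: "is_matroid (matroid_of_rank E r)"
  proof -
    have 1: "J \<in> indeps (matroid_of_rank E r)" if "I \<in> indeps (matroid_of_rank E r)" "J \<subseteq> I" for I J
      using down[of I J] that by (auto simp: matroid_of_rank_def)
    have 2: "\<exists>e\<in>J - I. insert e I \<in> indeps (matroid_of_rank E r)"
      if "I \<in> indeps (matroid_of_rank E r)" "J \<in> indeps (matroid_of_rank E r)" and cIJ: "card I < card J" for I J
    proof -
      have "I \<subseteq> E" "r I = card I" "J \<subseteq> E" "r J = card J" using that by (auto simp: matroid_of_rank_def)
      then obtain e where "e \<in> J - I" "r (insert e I) = card (insert e I)"
        using aug[of I J] cIJ by auto
      then show ?thesis using \<open>I \<subseteq> E\<close> \<open>J \<subseteq> E\<close> by (auto simp: matroid_of_rank_def)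
    qed
    have "indeps (matroid_of_rank E r) \<subseteq> Pow E" "{} \<in> indeps (matroid_of_rank E r)"
      "ground (matroid_of_rank E r) = E"
      using R(2) by (auto simp: matroid_of_rank_def)
    then show ?thesis unfolding is_matroid_def using R(1) 1 2 by simp
  qed
  show "rk (matroid_of_rank E r) A = r A" if A: "A \<subseteq> E"
  proof -
    obtain I where I: "I \<in> indeps (matroid_of_rank E r)" "I \<subseteq> A"
      "card I = rk (matroid_of_rank E r) A" using rk_obtain[OF mat] .
    then have I': "I \<subseteq> E" "r I = card I" by (auto simp: matroid_of_rank_def)
    have "\<not> card I < r A"
    proof
      assume "card I < r A"
      then obtain e where e: "e \<in> A - I" "r (insert e I) = card (insert e I)"
        using aug[OF I' A] by blast
      have "card (insert e I) \<le> rk (matroid_of_rank E r) A"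
        by (rule rk_ge[OF mat]) (use e I I' A in \<open>auto simp: matroid_of_rank_def\<close>)
      moreover have "finite I" using I' R(1) finite_subset by blast
      ultimately show False using e I by auto
    qed
    moreover have "r I \<le> r A" using rank_function_mono[OF assms I(2) A] .
    ultimately show ?thesis using I I' by simp
  qed
qed

lemma rk_cong_indeps:
  assumes "\<And>I. I \<subseteq> A \<Longrightarrow> I \<in> indeps M \<longleftrightarrow> I \<in> indeps N"
  shows "rk M A = rk N A"
proof -
  have "{I \<in> indeps M. I \<subseteq> A} = {I \<in> indeps N. I \<subseteq> A}" using assms by auto
  then show ?thesis unfolding rk_def by simp
qed

section \<open>Bases, weights and separators\<close>

lemma bases_iff:
  assumes "is_matroid M"
  shows "B \<in> bases M \<longleftrightarrow> B \<in> indeps M \<and> card B = rk M (ground M)"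
proof
  assume B: "B \<in> bases M"
  then have BI: "B \<in> indeps M" by (simp add: bases_def)
  obtain J where J: "J \<in> indeps M" "B \<subseteq> J" "J \<subseteq> ground M" "card J = rk M (ground M)"
    using rk_extend[OF assms BI matroidD(3)[OF assms BI]] .
  then have "J = B" using B by (auto simp: bases_def)
  then show "B \<in> indeps M \<and> card B = rk M (ground M)" using J by simp
next
  assume B: "B \<in> indeps M \<and> card B = rk M (ground M)"
  have "I = B" if "I \<in> indeps M" "B \<subseteq> I" for I
  proof -
    have "card I \<le> rk M (ground M)" using rk_ge[OF assms that(1) matroidD(3)[OF assms that(1)]] .
    then show ?thesis using B that card_seteq[OF matroidD(6)[OF assms that(1)] that(2)] by auto
  qed
  then show "B \<in> bases M" using B by (auto simp: bases_def)
qed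

lemma card_base_Int_le:
  assumes "is_matroid M" "B \<in> bases M" shows "card (B \<inter> A) \<le> rk M A"
proof -
  have "B \<inter> A \<in> indeps M" using assms bases_iff[OF assms(1)] matroidD(4)[OF assms(1)] by blast
  then show ?thesis using rk_ge[OF assms(1)] by auto
qed

lemma base_extend:
  assumes "is_matroid M" "I \<in> indeps M"
  obtains B where "B \<in> bases M" "I \<subseteq> B"
  using rk_extend[OF assms matroidD(3)[OF assms]] bases_iff[OF assms(1)] by metis

lemma base_chain:
  assumes "is_matroid M" "X \<subseteq> Y"
  obtains B where "B \<in> bases M" "card (B \<inter> X) = rk M X" "card (B \<inter> Y) = rk M Y"
proof -
  obtain I where I: "I \<in> indeps M" "I \<subseteq> X" "card I = rk M X" using rk_obtain[OF assms(1)] .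
  have "I \<subseteq> Y" using I assms(2) by blast
  then obtain J where J: "J \<in> indeps M" "I \<subseteq> J" "J \<subseteq> Y" "card J = rk M Y"
    using rk_extend[OF assms(1) I(1)] by blast
  obtain B where B: "B \<in> bases M" "J \<subseteq> B" using base_extend[OF assms(1) J(1)] .
  have fin: "finite B" using B bases_iff[OF assms(1)] matroidD(6)[OF assms(1)] by auto
  have "card I \<le> card (B \<inter> X)" "card J \<le> card (B \<inter> Y)"
    by (rule card_mono; use fin I J B in auto)+
  then show ?thesis using that[OF B(1)] card_base_Int_le[OF assms(1) B(1), of X]
      card_base_Int_le[OF assms(1) B(1), of Y] I J by auto
qed

text \<open>The greedy principle: a base that could contain more elements of \<open>U\<close> would become heavier by a single
  exchange.\<close>

lemma max_weight_base_upper_set: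
  fixes w :: "'a \<Rightarrow> real"
  assumes M: "is_matroid M" and B: "B \<in> bases M"
    and max: "\<And>B'. B' \<in> bases M \<Longrightarrow> sum w B' \<le> sum w B"
    and U: "\<And>a b. a \<in> U \<Longrightarrow> b \<in> ground M - U \<Longrightarrow> w b < w a"
  shows "card (B \<inter> U) = rk M U"
proof (rule ccontr)
  assume "card (B \<inter> U) \<noteq> rk M U"
  then have lt: "card (B \<inter> U) < rk M U" using card_base_Int_le[OF M B, of U] by simp
  have BI: "B \<in> indeps M" and Bc: "card B = rk M (ground M)" using B bases_iff[OF M] by auto
  have fB: "finite B" using matroidD(6)[OF M BI] .
  have BU: "B \<inter> U \<in> indeps M" using matroidD(4)[OF M BI] by auto
  obtain J where J: "J \<in> indeps M" "J \<subseteq> U" "card J = rk M U" using rk_obtain[OF M] .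
  then obtain e where e: "e \<in> J - B \<inter> U" "insert e (B \<inter> U) \<in> indeps M"
    using matroidD(7)[OF M BU J(1)] lt by auto
  have eB: "e \<notin> B" "e \<in> U" using e J by auto
  have sub: "insert e (B \<inter> U) \<subseteq> insert e B" by auto
  obtain K where K: "K \<in> indeps M" "insert e (B \<inter> U) \<subseteq> K" "K \<subseteq> insert e B" "card K = rk M (insert e B)"
    using rk_extend[OF M e(2) sub] .
  have "rk M (insert e B) = rk M (ground M)"
  proof (rule antisym)
    have "insert e B \<subseteq> ground M" using matroidD(3)[OF M BI] matroidD(3)[OF M J(1)] e by auto
    then show "rk M (insert e B) \<le> rk M (ground M)" using rk_mono[OF M] by auto
    show "rk M (ground M) \<le> rk M (insert e B)"
      using rk_ge[OF M BI, of "insert e B"] Bc by auto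
  qed
  then have KB: "K \<in> bases M" and Kc: "card K = card B" using K Bc bases_iff[OF M] by auto
  have "card (insert e B - K) = 1"
    using K fB eB Kc by (subst card_Diff_subset) (auto intro: finite_subset)
  then obtain b where b: "insert e B - K = {b}" by (auto simp: card_1_singleton_iff)
  then have bB: "b \<in> B" "b \<notin> U" "K = insert e (B - {b})" using K by auto
  have "b \<in> ground M" using bB matroidD(3)[OF M BI] by auto
  then have "w b < w e" using U eB bB by auto
  moreover have "sum w K = w e + (sum w B - w b)"
    using bB eB fB by (simp add: sum_diff1)
  ultimately show False using max[OF KB] by simp
qed

text \<open>All bases have maximum weight, so the greedy principle applies to each of them; one base contains a
  basis of the complement of \<open>U\<close>.\<close>

lemma constant_weight_separator:
  fixes w :: "'a \<Rightarrow> real"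
  assumes M: "is_matroid M"
    and const: "\<And>B B'. B \<in> bases M \<Longrightarrow> B' \<in> bases M \<Longrightarrow> sum w B = sum w B'"
    and U: "U \<subseteq> ground M" "\<And>a b. a \<in> U \<Longrightarrow> b \<in> ground M - U \<Longrightarrow> w b < w a"
  shows "rk M U + rk M (ground M - U) = rk M (ground M)"
proof -
  obtain B where B: "B \<in> bases M" "card (B \<inter> (ground M - U)) = rk M (ground M - U)"
    using base_chain[OF M order_refl] by metis
  have "card (B \<inter> U) = rk M U"
  proof (rule max_weight_base_upper_set[OF M B(1) _ U(2)])
    fix B' assume "B' \<in> bases M"
    then show "sum w B' \<le> sum w B" using const[OF _ B(1)] by fastforce
  qed
  moreover have "card B = card (B \<inter> U) + card (B \<inter> (ground M - U))"
  proof -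
    have BI: "B \<in> indeps M" using B bases_iff[OF M] by auto
    have "B = (B \<inter> U) \<union> (B \<inter> (ground M - U))" using matroidD(3)[OF M BI] by auto
    moreover have "card ((B \<inter> U) \<union> (B \<inter> (ground M - U))) = card (B \<inter> U) + card (B \<inter> (ground M - U))"
      by (rule card_Un_disjoint) (use matroidD(6)[OF M BI] in auto)
    ultimately show ?thesis by simp
  qed
  ultimately show ?thesis using B bases_iff[OF M] by auto
qed

text \<open>The defect of additivity can only grow with the set, and it is zero for the whole ground set.\<close>

lemma rank_function_partition_additive:
  assumes R: "rank_function E r" and P: "partition_on E \<P>" and sum: "(\<Sum>P\<in>\<P>. r P) = r E"
    and A: "A \<subseteq> E"
  shows "(\<Sum>P\<in>\<P>. r (A \<inter> P)) = r A"
proof -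
  have finP: "finite \<P>" using P rank_functionD(1)[OF R] finite_elements by blast
  have PE: "P \<subseteq> E" if "P \<in> \<P>" for P using P that by (auto simp: partition_on_def)
  have disj: "P \<inter> Q = {}" if "P \<in> \<P>" "Q \<in> \<P>" "P \<noteq> Q" for P Q
    using P that by (auto simp: partition_on_def disjoint_def)
  have le: "int (\<Sum>P\<in>\<P>. r (A \<inter> P)) - int (r A) \<le> int (\<Sum>P\<in>\<P>. r (E \<inter> P)) - int (r E)"
  proof (rule rank_function_subset_induct[OF R A order_refl])
    fix e C assume h: "A \<subseteq> C" "C \<subseteq> E" "e \<in> E - C"
      "int (\<Sum>P\<in>\<P>. r (A \<inter> P)) - int (r A) \<le> int (\<Sum>P\<in>\<P>. r (C \<inter> P)) - int (r C)"
    obtain Q where Q: "Q \<in> \<P>" "e \<in> Q" using P h by (auto simp: partition_on_def)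
    have other: "insert e C \<inter> P = C \<inter> P" if "P \<in> \<P> - {Q}" for P using disj[of P Q] that Q by auto
    have "(\<Sum>P\<in>\<P>. r (insert e C \<inter> P)) = r (insert e (C \<inter> Q)) + (\<Sum>P\<in>\<P> - {Q}. r (C \<inter> P))"
      using sum.remove[OF finP Q(1), of "\<lambda>P. r (insert e C \<inter> P)"] other Q by simp
    moreover have "(\<Sum>P\<in>\<P>. r (C \<inter> P)) = r (C \<inter> Q) + (\<Sum>P\<in>\<P> - {Q}. r (C \<inter> P))"
      using sum.remove[OF finP Q(1), of "\<lambda>P. r (C \<inter> P)"] by simp
    moreover have "r (insert e C) + r (C \<inter> Q) \<le> r C + r (insert e (C \<inter> Q))"
    proof -
      have "C \<union> insert e (C \<inter> Q) = insert e C" "C \<inter> insert e (C \<inter> Q) = C \<inter> Q" using h Q by auto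
      then show ?thesis
        using submodular_onD[OF rank_functionD(3)[OF R], of C "insert e (C \<inter> Q)"] h Q by auto
    qed
    ultimately show "int (\<Sum>P\<in>\<P>. r (A \<inter> P)) - int (r A)
        \<le> int (\<Sum>P\<in>\<P>. r (insert e C \<inter> P)) - int (r (insert e C))" using h(4) by linarith
  qed simp
  have "(\<Sum>P\<in>\<P>. r (E \<inter> P)) = r E" using sum PE by (simp add: Int_absorb1)
  then have *: "(\<Sum>P\<in>\<P>. r (A \<inter> P)) \<le> r A" using le by linarith
  have "r (A \<inter> \<Union>\<Q>) \<le> (\<Sum>P\<in>\<Q>. r (A \<inter> P))" if "finite \<Q>" "\<Q> \<subseteq> \<P>" for \<Q>
    using that
  proof (induction \<Q>)
    case empty then show ?case using rank_functionD(2)[OF R] by simp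
  next
    case (insert P \<Q>)
    have "r (A \<inter> P \<union> A \<inter> \<Union>\<Q>) \<le> r (A \<inter> P) + r (A \<inter> \<Union>\<Q>)"
      using submodular_onD[OF rank_functionD(3)[OF R], of "A \<inter> P" "A \<inter> \<Union>\<Q>"] A by force
    then show ?case using insert by (simp add: Int_Un_distrib)
  qed
  from this[OF finP order_refl] have "r A \<le> (\<Sum>P\<in>\<P>. r (A \<inter> P))"
    using P A by (simp add: partition_on_def Int_absorb2)
  with * show ?thesis by simp
qed

lemma rank_function_separator_additive:
  assumes R: "rank_function E r" and "X \<subseteq> E" and sum: "r X + r (E - X) = r E" and A: "A \<subseteq> E"
  shows "r (A \<inter> X) + r (A - X) = r A"
proof -
  have s: "submodular_on E (\<lambda>A. int (r A))"
    using rank_functionD(3)[OF R] unfolding submodular_on_def by (metis of_nat_add zle_int)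
  have "int (r ((A \<inter> X) \<union> (A - X))) = int (r (A \<inter> X)) + int (r (A - X))"
    by (rule submodular_additive_restrict[OF s, of X "E - X"])
      (use assms rank_functionD(2)[OF R] in \<open>auto simp: Un_absorb1 simp flip: of_nat_add\<close>)
  moreover have "(A \<inter> X) \<union> (A - X) = A" by auto
  ultimately show ?thesis by simp
qed

definition restricted :: "'a matroid \<Rightarrow> 'a set \<Rightarrow> 'a matroid" where
  "restricted M P = \<lparr>ground = P, indeps = {I \<in> indeps M. I \<subseteq> P}\<rparr>"

lemma restricted_simps [simp]:
  "ground (restricted M P) = P" "indeps (restricted M P) = {I \<in> indeps M. I \<subseteq> P}"
  by (simp_all add: restricted_def)

lemma is_matroid_restricted:
  assumes "is_matroid M" "P \<subseteq> ground M" shows "is_matroid (restricted M P)"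
proof -
  have "finite P" using assms matroidD(1) finite_subset by blast
  moreover have "\<exists>e\<in>J - I. insert e I \<in> indeps M \<and> e \<in> P"
    if "I \<in> indeps M" "J \<in> indeps M" "J \<subseteq> P" "card I < card J" for I J
    using matroidD(7)[OF assms(1) that(1,2,4)] that(3) by blast
  ultimately show ?thesis using matroidD(2,4)[OF assms(1)]
    unfolding is_matroid_def by auto
qed

lemma is_direct_sum_restricted:
  assumes M: "is_matroid M" and P: "partition_on (ground M) \<P>"
    and sum: "(\<Sum>P\<in>\<P>. rk M P) = rk M (ground M)"
  shows "is_direct_sum M (restricted M ` \<P>)"
proof -
  have finP: "finite \<P>" using P matroidD(1)[OF M] finite_elements by blast
  have glue: "I \<in> indeps M" if I: "I \<subseteq> ground M" "\<forall>P\<in>\<P>. I \<inter> P \<in> indeps M" for I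
  proof -
    have "rk M I = (\<Sum>P\<in>\<P>. rk M (I \<inter> P))"
      using rank_function_partition_additive[OF rank_function_rk[OF M] P sum I(1)] by simp
    also have "\<dots> = (\<Sum>P\<in>\<P>. card (I \<inter> P))"
      using I(2) indep_iff_rk[OF M] by (intro sum.cong) auto
    also have "\<dots> = card (\<Union>P\<in>\<P>. I \<inter> P)"
    proof (rule card_UN_disjoint[symmetric, OF finP])
      show "\<forall>P\<in>\<P>. finite (I \<inter> P)" using finite_subset[OF I(1) matroidD(1)[OF M]] by simp
      show "\<forall>P\<in>\<P>. \<forall>Q\<in>\<P>. P \<noteq> Q \<longrightarrow> (I \<inter> P) \<inter> (I \<inter> Q) = {}"
        using P unfolding partition_on_def disjoint_def by blast
    qed
    also have "(\<Union>P\<in>\<P>. I \<inter> P) = I" using I P by (auto simp: partition_on_def)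
    finally show ?thesis using I indep_iff_rk[OF M] by simp
  qed
  have trace: "I \<inter> P \<in> indeps M" if "I \<in> indeps M" for I P
    by (rule matroidD(4)[OF M that]) simp
  have "indeps M = {I. I \<subseteq> ground M \<and> (\<forall>P\<in>\<P>. I \<inter> P \<in> indeps M)}"
    using glue trace matroidD(3)[OF M] by blast
  then have "indeps M = {I. I \<subseteq> ground M \<and> (\<forall>N\<in>restricted M ` \<P>. I \<inter> ground N \<in> indeps N)}"
    by simp
  moreover have "disjoint_family_on ground (restricted M ` \<P>)"
    using P unfolding disjoint_family_on_def partition_on_def disjoint_def
    by (metis imageE restricted_simps(1))
  moreover have "ground M = \<Union>\<P>" using P by (simp add: partition_on_def)
  ultimately show ?thesis unfolding is_direct_sum_def by simp
qed

lemma direct_sum_summand: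
  assumes M: "is_matroid M" and D: "is_direct_sum M \<N>" and N: "N \<in> \<N>" and I: "I \<subseteq> ground N"
  shows "I \<in> indeps M \<longleftrightarrow> I \<in> indeps N"
proof -
  have e: "{} \<in> indeps N'" if "N' \<in> \<N>" for N'
    using D matroidD(2)[OF M] that unfolding is_direct_sum_def by auto
  have "I \<inter> ground N' = {}" if "N' \<in> \<N>" "N' \<noteq> N" for N'
    using D that N I unfolding is_direct_sum_def disjoint_family_on_def by blast
  then have "(\<forall>N'\<in>\<N>. I \<inter> ground N' \<in> indeps N') \<longleftrightarrow> I \<in> indeps N"
    using e N I by (metis inf.absorb1)
  moreover have "I \<subseteq> ground M" using D N I unfolding is_direct_sum_def by auto
  ultimately show ?thesis using D unfolding is_direct_sum_def by auto
qed

lemma direct_sum_rk: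
  assumes M: "is_matroid M" and D: "is_direct_sum M \<N>" 
  shows "partition_on (ground M) (ground ` \<N> - {{}})"
    and "(\<Sum>P\<in>ground ` \<N> - {{}}. rk M P) = rk M (ground M)"
proof -
  let ?P = "ground ` \<N> - {{}}"
  have dj: "ground N \<inter> ground N' = {}" if "N \<in> \<N>" "N' \<in> \<N>" "N \<noteq> N'" for N N'
    using D that unfolding is_direct_sum_def disjoint_family_on_def by metis
  show P: "partition_on (ground M) ?P"
  proof -
    have "\<Union>?P = ground M" using D unfolding is_direct_sum_def by auto
    moreover have "disjoint ?P"
    proof (rule disjointI)
      fix a b assume ab: "a \<in> ?P" "b \<in> ?P" "a \<noteq> b"
      then obtain N N' where "N \<in> \<N>" "N' \<in> \<N>" "a = ground N" "b = ground N'" by blast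
      then show "a \<inter> b = {}" using dj ab(3) by blast
    qed
    ultimately show ?thesis unfolding partition_on_def by blast
  qed
  have finP: "finite ?P" using P matroidD(1)[OF M] finite_elements by blast
  have "\<exists>I. \<forall>P\<in>?P. I P \<in> indeps M \<and> I P \<subseteq> P \<and> card (I P) = rk M P"
    by (intro bchoice ballI) (metis rk_obtain[OF M])
  then obtain I where I: "\<And>P. P \<in> ?P \<Longrightarrow> I P \<in> indeps M \<and> I P \<subseteq> P \<and> card (I P) = rk M P" by auto
  let ?I = "\<Union>P\<in>?P. I P"
  have sub: "?I \<subseteq> ground M" using I P by (fastforce simp: partition_on_def)
  have "?I \<inter> ground N \<in> indeps N" if N: "N \<in> \<N>" for N
  proof (cases "ground N = {}")
    case True
    then show ?thesis using D matroidD(2)[OF M] N unfolding is_direct_sum_def by auto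
  next
    case False
    then have gN: "ground N \<in> ?P" using N by auto
    have other: "I P \<inter> ground N = {}" if "P \<in> ?P" "P \<noteq> ground N" for P
      using P I[OF that(1)] that gN unfolding partition_on_def disjoint_def by blast
    have "?I \<inter> ground N = I (ground N)"
    proof
      show "?I \<inter> ground N \<subseteq> I (ground N)"
      proof
        fix x assume "x \<in> ?I \<inter> ground N"
        then obtain P where P: "P \<in> ?P" "x \<in> I P" "x \<in> ground N" by blast
        then show "x \<in> I (ground N)" using other[OF P(1)] by (cases "P = ground N") auto
      qed
      show "I (ground N) \<subseteq> ?I \<inter> ground N" using gN I[OF gN] by blast
    qed
    then show ?thesis using direct_sum_summand[OF M D N, of "I (ground N)"] I[OF gN] by auto
  qed
  then have ind: "?I \<in> indeps M" using D sub unfolding is_direct_sum_def by auto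
  have "card ?I = (\<Sum>P\<in>?P. card (I P))"
  proof (rule card_UN_disjoint[OF finP])
    show "\<forall>P\<in>?P. finite (I P)" using I matroidD(6)[OF M] by blast
    show "\<forall>i\<in>?P. \<forall>j\<in>?P. i \<noteq> j \<longrightarrow> I i \<inter> I j = {}"
    proof (intro ballI impI)
      fix i j assume ij: "i \<in> ?P" "j \<in> ?P" "i \<noteq> j"
      then have "i \<inter> j = {}" using P unfolding partition_on_def disjoint_def by blast
      then show "I i \<inter> I j = {}" using I[OF ij(1)] I[OF ij(2)] by blast
    qed
  qed
  also have "\<dots> = (\<Sum>P\<in>?P. rk M P)" using I by (intro sum.cong) auto
  finally have ge: "(\<Sum>P\<in>?P. rk M P) \<le> rk M (ground M)" using rk_ge[OF M ind sub] by simp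
  have "rk M (\<Union>\<Q>) \<le> (\<Sum>P\<in>\<Q>. rk M P)" if "finite \<Q>" for \<Q>
    using that
  proof (induction \<Q>)
    case empty then show ?case using rank_functionD(2)[OF rank_function_rk[OF M]] by simp
  next
    case (insert P \<Q>)
    then show ?case using rk_submodular[OF M, of P "\<Union>\<Q>"] by simp
  qed
  from this[OF finP] show "(\<Sum>P\<in>?P. rk M P) = rk M (ground M)"
    using ge P by (simp add: partition_on_def)
qed

text \<open>Bases of the summands of a direct sum combine freely, so the ranks of a summand and of its complement
  add up. Conversely, if the ranks of two complementary sets add up, then the union of independent
  subsets of the two sets is independent.\<close>

lemma not_connected_matroid_iff:
  assumes M: "is_matroid M"
  shows "\<not> connected_matroid M \<longleftrightarrow>
    (\<exists>X. X \<noteq> {} \<and> X \<subset> ground M \<and> rk M X + rk M (ground M - X) = rk M (ground M))"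
proof
  assume "\<not> connected_matroid M"
  then obtain \<N> where N: "2 \<le> card \<N>" "\<forall>N\<in>\<N>. is_matroid N \<and> ground N \<noteq> {}" "is_direct_sum M \<N>"
    unfolding connected_matroid_def by blast
  then obtain N1 where N1: "N1 \<in> \<N>" by fastforce
  have "\<not> \<N> \<subseteq> {N1}" using N(1) card_mono[of "{N1}" \<N>] by auto
  then obtain N2 where N2: "N2 \<in> \<N>" "N2 \<noteq> N1" by auto
  let ?X = "ground N1"
  have disj: "ground N1 \<inter> ground N2 = {}" "ground N1 \<subseteq> ground M" "ground N2 \<subseteq> ground M"
    using N(3) N1 N2 unfolding is_direct_sum_def disjoint_family_on_def by auto
  have proper: "?X \<noteq> {}" "?X \<subset> ground M"
  proof -
    show "?X \<noteq> {}" using N1 N(2) by blast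
    have "ground N2 \<noteq> {}" using N2 N(2) by blast
    then show "?X \<subset> ground M" using disj by blast
  qed
  note P = direct_sum_rk[OF M N(3)]
  let ?P = "ground ` \<N> - {{}}"
  have finP: "finite ?P" using P matroidD(1)[OF M] finite_elements by blast
  have XP: "?X \<in> ?P" using N1 proper by auto
  have "(\<Sum>Q\<in>?P. rk M ((ground M - ?X) \<inter> Q)) = rk M (ground M - ?X)"
    by (rule rank_function_partition_additive[OF rank_function_rk[OF M] P]) auto
  moreover have "(\<Sum>Q\<in>?P. rk M ((ground M - ?X) \<inter> Q)) = (\<Sum>Q\<in>?P - {?X}. rk M Q)"
  proof -
    have "(ground M - ?X) \<inter> Q = Q" if "Q \<in> ?P - {?X}" for Q
    proof -
      have "Q \<inter> ?X = {}" using disjointD[OF partition_onD2[OF P(1)], of Q ?X] that XP by blast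
      moreover have "Q \<subseteq> ground M" using partition_onD1[OF P(1)] that by blast
      ultimately show ?thesis by blast
    qed
    moreover have "(ground M - ?X) \<inter> ?X = {}" by auto
    ultimately show ?thesis
      using sum.remove[OF finP XP, of "\<lambda>Q. rk M ((ground M - ?X) \<inter> Q)"]
        rank_functionD(2)[OF rank_function_rk[OF M]] by simp
  qed
  ultimately have "rk M ?X + rk M (ground M - ?X) = rk M (ground M)"
    using P(2) sum.remove[OF finP XP, of "rk M"] by simp
  then show "\<exists>X. X \<noteq> {} \<and> X \<subset> ground M \<and> rk M X + rk M (ground M - X) = rk M (ground M)"
    using proper by blast
next
  assume "\<exists>X. X \<noteq> {} \<and> X \<subset> ground M \<and> rk M X + rk M (ground M - X) = rk M (ground M)"
  then obtain X where X: "X \<noteq> {}" "X \<subset> ground M" "rk M X + rk M (ground M - X) = rk M (ground M)"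
    by blast
  let ?P = "{X, ground M - X}"
  have ne: "X \<noteq> ground M - X" using X by auto
  have P: "partition_on (ground M) ?P"
    using X unfolding partition_on_def disjoint_def by auto
  have D: "is_direct_sum M (restricted M ` ?P)"
    by (rule is_direct_sum_restricted[OF M P]) (use X ne in auto)
  have "restricted M X \<noteq> restricted M (ground M - X)" using ne by (metis restricted_simps(1))
  then have "2 \<le> card (restricted M ` ?P)" by simp
  moreover have "\<forall>N\<in>restricted M ` ?P. is_matroid N \<and> ground N \<noteq> {}"
    using is_matroid_restricted[OF M] X by auto
  ultimately show "\<not> connected_matroid M"
    unfolding connected_matroid_def not_not using D
    by (intro exI[of _ "restricted M ` ?P"] conjI)
qed

text \<open>A partition into as many separating parts as possible consists of connected components.\<close>

lemma connected_partition:
  assumes M: "is_matroid M"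
  obtains \<P> where "partition_on (ground M) \<P>" "(\<Sum>P\<in>\<P>. rk M P) = rk M (ground M)"
    "\<And>P X. P \<in> \<P> \<Longrightarrow> X \<noteq> {} \<Longrightarrow> X \<subset> P \<Longrightarrow> rk M P < rk M X + rk M (P - X)"
proof -
  define good where "good \<P> \<longleftrightarrow> partition_on (ground M) \<P> \<and> (\<Sum>P\<in>\<P>. rk M P) = rk M (ground M)" for \<P>
  have fin: "finite \<P>" "card \<P> \<le> card (ground M)" if "good \<P>" for \<P>
  proof -
    have p: "partition_on (ground M) \<P>" using that by (simp add: good_def)
    show f: "finite \<P>" using p matroidD(1)[OF M] finite_elements by blast
    have "card (ground M) = (\<Sum>P\<in>\<P>. card P)"
    proof (rule product_partition[OF p])
      fix P assume "P \<in> \<P>"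
      then have "P \<subseteq> ground M" using p by (auto simp: partition_on_def)
      then show "finite P" using matroidD(1)[OF M] finite_subset by blast
    qed
    moreover have "(\<Sum>P\<in>\<P>. 1) \<le> (\<Sum>P\<in>\<P>. card P)"
    proof (rule sum_mono)
      fix P assume "P \<in> \<P>"
      then have "finite P" "P \<noteq> {}" using p matroidD(1)[OF M] unfolding partition_on_def
        by (auto intro: finite_subset)
      then show "1 \<le> card P" by (simp add: Suc_le_eq card_gt_0_iff)
    qed
    ultimately show "card \<P> \<le> card (ground M)" by simp
  qed
  have "\<exists>\<P>. good \<P>"
  proof (cases "ground M = {}")
    case True
    then have "good {}" using rank_functionD(2)[OF rank_function_rk[OF M]]
      by (simp add: good_def partition_on_def)
    then show ?thesis ..
  next
    case False
    then have "good {ground M}" by (simp add: good_def partition_on_def)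
    then show ?thesis ..
  qed
  then obtain \<P> where P: "good \<P>" "\<And>\<Q>. good \<Q> \<Longrightarrow> card \<Q> \<le> card \<P>"
    using ex_has_greatest_nat[of good _ card "Suc (card (ground M))"] fin(2) less_Suc_eq_le by blast
  have irr: "rk M P < rk M X + rk M (P - X)" if PP: "P \<in> \<P>" and X: "X \<noteq> {}" "X \<subset> P" for P X
  proof (rule ccontr)
    assume "\<not> ?thesis"
    moreover have "rk M (X \<union> (P - X)) \<le> rk M X + rk M (P - X)"
      using rk_submodular[OF M, of X "P - X"] by simp
    moreover have "X \<union> (P - X) = P" using X by auto
    ultimately have eq: "rk M P = rk M X + rk M (P - X)" by simp
    have p: "partition_on (ground M) \<P>" using P by (simp add: good_def)
    let ?Q = "insert X (insert (P - X) (\<P> - {P}))"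
    have disj: "P \<inter> Q = {}" if "Q \<in> \<P> - {P}" for Q
      using p PP that unfolding partition_on_def disjoint_def by blast
    have neQ: "{} \<notin> \<P>" using p by (simp add: partition_on_def)
    have nin: "X \<notin> \<P> - {P}" "P - X \<notin> \<P> - {P}" "X \<noteq> P - X" "P - X \<noteq> {}"
      using disj[of X] disj[of "P - X"] X by auto
    have pQ: "partition_on (ground M) ?Q"
    proof -
      have "\<Union>?Q = ground M" using p PP X unfolding partition_on_def by auto
      moreover have "disjoint ?Q"
      proof (rule disjointI)
        fix a b assume ab: "a \<in> ?Q" "b \<in> ?Q" "a \<noteq> b"
        have 3: "\<And>Q. Q \<in> \<P> - {P} \<Longrightarrow> X \<inter> Q = {} \<and> (P - X) \<inter> Q = {} \<and> Q \<inter> X = {} \<and> Q \<inter> (P - X) = {}"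
          using disj X by blast
        have 2: "\<And>Q R. Q \<in> \<P> \<Longrightarrow> R \<in> \<P> \<Longrightarrow> Q \<noteq> R \<Longrightarrow> Q \<inter> R = {}"
          using p unfolding partition_on_def disjoint_def by blast
        have 4: "c \<inter> d = {}" if cd: "c \<in> \<P> - {P}" "d \<in> ?Q" "c \<noteq> d" for c d
        proof -
          consider "d = X" | "d = P - X" | "d \<in> \<P>" using cd(2) by blast
          then show ?thesis
          proof cases
            case 3
            then show ?thesis using 2[of c d] cd by simp
          qed (use 3[OF cd(1)] in simp_all)
        qed
        consider "a \<in> \<P> - {P}" | "b \<in> \<P> - {P}" | "a = X \<and> b = P - X" | "a = P - X \<and> b = X"
          using ab by blast
        then show "a \<inter> b = {}"
        proof cases
          assume "a \<in> \<P> - {P}"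
          then show ?thesis using 4[of a b] ab by simp
        next
          assume "b \<in> \<P> - {P}"
          then show ?thesis using 4[of b a] ab by (simp add: Int_commute)
        qed auto
      qed
      moreover have "{} \<notin> ?Q" using neQ nin(4) X(1) by blast
      ultimately show ?thesis unfolding partition_on_def by simp
    qed
    have finP: "finite \<P>" using fin P by simp
    have "(\<Sum>Q\<in>?Q. rk M Q) = rk M X + (rk M (P - X) + (\<Sum>Q\<in>\<P> - {P}. rk M Q))"
      using finP nin by simp
    also have "\<dots> = (\<Sum>Q\<in>\<P>. rk M Q)" using sum.remove[OF finP PP, of "rk M"] eq by simp
    finally have "good ?Q" using P(1) pQ by (simp add: good_def)
    moreover have "card ?Q = Suc (card \<P>)"
      using finP nin PP card_Suc_Diff1[OF finP PP] by simp
    ultimately show False using P(2)[of ?Q] by simp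
  qed
  show ?thesis using that[of \<P>] P(1) irr unfolding good_def by blast
qed

section \<open>Contraction\<close>

text \<open>All maximal independent subsets of \<open>K\<close> span \<open>K\<close>, so whether \<open>I\<close> can be added to such a subset
  depends only on the rank of \<open>I \<union> K\<close>.\<close>

lemma contraction_matroid_of_rank:
  assumes M: "is_matroid M" and K: "K \<subseteq> ground M"
  shows "rank_function (ground M - K) (\<lambda>A. rk M (A \<union> K) - rk M K)"
    and "contraction M K = matroid_of_rank (ground M - K) (\<lambda>A. rk M (A \<union> K) - rk M K)"
proof -
  let ?r = "\<lambda>A. rk M (A \<union> K) - rk M K"
  have ge: "rk M K \<le> rk M (A \<union> K)" for A using rk_mono[OF M] by auto
  show "rank_function (ground M - K) ?r"
    unfolding rank_function_def submodular_on_def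
  proof (intro conjI allI impI)
    show "finite (ground M - K)" using matroidD(1)[OF M] by simp
    show "rk M ({} \<union> K) - rk M K = 0" by simp
    fix A e
    show "rk M (A \<union> K) - rk M K \<le> rk M (insert e A \<union> K) - rk M K"
      by (intro diff_le_mono rk_mono[OF M]) auto
    show "rk M (insert e A \<union> K) - rk M K \<le> Suc (rk M (A \<union> K) - rk M K)"
      using rk_insert_le[OF M, of e "A \<union> K"] ge[of A] by simp
  next
    fix A B assume "A \<subseteq> ground M - K" "B \<subseteq> ground M - K"
    have "(A \<union> K) \<union> (B \<union> K) = A \<union> B \<union> K" "(A \<union> K) \<inter> (B \<union> K) = A \<inter> B \<union> K" by auto
    then show "rk M (A \<union> B \<union> K) - rk M K + (rk M (A \<inter> B \<union> K) - rk M K)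
      \<le> rk M (A \<union> K) - rk M K + (rk M (B \<union> K) - rk M K)"
      using rk_submodular[OF M, of "A \<union> K" "B \<union> K"] ge[of A] ge[of B] ge[of "A \<inter> B"] ge[of "A \<union> B"]
      by simp
  qed
  have finK: "finite K" using K matroidD(1)[OF M] finite_subset by blast
  have "(\<exists>B. B \<subseteq> K \<and> B \<in> indeps M \<and> (\<forall>B'\<in>indeps M. B \<subseteq> B' \<and> B' \<subseteq> K \<longrightarrow> B' = B) \<and> I \<union> B \<in> indeps M)
      \<longleftrightarrow> ?r I = card I" if I: "I \<subseteq> ground M - K" for I
  proof -
    have finI: "finite I" using I matroidD(1)[OF M] finite_subset by blast
    have key: "I \<union> B \<in> indeps M \<longleftrightarrow> ?r I = card I"
      if B: "B \<subseteq> K" "B \<in> indeps M" "card B = rk M K" for B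
    proof -
      have rB: "rk M B = card B" using indep_iff_rk[OF M] B by auto
      have "(I \<union> B) \<union> K = I \<union> K" "(I \<union> B) \<inter> K = B" using I B by auto
      then have "rk M (I \<union> K) + rk M B \<le> rk M (I \<union> B) + rk M K"
        using rk_submodular[OF M, of "I \<union> B" K] by simp
      moreover have "rk M (I \<union> B) \<le> rk M (I \<union> K)" using rk_mono[OF M, of "I \<union> B" "I \<union> K"] B by auto
      ultimately have "rk M (I \<union> B) = rk M (I \<union> K)" using rB B by simp
      moreover have "card (I \<union> B) = card I + card B"
        by (rule card_Un_disjoint) (use finI I B finK in \<open>auto intro: finite_subset\<close>)
      moreover have "I \<union> B \<subseteq> ground M" using I B K by auto
      ultimately show ?thesis using indep_iff_rk[OF M, of "I \<union> B"] B ge[of I] by auto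
    qed
    show ?thesis
    proof
      assume "\<exists>B. B \<subseteq> K \<and> B \<in> indeps M \<and> (\<forall>B'\<in>indeps M. B \<subseteq> B' \<and> B' \<subseteq> K \<longrightarrow> B' = B) \<and> I \<union> B \<in> indeps M"
      then obtain B where B: "B \<subseteq> K" "B \<in> indeps M" "\<forall>B'\<in>indeps M. B \<subseteq> B' \<and> B' \<subseteq> K \<longrightarrow> B' = B"
        "I \<union> B \<in> indeps M" by blast
      obtain J where J: "J \<in> indeps M" "B \<subseteq> J" "J \<subseteq> K" "card J = rk M K" using rk_extend[OF M B(2,1)] .
      then have "J = B" using B by auto
      then show "?r I = card I" using key[OF B(1,2)] J B by auto
    next
      assume r: "?r I = card I"
      obtain B where B: "B \<in> indeps M" "B \<subseteq> K" "card B = rk M K" using rk_obtain[OF M] .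
      have "B' = B" if "B' \<in> indeps M" "B \<subseteq> B'" "B' \<subseteq> K" for B'
        using rk_ge[OF M that(1,3)] card_seteq[OF matroidD(6)[OF M that(1)] that(2)] B by auto
      then show "\<exists>B. B \<subseteq> K \<and> B \<in> indeps M \<and> (\<forall>B'\<in>indeps M. B \<subseteq> B' \<and> B' \<subseteq> K \<longrightarrow> B' = B) \<and> I \<union> B \<in> indeps M"
        using key[OF B(2,1,3)] B r by blast
    qed
  qed
  then show "contraction M K = matroid_of_rank (ground M - K) ?r"
    unfolding contraction_def matroid_of_rank_def by auto
qed

lemma is_matroid_contraction:
  "is_matroid M \<Longrightarrow> K \<subseteq> ground M \<Longrightarrow> is_matroid (contraction M K)"
  using contraction_matroid_of_rank is_matroid_matroid_of_rank by metis

lemma rk_contraction: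
  assumes "is_matroid M" "K \<subseteq> ground M" "A \<subseteq> ground M - K"
  shows "rk (contraction M K) A = rk M (A \<union> K) - rk M K"
  unfolding contraction_matroid_of_rank(2)[OF assms(1,2)]
  by (rule rk_matroid_of_rank[OF contraction_matroid_of_rank(1)[OF assms(1,2)] assms(3)])

lemma ground_contraction [simp]: "ground (contraction M K) = ground M - K"
  by (simp add: contraction_def)

section \<open>Matroids with a direct sum decomposition\<close>

locale matroid_partition =
  fixes M :: "'a matroid" and \<P> :: "'a set set"
  assumes M: "is_matroid M" and partition: "partition_on (ground M) \<P>"
    and rk_sum: "(\<Sum>P\<in>\<P>. rk M P) = rk M (ground M)"
begin

lemma finite_parts: "finite \<P>"
  using partition matroidD(1)[OF M] finite_elements by blast

lemma part_subset: "P \<in> \<P> \<Longrightarrow> P \<subseteq> ground M"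
  using partition_onD1[OF partition] by blast

lemma finite_ground: "finite (ground M)"
  using matroidD(1)[OF M] .

lemma finite_part: "P \<in> \<P> \<Longrightarrow> finite P"
  using part_subset finite_ground finite_subset by blast

lemma parts_disjoint: "P \<in> \<P> \<Longrightarrow> Q \<in> \<P> \<Longrightarrow> P \<noteq> Q \<Longrightarrow> P \<inter> Q = {}"
  using disjointD[OF partition_onD2[OF partition]] .

lemma sum_over_parts:
  fixes w :: "'a \<Rightarrow> 'b::comm_monoid_add"
  assumes "A \<subseteq> ground M" shows "sum w A = (\<Sum>P\<in>\<P>. sum w (A \<inter> P))"
proof -
  have "A = (\<Union>P\<in>\<P>. A \<inter> P)" using assms partition_onD1[OF partition] by auto
  moreover have "sum w (\<Union>P\<in>\<P>. A \<inter> P) = (\<Sum>P\<in>\<P>. sum w (A \<inter> P))"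
  proof (rule sum.UNION_disjoint[OF finite_parts])
    show "\<forall>P\<in>\<P>. finite (A \<inter> P)" using finite_part by blast
    show "\<forall>P\<in>\<P>. \<forall>Q\<in>\<P>. P \<noteq> Q \<longrightarrow> (A \<inter> P) \<inter> (A \<inter> Q) = {}" using parts_disjoint by blast
  qed
  ultimately show ?thesis by simp
qed

lemma card_over_parts: "A \<subseteq> ground M \<Longrightarrow> card A = (\<Sum>P\<in>\<P>. card (A \<inter> P))"
  using sum_over_parts[of A "\<lambda>_. 1::nat"] by simp

lemma rk_over_parts: "A \<subseteq> ground M \<Longrightarrow> rk M A = (\<Sum>P\<in>\<P>. rk M (A \<inter> P))"
  using rank_function_partition_additive[OF rank_function_rk[OF M] partition rk_sum] by simp

lemma rk_empty: "rk M {} = 0"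
  using rank_functionD(2)[OF rank_function_rk[OF M]] .

lemma rk_Un_parts:
  assumes "P \<in> \<P>" "Q \<in> \<P>" "P \<noteq> Q" "X \<subseteq> P" "Y \<subseteq> Q"
  shows "rk M (X \<union> Y) = rk M X + rk M Y"
proof -
  have X: "(X \<union> Y) \<inter> P = X" "(X \<union> Y) \<inter> Q = Y" using parts_disjoint[OF assms(1-3)] assms by auto
  have "(X \<union> Y) \<inter> R = {}" if "R \<in> \<P> - {P, Q}" for R
    using parts_disjoint[of P R] parts_disjoint[of Q R] that assms by blast
  then have "(\<Sum>R\<in>\<P> - {P, Q}. rk M ((X \<union> Y) \<inter> R)) = 0" using rk_empty by simp
  moreover have "(\<Sum>R\<in>\<P>. rk M ((X \<union> Y) \<inter> R))
      = (\<Sum>R\<in>\<P> - {P, Q}. rk M ((X \<union> Y) \<inter> R)) + (\<Sum>R\<in>{P, Q}. rk M ((X \<union> Y) \<inter> R))"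
    by (rule sum.subset_diff) (use assms finite_parts in auto)
  moreover have "X \<union> Y \<subseteq> ground M" using assms part_subset by blast
  ultimately show ?thesis using rk_over_parts[of "X \<union> Y"] X assms(3) by simp
qed

lemma base_subset: "B \<in> bases M \<Longrightarrow> B \<subseteq> ground M"
  using bases_iff[OF M] matroidD(3)[OF M] by blast

lemma finite_base: "B \<in> bases M \<Longrightarrow> finite B"
  using base_subset finite_ground finite_subset by blast

text \<open>The ranks of the traces on the parts add up to the rank of \<open>U\<close>, and no trace contains more elements
  of the base than its rank.\<close>

lemma base_tight_part:
  assumes "B \<in> bases M" "U \<subseteq> ground M" "card (B \<inter> U) = rk M U" "P \<in> \<P>"
  shows "card (B \<inter> (U \<inter> P)) = rk M (U \<inter> P)"
proof -
  have "card (B \<inter> U) = (\<Sum>P\<in>\<P>. card (B \<inter> (U \<inter> P)))"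
    using card_over_parts[of "B \<inter> U"] assms(2) by (simp add: Int_assoc le_infI2)
  then have "(\<Sum>P\<in>\<P>. rk M (U \<inter> P)) = (\<Sum>P\<in>\<P>. card (B \<inter> (U \<inter> P)))"
    using rk_over_parts[OF assms(2)] assms(3) by simp
  then show ?thesis
    using sum_mono_inv[of "\<lambda>P. card (B \<inter> (U \<inter> P))" \<P> "\<lambda>P. rk M (U \<inter> P)" P]
      card_base_Int_le[OF M assms(1)] finite_parts assms(4) by simp
qed

lemma base_part: "B \<in> bases M \<Longrightarrow> P \<in> \<P> \<Longrightarrow> card (B \<inter> P) = rk M P"
  using base_tight_part[of B "ground M" P] bases_iff[OF M] base_subset[of B] part_subset[of P]
  by (simp add: Int_absorb1 Int_absorb2)

lemma weight_constant_on_parts: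
  fixes w :: "'a \<Rightarrow> real"
  assumes w: "\<And>P p q. P \<in> \<P> \<Longrightarrow> p \<in> P \<Longrightarrow> q \<in> P \<Longrightarrow> w p = w q"
    and B: "B \<in> bases M" "B' \<in> bases M"
  shows "sum w B = sum w B'"
proof -
  have "\<exists>c. \<forall>P\<in>\<P>. \<forall>p\<in>P. w p = c P"
    by (rule bchoice) (use w in blast)
  then obtain c where c: "\<And>P p. P \<in> \<P> \<Longrightarrow> p \<in> P \<Longrightarrow> w p = c P" by blast
  have "sum w B = (\<Sum>P\<in>\<P>. real (rk M P) * c P)" if B: "B \<in> bases M" for B
  proof -
    have "sum w (B \<inter> P) = real (rk M P) * c P" if P: "P \<in> \<P>" for P
    proof -
      have "sum w (B \<inter> P) = (\<Sum>p\<in>B \<inter> P. c P)" by (rule sum.cong) (use c[OF P] in auto)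
      then show ?thesis using base_part[OF B P] by simp
    qed
    then show ?thesis using sum_over_parts[OF base_subset[OF B], of w] by simp
  qed
  then show ?thesis using B by simp
qed

text \<open>A base that misses the rank of \<open>A\<close> by more than one can be improved by a single exchange, and some
  base misses it because \<open>A\<close> does not separate \<open>P\<close>.\<close>

lemma base_defect_one:
  assumes P: "P \<in> \<P>" and A: "A \<subseteq> P" and less: "rk M P < rk M A + rk M (P - A)"
  obtains B where "B \<in> bases M" "Suc (card (B \<inter> A)) = rk M A"
proof -
  let ?S = "{B \<in> bases M. card (B \<inter> A) < rk M A}"
  obtain B0 where B0: "B0 \<in> bases M" "card (B0 \<inter> (P - A)) = rk M (P - A)"
    using base_chain[OF M order_refl] by metis
  have "card (B0 \<inter> P) = card (B0 \<inter> A) + card (B0 \<inter> (P - A))"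
  proof -
    have "B0 \<inter> P = (B0 \<inter> A) \<union> (B0 \<inter> (P - A))" using A by auto
    moreover have "card ((B0 \<inter> A) \<union> (B0 \<inter> (P - A))) = card (B0 \<inter> A) + card (B0 \<inter> (P - A))"
      by (rule card_Un_disjoint) (use finite_base[OF B0(1)] in auto)
    ultimately show ?thesis by simp
  qed
  then have S0: "B0 \<in> ?S" using B0 base_part[OF B0(1) P] less by simp
  have "\<exists>B. B \<in> ?S \<and> (\<forall>B'. B' \<in> ?S \<longrightarrow> card (B' \<inter> A) \<le> card (B \<inter> A))"
    by (rule ex_has_greatest_nat[where P = "\<lambda>B. B \<in> ?S", OF S0, where b = "rk M A"]) simp
  then obtain B where "B \<in> ?S"
    and max: "\<And>B'. B' \<in> ?S \<Longrightarrow> card (B' \<inter> A) \<le> card (B \<inter> A)"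
    by blast
  then have B: "B \<in> bases M" "card (B \<inter> A) < rk M A" by auto
  have BI: "B \<in> indeps M" and Bc: "card B = rk M (ground M)" using B bases_iff[OF M] by auto
  have fB: "finite B" using finite_base[OF B(1)] .
  have BA: "B \<inter> A \<in> indeps M" by (rule matroidD(4)[OF M BI]) simp
  obtain J where J: "J \<in> indeps M" "J \<subseteq> A" "card J = rk M A" using rk_obtain[OF M] .
  then obtain e where e: "e \<in> J - B \<inter> A" "insert e (B \<inter> A) \<in> indeps M"
    using matroidD(7)[OF M BA J(1)] B(2) by auto
  have eA: "e \<in> A" "e \<notin> B" using e J by auto
  have sub: "insert e (B \<inter> A) \<subseteq> insert e B" by auto
  obtain K where K: "K \<in> indeps M" "insert e (B \<inter> A) \<subseteq> K" "K \<subseteq> insert e B" "card K = rk M (insert e B)"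
    using rk_extend[OF M e(2) sub] .
  have "card B \<le> card K" using K(4) rk_ge[OF M BI, of "insert e B"] by auto
  moreover have "card K \<le> rk M (ground M)" using rk_ge[OF M K(1)] matroidD(3)[OF M K(1)] by simp
  ultimately have KB: "K \<in> bases M" using Bc K(1) bases_iff[OF M] by simp
  have "K \<inter> A = insert e (B \<inter> A)" using K eA by auto
  then have c: "card (K \<inter> A) = Suc (card (B \<inter> A))" using eA fB by simp
  show ?thesis
  proof (rule ccontr)
    assume "\<not> thesis"
    then have "Suc (card (B \<inter> A)) \<noteq> rk M A" using that B(1) by blast
    then have "K \<in> ?S" using c KB B(2) by simp
    then show False using max[of K] c by simp
  qed
qed

end

section \<open>Gorenstein blocks\<close>

text \<open>The dilated base polytope obeys \<open>v(A) \<le> \<delta> * r A\<close>; this is the difference of the two sides at \<open>v\<close>.\<close>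

definition slack :: "nat \<Rightarrow> ('a \<Rightarrow> int) \<Rightarrow> ('a set \<Rightarrow> nat) \<Rightarrow> 'a set \<Rightarrow> int" where
  "slack \<delta> v r A = int \<delta> * int (r A) - sum v A"

definition splits_inside :: "('a set \<Rightarrow> int) \<Rightarrow> 'a set \<Rightarrow> bool" where
  "splits_inside f A \<longleftrightarrow> (\<exists>S S'. S \<noteq> {} \<and> S' \<noteq> {} \<and> S \<inter> S' = {} \<and> S \<union> S' = A \<and> f S + f S' = f A)"

definition splits_outside :: "('a set \<Rightarrow> int) \<Rightarrow> 'a set \<Rightarrow> 'a set \<Rightarrow> bool" where
  "splits_outside f E A \<longleftrightarrow>
     (\<exists>S S'. S \<subset> E \<and> S' \<subset> E \<and> S \<inter> S' = A \<and> S \<union> S' = E \<and> f S + f S' = f A)"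

text \<open>For the slack function of a connected matroid the sets that do not split are the flacets, the sets with
  connected restriction and connected contraction, which index the facets of the base polytope.\<close>

definition gorenstein_block :: "('a set \<Rightarrow> int) \<Rightarrow> 'a set \<Rightarrow> bool" where
  "gorenstein_block f E \<longleftrightarrow> f {} = 0 \<and> f E = 0 \<and>
     (\<forall>A. A \<noteq> {} \<longrightarrow> A \<subset> E \<longrightarrow> 1 \<le> f A \<and> (f A = 1 \<or> splits_inside f A \<or> splits_outside f E A))"

lemma gorenstein_blockD:
  assumes "gorenstein_block f E"
  shows "f {} = 0" "f E = 0" "A \<noteq> {} \<Longrightarrow> A \<subset> E \<Longrightarrow> 1 \<le> f A"
    "A \<noteq> {} \<Longrightarrow> A \<subset> E \<Longrightarrow> \<not> splits_inside f A \<Longrightarrow> \<not> splits_outside f E A \<Longrightarrow> f A = 1"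
    "A \<subseteq> E \<Longrightarrow> 0 \<le> f A"
proof -
  show *: "f {} = 0" "f E = 0" "A \<noteq> {} \<Longrightarrow> A \<subset> E \<Longrightarrow> 1 \<le> f A"
    "A \<noteq> {} \<Longrightarrow> A \<subset> E \<Longrightarrow> \<not> splits_inside f A \<Longrightarrow> \<not> splits_outside f E A \<Longrightarrow> f A = 1"
    using assms unfolding gorenstein_block_def by blast+
  show "0 \<le> f A" if "A \<subseteq> E"
    using * that by (cases "A = {} \<or> A = E") fastforce+
qed

lemma gorenstein_block_cong:
  assumes fg: "\<And>A. A \<subseteq> E \<Longrightarrow> f A = g A" and "gorenstein_block f E" shows "gorenstein_block g E"
proof -
  have 1: "splits_inside g A" if "splits_inside f A" "A \<subseteq> E" for A
    using that(1) fg that(2) unfolding splits_inside_def by (metis le_sup_iff)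
  have 2: "splits_outside g E A" if "splits_outside f E A" "A \<subseteq> E" for A
    using that(1) fg that(2) unfolding splits_outside_def by (metis psubset_imp_subset)
  note D = gorenstein_blockD[OF assms(2)]
  show ?thesis unfolding gorenstein_block_def
  proof (intro conjI allI impI)
    show "g {} = 0" "g E = 0" using D(1,2) fg[of "{}"] fg[of E] by simp_all
    fix A assume A: "A \<noteq> {}" "A \<subset> E"
    then have sub: "A \<subseteq> E" by simp
    show "1 \<le> g A" using D(3)[OF A] fg[OF sub] by simp
    show "g A = 1 \<or> splits_inside g A \<or> splits_outside g E A"
      using D(4)[OF A] fg[OF sub] 1[of A] 2[of A] sub by metis
  qed
qed

lemma slack_submodular:
  assumes "rank_function E r" shows "submodular_on E (slack \<delta> v r)"
  unfolding submodular_on_def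
proof (intro allI impI)
  fix A B assume AB: "A \<subseteq> E" "B \<subseteq> E"
  then have fin: "finite A" "finite B" using rank_functionD(1)[OF assms] finite_subset by blast+
  have "sum v (A \<union> B) + sum v (A \<inter> B) = sum v A + sum v B" using sum.union_inter[OF fin] .
  moreover have "r (A \<union> B) + r (A \<inter> B) \<le> r A + r B"
    using submodular_onD[OF rank_functionD(3)[OF assms] AB] .
  then have "int \<delta> * int (r (A \<union> B) + r (A \<inter> B)) \<le> int \<delta> * int (r A + r B)"
    by (intro mult_left_mono) auto
  ultimately show "slack \<delta> v r (A \<union> B) + slack \<delta> v r (A \<inter> B) \<le> slack \<delta> v r A + slack \<delta> v r B"
    unfolding slack_def by (simp add: algebra_simps)
qed

lemma slack_modular_iff:
  assumes "finite A" "finite B" "0 < \<delta>"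
  shows "slack \<delta> v r A + slack \<delta> v r B = slack \<delta> v r (A \<union> B) + slack \<delta> v r (A \<inter> B) \<longleftrightarrow>
    r A + r B = r (A \<union> B) + r (A \<inter> B)"
proof -
  have "sum v (A \<union> B) + sum v (A \<inter> B) = sum v A + sum v B" using sum.union_inter[OF assms(1,2)] .
  then have "slack \<delta> v r A + slack \<delta> v r B = slack \<delta> v r (A \<union> B) + slack \<delta> v r (A \<inter> B) \<longleftrightarrow>
    int \<delta> * int (r A + r B) = int \<delta> * int (r (A \<union> B) + r (A \<inter> B))"
    unfolding slack_def by (auto simp: algebra_simps)
  then show ?thesis using assms(3) by (simp only: mult_cancel_left of_nat_eq_iff) simp
qed

section \<open>Decomposing integer points into bases\<close>

text \<open>The discrete sandwich theorem. The value of \<open>y\<close> at one element \<open>e\<close> can be fixed as any integer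
  \<open>t\<close> that leaves room between the functions obtained by minimizing \<open>f\<close> and maximizing \<open>g\<close> over
  the two choices for \<open>e\<close>; submodularity of \<open>f\<close> and supermodularity of \<open>g\<close> guarantee that there is such a \<open>t\<close>.\<close>

lemma discrete_sandwich:
  fixes f g :: "'a set \<Rightarrow> int"
  assumes "finite E" "submodular_on E f" "submodular_on E (\<lambda>A. - g A)"
    "\<And>A. A \<subseteq> E \<Longrightarrow> g A \<le> f A" "f {} = 0" "g {} = 0"
  shows "\<exists>y. \<forall>A\<subseteq>E. g A \<le> sum y A \<and> sum y A \<le> f A"
  using assms
proof (induction E arbitrary: f g rule: finite_induct)
  case empty
  then show ?case by simp
next
  case (insert e E)
  note f = submodular_onD[OF insert.prems(1)]
  have g: "g A + g B \<le> g (A \<union> B) + g (A \<inter> B)" if "A \<subseteq> insert e E" "B \<subseteq> insert e E" for A B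
    using submodular_onD[OF insert.prems(2) that] by linarith
  define t where "t = Min ((\<lambda>A. f (insert e A) - g A) ` Pow E)"
  have fin: "finite ((\<lambda>A. f (insert e A) - g A) ` Pow E)" using insert.hyps(1) by simp
  have t_le: "t \<le> f (insert e A) - g A" if "A \<subseteq> E" for A
    unfolding t_def by (rule Min_le[OF fin]) (use that in blast)
  have t_ge: "g (insert e B) - f B \<le> t" if B: "B \<subseteq> E" for B
  proof -
    have "t \<in> (\<lambda>A. f (insert e A) - g A) ` Pow E" unfolding t_def by (rule Min_in[OF fin]) blast
    then obtain A where A: "A \<subseteq> E" "t = f (insert e A) - g A" by blast
    have eA: "e \<notin> A" "e \<notin> B" using A B insert.hyps(2) by auto
    have e: "insert e A \<union> B = insert e (A \<union> B)" "insert e A \<inter> B = A \<inter> B"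
      "A \<union> insert e B = insert e (A \<union> B)" "A \<inter> insert e B = A \<inter> B" using eA by auto
    have "f (insert e (A \<union> B)) + f (A \<inter> B) \<le> f (insert e A) + f B"
      using f[of "insert e A" B] A B e by auto
    moreover have "g A + g (insert e B) \<le> g (insert e (A \<union> B)) + g (A \<inter> B)"
      using g[of A "insert e B"] A B e by auto
    moreover have "g (insert e (A \<union> B)) \<le> f (insert e (A \<union> B))" "g (A \<inter> B) \<le> f (A \<inter> B)"
      using A B by (auto intro!: insert.prems(3))
    ultimately show ?thesis using A by linarith
  qed
  define f' where "f' A = min (f A) (f (insert e A) - t)" for A
  define g' where "g' A = max (g A) (g (insert e A) - t)" for A
  have mixed: "insert e A \<union> B = insert e (A \<union> B)" "insert e A \<inter> B = A \<inter> B"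
    "A \<union> insert e B = insert e (A \<union> B)" "A \<inter> insert e B = A \<inter> B"
    "insert e A \<union> insert e B = insert e (A \<union> B)" "insert e A \<inter> insert e B = insert e (A \<inter> B)"
    "A \<subseteq> insert e E" "B \<subseteq> insert e E" "insert e A \<subseteq> insert e E" "insert e B \<subseteq> insert e E"
    if "A \<subseteq> E" "B \<subseteq> E" for A B using that insert.hyps(2) by auto
  have sf: "submodular_on E f'"
    unfolding submodular_on_def
  proof (intro allI impI)
    fix A B assume AB: "A \<subseteq> E" "B \<subseteq> E"
    note m = mixed[OF AB]
    show "f' (A \<union> B) + f' (A \<inter> B) \<le> f' A + f' B"
      using f[OF m(7,8)] f[OF m(9,10)] f[OF m(7,10)] f[OF m(9,8)]
      unfolding m(1-6) f'_def min_def by (simp split: if_splits)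
  qed
  have sg: "submodular_on E (\<lambda>A. - g' A)"
    unfolding submodular_on_def
  proof (intro allI impI)
    fix A B assume AB: "A \<subseteq> E" "B \<subseteq> E"
    note m = mixed[OF AB]
    show "- g' (A \<union> B) + - g' (A \<inter> B) \<le> - g' A + - g' B"
      using g[OF m(7,8)] g[OF m(9,10)] g[OF m(7,10)] g[OF m(9,8)]
      unfolding m(1-6) g'_def max_def by (simp split: if_splits)
  qed
  have le: "g' A \<le> f' A" if A: "A \<subseteq> E" for A
    using t_le[OF A] t_ge[OF A] insert.prems(3)[of A] insert.prems(3)[of "insert e A"] A
    unfolding f'_def g'_def by auto
  have z: "f' {} = 0" "g' {} = 0"
    using t_le[of "{}"] t_ge[of "{}"] insert.prems(4,5) unfolding f'_def g'_def by auto
  obtain y where y: "\<And>A. A \<subseteq> E \<Longrightarrow> g' A \<le> sum y A \<and> sum y A \<le> f' A"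
    using insert.IH[OF sf sg le z] by blast
  have "g A \<le> sum (y(e := t)) A \<and> sum (y(e := t)) A \<le> f A" if A: "A \<subseteq> insert e E" for A
  proof -
    define A0 where "A0 = A - {e}"
    have A0: "A0 \<subseteq> E" "e \<notin> A0" "finite A0"
      using A insert.hyps(1) finite_subset by (auto simp: A0_def)
    have s: "sum (y(e := t)) A0 = sum y A0" by (rule sum.cong) (use A0 in auto)
    show ?thesis
    proof (cases "e \<in> A")
      case True
      then have "A = insert e A0" by (auto simp: A0_def)
      then show ?thesis using y[OF A0(1)] A0 s unfolding f'_def g'_def by auto
    next
      case False
      then have "A = A0" by (auto simp: A0_def)
      then show ?thesis using y[OF A0(1)] s unfolding f'_def g'_def by auto
    qed
  qed
  then show ?case by blast
qed

text \<open>A summand that is a base is sandwiched between the rank function and the function saying that the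
  remaining point obeys the rank inequalities of the smaller dilate.\<close>

lemma integer_point_sum_of_bases:
  fixes M :: "'e::finite matroid" and x :: "'e \<Rightarrow> int"
  assumes M: "is_matroid M"
    and "\<And>A. sum x A \<le> int k * int (rk M A)" "sum x UNIV = int k * int (rk M UNIV)"
  shows "\<exists>B. (\<forall>i<k. B i \<in> bases M) \<and> (\<forall>e. x e = (\<Sum>i<k. of_bool (e \<in> B i)))"
  using assms(2,3)
proof (induction k arbitrary: x)
  case 0
  have "x e = 0" for e
  proof -
    have "sum x UNIV = x e + sum x (UNIV - {e})" by (simp add: sum.remove)
    then show ?thesis using 0(1)[of "{e}"] 0(1)[of "UNIV - {e}"] 0(2) by simp
  qed
  then show ?case by simp
next
  case (Suc k)
  define f where "f A = int (rk M A)" for A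
  define g where "g A = sum x A - int k * int (rk M A)" for A
  have rm: "rk M (A \<union> B) + rk M (A \<inter> B) \<le> rk M A + rk M B" for A B by (rule rk_submodular[OF M])
  have rm': "int (rk M (A \<union> B)) + int (rk M (A \<inter> B)) \<le> int (rk M A) + int (rk M B)" for A B
    using rm[of A B] by linarith
  have sf: "submodular_on UNIV f" unfolding submodular_on_def f_def using rm' by blast
  have sg: "submodular_on UNIV (\<lambda>A. - g A)"
    unfolding submodular_on_def g_def
  proof (intro allI impI)
    fix A B :: "'e set"
    have "sum x (A \<union> B) + sum x (A \<inter> B) = sum x A + sum x B" by (rule sum.union_inter) auto
    moreover have "int k * (int (rk M (A \<union> B)) + int (rk M (A \<inter> B))) \<le> int k * (int (rk M A) + int (rk M B))"
      using rm'[of A B] by (intro mult_left_mono) auto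
    ultimately show "- (sum x (A \<union> B) - int k * int (rk M (A \<union> B))) + - (sum x (A \<inter> B) - int k * int (rk M (A \<inter> B)))
      \<le> - (sum x A - int k * int (rk M A)) + - (sum x B - int k * int (rk M B))"
      by (simp add: algebra_simps)
  qed
  have le: "g A \<le> f A" for A using Suc.prems(1)[of A] by (simp add: f_def g_def algebra_simps)
  have z: "f {} = 0" "g {} = 0"
    using rank_functionD(2)[OF rank_function_rk[OF M]] by (simp_all add: f_def g_def)
  obtain y where y: "\<And>A. g A \<le> sum y A" "\<And>A. sum y A \<le> f A"
    using discrete_sandwich[OF finite sf sg le z] by auto
  have yU: "sum y UNIV = int (rk M UNIV)"
    using y[of UNIV] Suc.prems(2) by (simp add: f_def g_def algebra_simps)
  have y01: "0 \<le> y e \<and> y e \<le> 1" for e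
  proof -
    have "sum y UNIV = y e + sum y (UNIV - {e})" by (simp add: sum.remove)
    moreover have "rk M (UNIV - {e}) \<le> rk M UNIV" by (rule rk_mono[OF M]) simp
    ultimately have "0 \<le> y e" using yU y(2)[of "UNIV - {e}"] by (simp add: f_def)
    moreover have "rk M {e} \<le> 1" using rk_le_card[OF M, of "{e}"] by simp
    ultimately show ?thesis using y(2)[of "{e}"] by (simp add: f_def)
  qed
  define B0 where "B0 = {e. y e = 1}"
  have yB: "y e = of_bool (e \<in> B0)" for e using y01[of e] by (auto simp: B0_def)
  have cB: "sum y A = int (card (B0 \<inter> A))" for A
    unfolding yB by (simp add: Int_commute)
  have "card B0 = rk M UNIV" using cB[of UNIV] yU by simp
  moreover have "rk M B0 = card B0"
    using cB[of B0] y(2)[of B0] rk_le_card[OF M, of B0] by (simp add: f_def)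
  moreover have "B0 \<subseteq> ground M"
  proof
    fix e assume "e \<in> B0"
    show "e \<in> ground M"
    proof (rule ccontr)
      assume "e \<notin> ground M"
      then have "rk M {e} = 0"
        using rk_Int_ground[OF M, of "{e}"] rank_functionD(2)[OF rank_function_rk[OF M]] by simp
      then show False using y(2)[of "{e}"] yB[of e] \<open>e \<in> B0\<close> by (simp add: f_def)
    qed
  qed
  moreover have "rk M (ground M) = rk M UNIV" using rk_Int_ground[OF M, of UNIV] by simp
  ultimately have B0: "B0 \<in> bases M" using bases_iff[OF M] indep_iff_rk[OF M] by simp
  have 1: "sum (\<lambda>e. x e - y e) A \<le> int k * int (rk M A)" for A
    using y(1)[of A] by (simp add: g_def sum_subtractf)
  have 2: "sum (\<lambda>e. x e - y e) UNIV = int k * int (rk M UNIV)"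
    using Suc.prems(2) yU by (simp add: sum_subtractf algebra_simps)
  obtain B where B: "\<forall>i<k. B i \<in> bases M" "\<forall>e. x e - y e = (\<Sum>i<k. of_bool (e \<in> B i))"
    using Suc.IH[OF 1 2] by blast
  define B' where "B' = B(k := B0)"
  have "\<forall>i<Suc k. B' i \<in> bases M" using B(1) B0 by (simp add: B'_def less_Suc_eq)
  moreover have "x e = (\<Sum>i<Suc k. of_bool (e \<in> B' i))" for e
  proof -
    have "(\<Sum>i<k. of_bool (e \<in> B' i)) = (\<Sum>i<k. of_bool (e \<in> B i) :: int)"
      by (rule sum.cong) (auto simp: B'_def)
    then show ?thesis using B(2)[rule_format, of e] yB[of e] by (simp add: B'_def)
  qed
  ultimately show ?case by blast
qed

section \<open>Linear forms on the cone over a base polytope\<close>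

definition indicator_vec :: "'e::finite set \<Rightarrow> real ^ 'e" where
  "indicator_vec B = (\<Sum>e\<in>B. axis e 1)"

lemma indicator_vec_nth: "indicator_vec B $ i = of_bool (i \<in> B)"
proof -
  have "(\<Sum>e\<in>B. axis e (1::real) $ i) = (\<Sum>e\<in>B. if e = i then 1 else 0)"
    by (rule sum.cong) (auto simp: axis_def)
  then show ?thesis by (simp add: indicator_vec_def)
qed

lemma inner_indicator_vec: "indicator_vec A \<bullet> x = (\<Sum>e\<in>A. x $ e)"
proof -
  have "indicator_vec A \<bullet> x = (\<Sum>e\<in>A. axis e 1 \<bullet> x)"
    by (simp add: indicator_vec_def inner_sum_left)
  then show ?thesis by (simp add: inner_axis')
qed

lemma base_polytope_eq: "base_polytope M = convex hull (indicator_vec ` bases M)"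
  by (simp add: base_polytope_def indicator_vec_def)

lemma cone_over_base_polytope:
  "cone_over (base_polytope M) = convex_cone hull ((\<lambda>B. (indicator_vec B, 1)) ` bases M)"
proof -
  let ?V = "(\<lambda>B. (indicator_vec B, 1::real)) ` bases M"
  have "base_polytope M \<times> {1::real} = (convex hull (indicator_vec ` bases M)) \<times> (convex hull {1})"
    by (simp add: base_polytope_eq)
  also have "\<dots> = convex hull (indicator_vec ` bases M \<times> {1})" by (simp add: convex_hull_Times)
  also have "indicator_vec ` bases M \<times> {1} = ?V" by auto
  finally have e: "base_polytope M \<times> {1} = convex hull ?V" .
  have "convex hull ?V \<subseteq> convex_cone hull ?V"
    by (rule hull_minimal) (simp_all add: hull_subset convex_convex_cone_hull)
  then have "convex_cone hull (convex hull ?V) \<subseteq> convex_cone hull ?V"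
    by (rule hull_minimal) (rule convex_cone_convex_cone_hull)
  moreover have "convex_cone hull ?V \<subseteq> convex_cone hull (convex hull ?V)"
    by (rule hull_mono) (rule hull_subset)
  ultimately show ?thesis unfolding cone_over_def e by blast
qed

lemma base_in_polytope: "B \<in> bases M \<Longrightarrow> indicator_vec B \<in> base_polytope M"
  unfolding base_polytope_eq by (rule hull_inc) blast

lemma in_polytope_in_cone: "p \<in> base_polytope M \<Longrightarrow> (p, 1) \<in> cone_over (base_polytope M)"
  unfolding cone_over_def by (rule hull_inc) blast

lemma base_in_cone: "B \<in> bases M \<Longrightarrow> (indicator_vec B, 1) \<in> cone_over (base_polytope M)"
  by (rule in_polytope_in_cone[OF base_in_polytope])

lemma cone_scale: "z \<in> cone_over P \<Longrightarrow> 0 \<le> c \<Longrightarrow> c *\<^sub>R z \<in> cone_over P"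
  unfolding cone_over_def by (rule conicD[OF conic_convex_cone_hull])

lemma polyhedron_cone_over: "polyhedron (cone_over (base_polytope (M :: 'e::finite matroid)))"
  unfolding cone_over_base_polytope by (rule polyhedron_convex_cone_hull) simp

lemma convex_cone_over: "convex (cone_over P)"
  unfolding cone_over_def by (rule convex_convex_cone_hull)

lemma linear_nonneg_on_cone:
  assumes "linear h" "\<And>B. B \<in> bases M \<Longrightarrow> 0 \<le> h (indicator_vec B, 1)"
    and z: "z \<in> cone_over (base_polytope M)"
  shows "0 \<le> (h z :: real)"
proof -
  have "convex_cone {z. 0 \<le> h z}"
  proof -
    have "0 \<in> {z. 0 \<le> h z}" using linear_0[OF assms(1)] by simp
    moreover have "convex {z. 0 \<le> h z}" "conic {z. 0 \<le> h z}"
      unfolding conic_def convex_def using linear_add[OF assms(1)] linear_cmul[OF assms(1)] by auto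
    ultimately show ?thesis unfolding convex_cone_def by blast
  qed
  moreover have "(\<lambda>B. (indicator_vec B, 1)) ` bases M \<subseteq> {z. 0 \<le> h z}" using assms(2) by auto
  ultimately have "cone_over (base_polytope M) \<subseteq> {z. 0 \<le> h z}"
    unfolding cone_over_base_polytope by (rule hull_minimal[rotated])
  then show ?thesis using z by auto
qed

lemma linear_zero_on_cone:
  assumes h: "linear h" "\<And>B. B \<in> bases M \<Longrightarrow> h (indicator_vec B, 1) = 0"
    and z: "z \<in> cone_over (base_polytope M)"
  shows "h z = (0 :: real)"
proof -
  have "0 \<le> h z" by (rule linear_nonneg_on_cone[OF h(1) _ z]) (simp add: h(2))
  moreover have "0 \<le> - h z"
    by (rule linear_nonneg_on_cone[OF linear_compose_neg[OF h(1)] _ z]) (simp add: h(2))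
  ultimately show ?thesis by simp
qed

text \<open>A large multiple of the supporting form dominates the other form and its negative at all bases, hence
  on the cone.\<close>

lemma linear_zero_on_face:
  fixes M :: "'e::finite matroid" and a h :: "(real ^ 'e) \<times> real \<Rightarrow> real"
  assumes a: "linear a" "\<And>B. B \<in> bases M \<Longrightarrow> 0 \<le> a (indicator_vec B, 1)"
    and h: "linear h" "\<And>B. B \<in> bases M \<Longrightarrow> a (indicator_vec B, 1) = 0 \<Longrightarrow> h (indicator_vec B, 1) = 0"
    and z: "z \<in> cone_over (base_polytope M)" "a z = 0"
  shows "h z = 0"
proof -
  have le: "g z \<le> 0" if g: "linear g"
    "\<And>B. B \<in> bases M \<Longrightarrow> a (indicator_vec B, 1) = 0 \<Longrightarrow> g (indicator_vec B, 1) = 0" for g :: "(real ^ 'e) \<times> real \<Rightarrow> real"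
  proof -
    define K where "K = (\<Sum>B\<in>bases M. \<bar>g (indicator_vec B, 1)\<bar> / a (indicator_vec B, 1))"
    have "0 \<le> K * a (indicator_vec B, 1) - g (indicator_vec B, 1)" if B: "B \<in> bases M" for B
    proof (cases "a (indicator_vec B, 1) = 0")
      case True
      then show ?thesis using g(2)[OF B True] by simp
    next
      case False
      then have pos: "0 < a (indicator_vec B, 1)" using a(2)[OF B] by simp
      have "\<bar>g (indicator_vec B, 1)\<bar> / a (indicator_vec B, 1) \<le> K"
        unfolding K_def
        by (rule member_le_sum[OF B, where f = "\<lambda>B. \<bar>g (indicator_vec B, 1)\<bar> / a (indicator_vec B, 1)"])
          (simp_all add: a(2))
      then show ?thesis using pos by (simp add: divide_le_eq)
    qed
    moreover have "linear (\<lambda>z. K * a z - g z)"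
      using linear_compose_sub[OF linear_compose_scale_right[OF a(1), of K] g(1)] by simp
    ultimately have "0 \<le> K * a z - g z" using linear_nonneg_on_cone[OF _ _ z(1), of "\<lambda>z. K * a z - g z"] by blast
    then show ?thesis using z(2) by simp
  qed
  have "h z \<le> 0" by (rule le[OF h])
  moreover have "- h z \<le> 0" by (rule le[OF linear_compose_neg[OF h(1)]]) (simp add: h(2))
  ultimately show ?thesis by simp
qed

definition rank_form :: "'e::finite matroid \<Rightarrow> 'e set \<Rightarrow> (real ^ 'e) \<times> real \<Rightarrow> real" where
  "rank_form M A z = (- indicator_vec A, real (rk M A)) \<bullet> z"

lemma rank_form_eq: "rank_form M A (x, t) = t * real (rk M A) - (\<Sum>e\<in>A. x $ e)"
  by (simp add: rank_form_def inner_indicator_vec)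

lemma linear_rank_form: "linear (rank_form M A)"
  unfolding rank_form_def by (rule bounded_linear.linear[OF bounded_linear_inner_right])

lemma rank_form_base: "rank_form M A (indicator_vec B, 1) = real (rk M A) - real (card (B \<inter> A))"
  by (simp add: rank_form_eq indicator_vec_nth Int_commute)

lemma rank_form_nonneg:
  assumes "is_matroid M" "z \<in> cone_over (base_polytope M)" shows "0 \<le> rank_form M A z"
  by (rule linear_nonneg_on_cone[OF linear_rank_form _ assms(2)])
    (simp add: rank_form_base card_base_Int_le[OF assms(1)])

section \<open>The spanned lattice\<close>

lemma spanned_lattice_generator:
  assumes "p \<in> P \<inter> integer_points" shows "(p, 1) \<in> spanned_lattice P"
  unfolding spanned_lattice_def using assms
  by (auto intro!: exI[of _ "{p}"] exI[of _ "\<lambda>_. 1"])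

lemma spanned_lattice_scale:
  assumes "z \<in> spanned_lattice P" shows "of_int n *\<^sub>R z \<in> spanned_lattice P"
proof -
  obtain S u where S: "finite S" "S \<subseteq> P \<inter> integer_points" "z = (\<Sum>p\<in>S. of_int (u p) *\<^sub>R (p, 1))"
    using assms unfolding spanned_lattice_def by blast
  have "of_int n *\<^sub>R z = (\<Sum>p\<in>S. of_int (n * u p) *\<^sub>R (p, 1))"
    unfolding S(3) by (simp add: scaleR_sum_right sum_distrib_left sum_prod prod_eq_iff fst_sum snd_sum)
  then show ?thesis unfolding spanned_lattice_def using S(1,2)
    by (auto intro!: exI[of _ S] exI[of _ "\<lambda>p. n * u p"])
qed

lemma spanned_lattice_add:
  assumes "z \<in> spanned_lattice P" "z' \<in> spanned_lattice P" shows "z + z' \<in> spanned_lattice P"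
proof -
  obtain S u where S: "finite S" "S \<subseteq> P \<inter> integer_points" "z = (\<Sum>p\<in>S. of_int (u p) *\<^sub>R (p, 1))"
    using assms(1) unfolding spanned_lattice_def by blast
  obtain T w where T: "finite T" "T \<subseteq> P \<inter> integer_points" "z' = (\<Sum>p\<in>T. of_int (w p) *\<^sub>R (p, 1))"
    using assms(2) unfolding spanned_lattice_def by blast
  define u' where "u' p = (if p \<in> S then u p else 0)" for p
  define w' where "w' p = (if p \<in> T then w p else 0)" for p
  have "z = (\<Sum>p\<in>S \<union> T. of_int (u' p) *\<^sub>R (p, 1))"
    unfolding S(3) by (rule sum.mono_neutral_cong_left) (use S(1) T(1) in \<open>auto simp: u'_def zero_prod_def\<close>)
  moreover have "z' = (\<Sum>p\<in>S \<union> T. of_int (w' p) *\<^sub>R (p, 1))"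
    unfolding T(3) by (rule sum.mono_neutral_cong_left) (use S(1) T(1) in \<open>auto simp: w'_def zero_prod_def\<close>)
  ultimately have "z + z' = (\<Sum>p\<in>S \<union> T. of_int (u' p + w' p) *\<^sub>R (p, 1))"
    by (simp only: sum.distrib of_int_add scaleR_left_distrib)
  moreover have "finite (S \<union> T)" "S \<union> T \<subseteq> P \<inter> integer_points" using S T by auto
  ultimately show ?thesis unfolding spanned_lattice_def
    by (auto intro!: exI[of _ "S \<union> T"] exI[of _ "\<lambda>p. u' p + w' p"])
qed

lemma spanned_lattice_zero: "0 \<in> spanned_lattice P"
  unfolding spanned_lattice_def by (auto intro!: exI[of _ "{}"])

lemma spanned_lattice_sum:
  "(\<And>i. i \<in> I \<Longrightarrow> z i \<in> spanned_lattice P) \<Longrightarrow> sum z I \<in> spanned_lattice P"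
  by (induction I rule: infinite_finite_induct) (auto intro: spanned_lattice_add simp: spanned_lattice_zero)

lemma linear_integral_on_lattice:
  assumes h: "linear h" and gen: "\<And>p. p \<in> P \<inter> integer_points \<Longrightarrow> h (p, 1) \<in> \<int>"
    and z: "z \<in> spanned_lattice P"
  shows "(h z :: real) \<in> \<int>"
proof -
  obtain S u where S: "finite S" "S \<subseteq> P \<inter> integer_points" "z = (\<Sum>p\<in>S. of_int (u p) *\<^sub>R (p, 1))"
    using z unfolding spanned_lattice_def by blast
  have "h z = (\<Sum>p\<in>S. of_int (u p) * h (p, 1))"
    unfolding S(3) linear_sum[OF h] by (simp add: linear_cmul[OF h] del: scaleR_Pair)
  then show ?thesis using S(2) gen by (auto intro!: Ints_sum Ints_mult)
qed

lemma linear_zero_on_lattice: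
  assumes h: "linear h" and gen: "\<And>p. p \<in> P \<Longrightarrow> h (p, 1) = (0::real)" and z: "z \<in> spanned_lattice P"
  shows "h z = 0"
proof -
  obtain S u where S: "finite S" "S \<subseteq> P \<inter> integer_points" "z = (\<Sum>p\<in>S. of_int (u p) *\<^sub>R (p, 1))"
    using z unfolding spanned_lattice_def by blast
  have "h z = (\<Sum>p\<in>S. of_int (u p) * h (p, 1))"
    unfolding S(3) linear_sum[OF h] by (simp add: linear_cmul[OF h] del: scaleR_Pair)
  also have "\<dots> = 0" by (rule sum.neutral) (use S(2) gen in auto)
  finally show ?thesis .
qed

lemma rank_form_integral:
  assumes "z \<in> spanned_lattice P" shows "rank_form M A z \<in> \<int>"
proof (rule linear_integral_on_lattice[OF linear_rank_form _ assms])
  fix p assume "p \<in> P \<inter> integer_points"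
  then have "p $ e \<in> \<int>" for e by (simp add: integer_points_def)
  then show "rank_form M A (p, 1) \<in> \<int>" unfolding rank_form_eq by (auto intro!: Ints_diff Ints_sum)
qed

lemma base_integer_point: "indicator_vec B \<in> integer_points"
  by (simp add: integer_points_def indicator_vec_nth)

lemma base_in_lattice: "B \<in> bases M \<Longrightarrow> (indicator_vec B, 1) \<in> spanned_lattice (base_polytope M)"
  by (rule spanned_lattice_generator) (simp add: base_in_polytope base_integer_point)

lemma lattice_integer_coords:
  fixes P :: "(real ^ 'n) set"
  assumes "(x, t) \<in> spanned_lattice P" shows "x $ e \<in> \<int>"
proof -
  have "linear (\<lambda>z::(real ^ 'n) \<times> real. fst z $ e)" by (intro linearI) auto
  then have "fst (x, t) $ e \<in> \<int>"
    by (rule linear_integral_on_lattice[OF _ _ assms]) (simp add: integer_points_def)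
  then show ?thesis by simp
qed

lemma linear_form_onto_integers:
  assumes h: "linear h" "\<And>z. z \<in> spanned_lattice P \<Longrightarrow> h z \<in> \<int>"
    and z: "z \<in> spanned_lattice P" "h z = (1::real)"
  shows "h ` spanned_lattice P = \<int>"
proof
  show "h ` spanned_lattice P \<subseteq> \<int>" using h(2) by blast
  show "\<int> \<subseteq> h ` spanned_lattice P"
  proof
    fix n :: real assume "n \<in> \<int>"
    then obtain k where k: "n = of_int k" by (auto elim: Ints_cases)
    have "h (of_int k *\<^sub>R z) = n" using linear_cmul[OF h(1), of "of_int k" z] z(2) k by simp
    then show "n \<in> h ` spanned_lattice P" using spanned_lattice_scale[OF z(1), of k] by (metis imageI)
  qed
qed

section \<open>Integer decomposition for base polytopes\<close>

lemma lattice_polytope_base_polytope: "lattice_polytope (base_polytope (M :: 'e::finite matroid))"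
  unfolding lattice_polytope_def base_polytope_eq
  by (rule exI[of _ "indicator_vec ` bases M"]) (auto simp: base_integer_point)

lemma vec_eq_sum_bases:
  fixes x :: "real ^ 'e::finite" and y :: "'e \<Rightarrow> int"
  assumes "\<And>e. x $ e = of_int (y e)" "\<And>e. y e = (\<Sum>i<k. of_bool (e \<in> B i))"
  shows "x = (\<Sum>i<k. indicator_vec (B i))"
  by (simp add: vec_eq_iff assms indicator_vec_nth)

lemma integer_vector_sum_of_bases:
  fixes M :: "'e::finite matroid" and x :: "real ^ 'e"
  assumes M: "is_matroid M" and int: "\<And>e. x $ e \<in> \<int>"
    and le: "\<And>A. 0 \<le> rank_form M A (x, real k)" and eq: "rank_form M UNIV (x, real k) = 0"
  obtains B where "\<And>i. i < k \<Longrightarrow> B i \<in> bases M" "x = (\<Sum>i<k. indicator_vec (B i))"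
proof -
  define y where "y e = \<lfloor>x $ e\<rfloor>" for e
  have y: "x $ e = of_int (y e)" for e using int[of e] by (simp add: y_def)
  have "real_of_int (sum y A) \<le> real_of_int (int k * int (rk M A))" for A
    using le[of A] by (simp add: rank_form_eq y)
  then have 1: "sum y A \<le> int k * int (rk M A)" for A by (simp only: of_int_le_iff)
  have "real_of_int (sum y UNIV) = real_of_int (int k * int (rk M UNIV))"
    using eq by (simp add: rank_form_eq y)
  then have 2: "sum y UNIV = int k * int (rk M UNIV)" by (simp only: of_int_eq_iff)
  obtain B where B: "\<forall>i<k. B i \<in> bases M" "\<forall>e. y e = (\<Sum>i<k. of_bool (e \<in> B i))"
    using integer_point_sum_of_bases[OF M 1 2] by blast
  show ?thesis
    by (rule that[of B]) (use B vec_eq_sum_bases[where k = k and B = B, OF y] in blast)+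
qed

lemma rank_form_UNIV_zero:
  assumes M: "is_matroid M" and z: "z \<in> cone_over (base_polytope M)" shows "rank_form M UNIV z = 0"
proof (rule linear_zero_on_cone[OF linear_rank_form _ z])
  fix B assume B: "B \<in> bases M"
  have "rk M UNIV = rk M (ground M)" using rk_Int_ground[OF M, of UNIV] by simp
  then show "rank_form M UNIV (indicator_vec B, 1) = 0"
    using B bases_iff[OF M] by (simp add: rank_form_base)
qed

lemma dilate_in_cone:
  assumes "x \<in> (\<lambda>p. real k *\<^sub>R p) ` base_polytope M"
  shows "(x, real k) \<in> cone_over (base_polytope M)"
proof -
  obtain p where p: "p \<in> base_polytope M" "x = real k *\<^sub>R p" using assms by blast
  have "(x, real k) = real k *\<^sub>R (p, 1)" using p by simp
  then show ?thesis using cone_scale[OF in_polytope_in_cone[OF p(1)]] by (metis of_nat_0_le_iff)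
qed

lemma integer_decomposition_base_polytope:
  fixes M :: "'e::finite matroid"
  assumes M: "is_matroid M" shows "integer_decomposition_property (base_polytope M)"
  unfolding integer_decomposition_property_def
proof (intro allI impI ballI)
  fix k :: nat and x
  assume k: "0 < k" "x \<in> (\<lambda>p. real k *\<^sub>R p) ` base_polytope M"
    "(x, real k) \<in> spanned_lattice (base_polytope M)"
  note c = dilate_in_cone[OF k(2)]
  obtain B where B: "\<And>i. i < k \<Longrightarrow> B i \<in> bases M" "x = (\<Sum>i<k. indicator_vec (B i))"
    using integer_vector_sum_of_bases[OF M lattice_integer_coords[OF k(3)] rank_form_nonneg[OF M c]
        rank_form_UNIV_zero[OF M c]] by blast
  show "\<exists>w. (\<forall>i<k. w i \<in> base_polytope M \<and> (w i, 1) \<in> spanned_lattice (base_polytope M)) \<and> x = (\<Sum>i<k. w i)"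
    by (rule exI[of _ "\<lambda>i. indicator_vec (B i)"]) (use B base_in_polytope base_in_lattice in blast)
qed

lemma sum_of_bases_in_dilate:
  assumes B: "\<And>i. i < k \<Longrightarrow> B i \<in> bases M" and k: "0 < k"
  shows "(\<Sum>i<k. indicator_vec (B i)) \<in> (\<lambda>p. real k *\<^sub>R p) ` base_polytope M"
    and "(\<Sum>i<k. indicator_vec (B i), real k) \<in> spanned_lattice (base_polytope M)"
proof -
  have "(\<Sum>i<k. (1 / real k) *\<^sub>R indicator_vec (B i)) \<in> base_polytope M"
    by (rule convex_sum) (use B k base_in_polytope in \<open>auto simp: base_polytope_eq\<close>)
  then have "real k *\<^sub>R (\<Sum>i<k. (1 / real k) *\<^sub>R indicator_vec (B i)) \<in> (\<lambda>p. real k *\<^sub>R p) ` base_polytope M"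
    by (rule imageI)
  moreover have "real k *\<^sub>R (\<Sum>i<k. (1 / real k) *\<^sub>R indicator_vec (B i)) = (\<Sum>i<k. indicator_vec (B i))"
    using k by (simp add: scaleR_sum_right)
  ultimately show "(\<Sum>i<k. indicator_vec (B i)) \<in> (\<lambda>p. real k *\<^sub>R p) ` base_polytope M" by simp
  have "(\<Sum>i<k. (indicator_vec (B i), 1)) \<in> spanned_lattice (base_polytope M)"
    by (rule spanned_lattice_sum) (use B base_in_lattice in auto)
  moreover have "(\<Sum>i<k. (indicator_vec (B i), 1::real)) = (\<Sum>i<k. indicator_vec (B i), real k)"
    by (simp add: prod_eq_iff fst_sum snd_sum)
  ultimately show "(\<Sum>i<k. indicator_vec (B i), real k) \<in> spanned_lattice (base_polytope M)" by simp
qed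

section \<open>Gorenstein base polytopes and Gorenstein blocks\<close>

text \<open>The rank function of the direct sum of the restriction to \<open>A\<close> and the contraction of \<open>A\<close>. Its
  bases are the bases of \<open>M\<close> on the face where the inequality of \<open>A\<close> is tight.\<close>

definition face_rank :: "'a matroid \<Rightarrow> 'a set \<Rightarrow> 'a set \<Rightarrow> nat" where
  "face_rank M A X = rk M (X \<inter> A) + (rk M (X \<union> A) - rk M A)"

lemma face_rank_function:
  assumes M: "is_matroid M" and A: "A \<subseteq> ground M"
  shows "rank_function (ground M) (face_rank M A)"
proof -
  have ge: "rk M A \<le> rk M (X \<union> A)" for X by (rule rk_mono[OF M]) simp
  have "face_rank M A X \<le> face_rank M A (insert e X) \<and> face_rank M A (insert e X) \<le> Suc (face_rank M A X)"
    for X e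
  proof (cases "e \<in> A")
    case True
    then have "insert e X \<inter> A = insert e (X \<inter> A)" "insert e X \<union> A = X \<union> A" by auto
    then show ?thesis unfolding face_rank_def
      using rk_insert_le[OF M, of e "X \<inter> A"] rk_mono[OF M, of "X \<inter> A" "insert e (X \<inter> A)"] by auto
  next
    case False
    then have "insert e X \<inter> A = X \<inter> A" "insert e X \<union> A = insert e (X \<union> A)" by auto
    moreover have "rk M (X \<union> A) \<le> rk M (insert e (X \<union> A))" by (rule rk_mono[OF M]) blast
    ultimately show ?thesis unfolding face_rank_def
      using rk_insert_le[OF M, of e "X \<union> A"] ge[of X] by auto
  qed
  moreover have "face_rank M A (X \<union> Y) + face_rank M A (X \<inter> Y) \<le> face_rank M A X + face_rank M A Y" for X Y
  proof -
    have "(X \<inter> A) \<union> (Y \<inter> A) = (X \<union> Y) \<inter> A" "(X \<inter> A) \<inter> (Y \<inter> A) = X \<inter> Y \<inter> A"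
      "(X \<union> A) \<union> (Y \<union> A) = X \<union> Y \<union> A" "(X \<union> A) \<inter> (Y \<union> A) = X \<inter> Y \<union> A" by auto
    then show ?thesis unfolding face_rank_def
      using rk_submodular[OF M, of "X \<inter> A" "Y \<inter> A"] rk_submodular[OF M, of "X \<union> A" "Y \<union> A"]
        ge[of X] ge[of Y] ge[of "X \<union> Y"] ge[of "X \<inter> Y"] by simp
  qed
  moreover have "face_rank M A {} = 0"
    unfolding face_rank_def using rank_functionD(2)[OF rank_function_rk[OF M]] by simp
  ultimately show ?thesis
    unfolding rank_function_def submodular_on_def using matroidD(1)[OF M] by blast
qed

lemma face_base:
  assumes M: "is_matroid M" and A: "A \<subseteq> ground M"
    and B: "B \<in> bases (matroid_of_rank (ground M) (face_rank M A))"
  shows "B \<in> bases M" "card (B \<inter> A) = rk M A"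
proof -
  note R = face_rank_function[OF M A]
  let ?N = "matroid_of_rank (ground M) (face_rank M A)"
  have g: "ground ?N = ground M" by (simp add: matroid_of_rank_def)
  have "B \<in> indeps ?N" "card B = rk ?N (ground M)"
    using B bases_iff[OF is_matroid_matroid_of_rank[OF R]] g by auto
  then have B1: "B \<subseteq> ground M" "face_rank M A B = card B" "card B = face_rank M A (ground M)"
    using rk_matroid_of_rank[OF R order_refl] by (auto simp: matroid_of_rank_def)
  have ge: "rk M A \<le> rk M (X \<union> A)" for X by (rule rk_mono[OF M]) simp
  have "ground M \<inter> A = A" "ground M \<union> A = ground M" using A by auto
  then have cB: "card B = rk M (ground M)"
    using B1(3) rk_mono[OF M A] by (simp add: face_rank_def)
  have fin: "finite B" using B1(1) matroidD(1)[OF M] finite_subset by blast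
  have "B \<inter> A \<union> (B - A) = B" by auto
  then have split: "card B = card (B \<inter> A) + card (B - A)"
    using card_Int_Diff[OF fin, of A] by simp
  have 1: "rk M (B \<inter> A) \<le> card (B \<inter> A)" by (rule rk_le_card[OF M]) (use fin in simp)
  have 2: "rk M (B \<union> A) \<le> rk M A + card (B - A)"
  proof -
    have "rk M (A \<union> (B - A)) + rk M (A \<inter> (B - A)) \<le> rk M A + rk M (B - A)" by (rule rk_submodular[OF M])
    moreover have "A \<union> (B - A) = B \<union> A" by auto
    moreover have "rk M (B - A) \<le> card (B - A)" by (rule rk_le_card[OF M]) (use fin in simp)
    ultimately show ?thesis by simp
  qed
  have tight: "rk M (B \<inter> A) = card (B \<inter> A)" "rk M (B \<union> A) = rk M A + card (B - A)"
    using 1 2 split B1(2) ge[of B] unfolding face_rank_def by linarith+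
  have "rk M (B \<union> A) + rk M (B \<inter> A) \<le> rk M B + rk M A" by (rule rk_submodular[OF M])
  then have "card B \<le> rk M B" using tight split by simp
  then have "rk M B = card B" using rk_le_card[OF M fin] by simp
  then show BM: "B \<in> bases M" using bases_iff[OF M] indep_iff_rk[OF M] B1(1) cB by simp
  have "rk M (B \<union> A) \<le> rk M (ground M)" by (rule rk_mono[OF M]) (use A B1(1) in simp)
  then show "card (B \<inter> A) = rk M A"
    using tight(2) cB split card_base_Int_le[OF M BM, of A] by linarith
qed

text \<open>Faces of a polyhedral cone are exposed, and a supporting hyperplane of a nonempty face passes through
  the origin because the cone can be scaled.\<close>

lemma facet_functional:
  fixes M :: "'e::finite matroid"
  assumes F: "F facet_of cone_over (base_polytope M)"
  obtains a where "linear a" "\<And>z. z \<in> cone_over (base_polytope M) \<Longrightarrow> 0 \<le> (a z :: real)"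
    "\<And>z. z \<in> F \<Longrightarrow> z \<in> cone_over (base_polytope M) \<and> a z = 0"
    "\<exists>B\<in>bases M. a (indicator_vec B, 1) \<noteq> 0"
proof -
  let ?C = "cone_over (base_polytope M)"
  have "F face_of ?C" "F \<noteq> {}" "aff_dim F = aff_dim ?C - 1" using F by (auto simp: facet_of_def)
  then have "F exposed_face_of ?C" and neq: "F \<noteq> ?C"
    using exposed_face_of_polyhedron[OF polyhedron_cone_over] by auto
  then obtain c b where cb: "?C \<subseteq> {z. c \<bullet> z \<le> b}" "F = ?C \<inter> {z. c \<bullet> z = b}"
    unfolding exposed_face_of_def by blast
  obtain z where z: "z \<in> F" using \<open>F \<noteq> {}\<close> by blast
  have zC: "z \<in> ?C" "c \<bullet> z = b" using z cb by auto
  have "0 \<in> ?C" "2 *\<^sub>R z \<in> ?C" using cone_scale[OF zC(1), of 0] cone_scale[OF zC(1), of 2] by auto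
  then have "c \<bullet> 0 \<le> b" "c \<bullet> (2 *\<^sub>R z) \<le> b" using cb(1) by blast+
  then have b: "b = 0" using zC(2) by simp
  let ?a = "\<lambda>z. - (c \<bullet> z)"
  have lin: "linear ?a"
    by (rule linear_compose_neg) (rule bounded_linear.linear[OF bounded_linear_inner_right])
  show ?thesis
  proof (rule that[of ?a])
    show "linear ?a" by (rule lin)
    show "0 \<le> ?a z" if "z \<in> ?C" for z using cb(1) b that by auto
    show "z \<in> ?C \<and> ?a z = 0" if "z \<in> F" for z using cb(2) b that by auto
    show "\<exists>B\<in>bases M. ?a (indicator_vec B, 1) \<noteq> 0"
    proof (rule ccontr)
      assume n: "\<not> ?thesis"
      have "?a z = 0" if "z \<in> ?C" for z
        by (rule linear_zero_on_cone[OF lin _ that]) (use n in blast)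
      then have "?C \<subseteq> F" using cb(2) b by auto
      then show False using neq cb(2) by blast
    qed
  qed
qed

lemma linear_at_base:
  fixes h :: "(real ^ 'e::finite) \<times> real \<Rightarrow> real"
  assumes h: "linear h"
  shows "h (indicator_vec B, 1) = (\<Sum>e\<in>B. h (axis e 1, 0)) + h (0, 1)"
proof -
  have e: "(indicator_vec B, 1) = (\<Sum>e\<in>B. (axis e 1, 0)) + (0 :: real ^ 'e, 1 :: real)"
    by (simp add: prod_eq_iff fst_sum snd_sum indicator_vec_def)
  show ?thesis unfolding e by (simp add: linear_add[OF h] linear_sum[OF h] del: add_Pair)
qed

locale matroid_polytope = matroid_partition M \<P> for M :: "'e::finite matroid" and \<P>
begin

abbreviation C where "C \<equiv> cone_over (base_polytope M)"

lemma obtain_base: obtains B where "B \<in> bases M"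
  using base_extend[OF M matroidD(2)[OF M]] by blast

text \<open>Where the ranks are modular, a base that is tight for the union and the intersection of two sets is
  tight for the two sets, since neither of them can exceed its rank.\<close>

lemma block_value_tight:
  assumes P: "P \<in> \<P>" and d: "0 < \<delta>"
    and S: "S \<union> S' = T" "S \<inter> S' = A" "T \<subseteq> P"
    and f: "slack \<delta> v (rk M) S + slack \<delta> v (rk M) S' = slack \<delta> v (rk M) T + slack \<delta> v (rk M) A"
    and B: "B \<in> bases M" "card (B \<inter> T) = rk M T" "card (B \<inter> A) = rk M A"
  shows "card (B \<inter> S) = rk M S"
proof -
  have fin: "finite S" "finite S'" using S(1,3) finite_part[OF P] finite_subset by blast+
  have "rk M S + rk M S' = rk M T + rk M A"
    using slack_modular_iff[OF fin d, of v "rk M"] f S by simp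
  moreover have "card (B \<inter> S) + card (B \<inter> S') = card (B \<inter> T) + card (B \<inter> A)"
  proof -
    have "(B \<inter> S) \<union> (B \<inter> S') = B \<inter> T" "(B \<inter> S) \<inter> (B \<inter> S') = B \<inter> A" using S by auto
    then show ?thesis using card_Un_Int[of "B \<inter> S" "B \<inter> S'"] fin by simp
  qed
  ultimately show ?thesis
    using B card_base_Int_le[OF M B(1), of S] card_base_Int_le[OF M B(1), of S'] by linarith
qed

text \<open>Among the proper subsets of blocks whose inequality is tight on a given face, one of least slack
  cannot split, since the pieces of a splitting are tight as well and have smaller slack. Hence its
  slack is one.\<close>

lemma tight_set_with_slack_one:
  assumes d: "0 < \<delta>" and block: "\<And>P. P \<in> \<P> \<Longrightarrow> gorenstein_block (slack \<delta> v (rk M)) P"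
    and P0: "P0 \<in> \<P>" "A0 \<noteq> {}" "A0 \<subset> P0"
    and tight: "\<And>B. B \<in> \<B> \<Longrightarrow> B \<in> bases M \<and> card (B \<inter> A0) = rk M A0"
  shows "\<exists>P\<in>\<P>. \<exists>A. A \<noteq> {} \<and> A \<subset> P \<and> slack \<delta> v (rk M) A = 1 \<and> (\<forall>B\<in>\<B>. card (B \<inter> A) = rk M A)"
proof -
  let ?f = "slack \<delta> v (rk M)"
  define Q where "Q A \<longleftrightarrow> A \<noteq> {} \<and> A \<subset> P0 \<and> (\<forall>B\<in>\<B>. card (B \<inter> A) = rk M A)" for A
  have Q0: "Q A0" using P0 tight by (simp add: Q_def)
  \<comment> \<open>Slacks of proper sets are positive, so they can be compared as natural numbers.\<close>
  obtain A where QA: "Q A" and min: "\<And>A'. Q A' \<Longrightarrow> nat (?f A) \<le> nat (?f A')"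
    using ex_has_least_nat[of Q A0 "\<lambda>A. nat (?f A)"] Q0 by blast
  note D = gorenstein_blockD[OF block[OF P0(1)]]
  have A: "A \<noteq> {}" "A \<subset> P0" "\<And>B. B \<in> \<B> \<Longrightarrow> card (B \<inter> A) = rk M A" using QA by (auto simp: Q_def)
  have nolower: "\<not> ?f A' < ?f A" if "Q A'" for A'
  proof -
    have "1 \<le> ?f A'" using D(3)[of A'] that by (simp add: Q_def)
    then show ?thesis using min[OF that] D(3)[OF A(1,2)] by linarith
  qed
  have "\<not> splits_inside ?f A"
  proof
    assume "splits_inside ?f A"
    then obtain S S' where S: "S \<noteq> {}" "S' \<noteq> {}" "S \<inter> S' = {}" "S \<union> S' = A" "?f S + ?f S' = ?f A"
      unfolding splits_inside_def by blast
    have "card (B \<inter> S) = rk M S" if "B \<in> \<B>" for B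
      by (rule block_value_tight[OF P0(1) d S(4,3), where v = v])
        (use S D(1) A(2) A(3)[OF that] tight[OF that] rk_empty in auto)
    moreover have SP: "S \<subset> P0" "S' \<subset> P0" using S(4) A(2) by auto
    ultimately have "Q S" using S(1) by (simp add: Q_def)
    then show False using nolower[of S] D(3)[OF S(2) SP(2)] S(5) by linarith
  qed
  moreover have "\<not> splits_outside ?f P0 A"
  proof
    assume "splits_outside ?f P0 A"
    then obtain S S' where S: "S \<subset> P0" "S' \<subset> P0" "S \<inter> S' = A" "S \<union> S' = P0" "?f S + ?f S' = ?f A"
      unfolding splits_outside_def by blast
    have "card (B \<inter> S) = rk M S" if "B \<in> \<B>" for B
      by (rule block_value_tight[OF P0(1) d S(4,3), where v = v])
        (use S D(2) A(2) A(3)[OF that] tight[OF that] base_part[OF _ P0(1)] in auto)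
    moreover have ne: "S \<noteq> {}" "S' \<noteq> {}" using S(3) A(1) by auto
    ultimately have "Q S" using S(1) by (simp add: Q_def)
    then show False using nolower[of S] D(3)[OF ne(2) S(2)] S(5) by linarith
  qed
  ultimately have "?f A = 1" using D(4)[OF A(1,2)] by blast
  then show ?thesis using A P0(1) by blast
qed

text \<open>A supporting form is a weight that is not constant on some block. The heaviest elements of this block
  form the required set, since the bases on the face are those of maximum weight. If the face contains no
  base, any proper subset will do.\<close>

lemma facet_tight_set:
  assumes a: "linear a" "\<And>z. z \<in> C \<Longrightarrow> 0 \<le> (a z :: real)"
    and nz: "\<exists>B\<in>bases M. a (indicator_vec B, 1) \<noteq> 0"
    and P0: "P0 \<in> \<P>" "2 \<le> card P0"
  shows "\<exists>P\<in>\<P>. \<exists>A. A \<noteq> {} \<and> A \<subset> P \<and>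
    (\<forall>B\<in>bases M. a (indicator_vec B, 1) = 0 \<longrightarrow> card (B \<inter> A) = rk M A)"
proof (cases "\<exists>B0\<in>bases M. a (indicator_vec B0, 1) = 0")
  case False
  obtain p where p: "p \<in> P0" using P0(2) by fastforce
  have "{p} \<noteq> P0" using P0(2) by auto
  then have "{p} \<subset> P0" using p by blast
  then show ?thesis using P0(1) False by blast
next
  case True
  define w where "w e = - a (axis e 1, 0)" for e
  have aw: "a (indicator_vec B, 1) = a (0, 1) - sum w B" for B
    unfolding linear_at_base[OF a(1)] by (simp add: w_def sum_negf)
  have max: "sum w B' \<le> sum w B" if "B \<in> bases M" "a (indicator_vec B, 1) = 0" "B' \<in> bases M" for B B'
    using a(2)[OF base_in_cone[OF that(3)]] that(2) aw[of B] aw[of B'] by linarith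
  have "\<exists>P\<in>\<P>. \<exists>p\<in>P. \<exists>q\<in>P. w p < w q"
  proof (rule ccontr)
    assume "\<not> ?thesis"
    then have n: "w p = w q" if "P \<in> \<P>" "p \<in> P" "q \<in> P" for P p q
      using that by (meson linorder_neqE_linordered_idom)
    obtain B0 where B0: "B0 \<in> bases M" "a (indicator_vec B0, 1) = 0" using True by blast
    have "a (indicator_vec B, 1) = 0" if B: "B \<in> bases M" for B
      using weight_constant_on_parts[of w, OF n B B0(1)] aw[of B] aw[of B0] B0(2) by simp
    then show False using nz by blast
  qed
  then obtain P p q where P: "P \<in> \<P>" "p \<in> P" "q \<in> P" "w p < w q" by blast
  define U where "U = {e \<in> ground M. w q \<le> w e}"
  have U: "U \<subseteq> ground M" "q \<in> U" "p \<notin> U" using P part_subset[OF P(1)] by (auto simp: U_def)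
  have tight: "card (B \<inter> (U \<inter> P)) = rk M (U \<inter> P)" if B: "B \<in> bases M" "a (indicator_vec B, 1) = 0" for B
  proof (rule base_tight_part[OF B(1) U(1) _ P(1)])
    show "card (B \<inter> U) = rk M U"
      by (rule max_weight_base_upper_set[OF M B(1), of w]) (use max[OF B] in \<open>auto simp: U_def\<close>)
  qed
  have "U \<inter> P \<noteq> {}" "U \<inter> P \<subset> P" using P U by auto
  then show ?thesis
    by (intro bexI[OF _ P(1)] exI[of _ "U \<inter> P"] conjI ballI impI) (simp_all add: tight)
qed

lemma rk_less_of_block:
  assumes d: "0 < \<delta>" and block: "gorenstein_block (slack \<delta> v (rk M)) P"
    and P: "P \<in> \<P>" and A: "A \<noteq> {}" "A \<subset> P"
  shows "rk M P < rk M A + rk M (P - A)"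
proof -
  let ?f = "slack \<delta> v (rk M)"
  have "1 \<le> ?f A" "1 \<le> ?f (P - A)" "?f P = 0" "?f {} = 0"
    using gorenstein_blockD(3)[OF block A] gorenstein_blockD(3)[OF block, of "P - A"]
      gorenstein_blockD(1,2)[OF block] A by auto
  then have n: "?f A + ?f (P - A) \<noteq> ?f (A \<union> (P - A)) + ?f (A \<inter> (P - A))"
    using A by (simp add: Un_absorb1 psubset_imp_subset)
  have "finite A" "finite (P - A)" using A finite_part[OF P] finite_subset by blast+
  then have "rk M A + rk M (P - A) \<noteq> rk M (A \<union> (P - A)) + rk M (A \<inter> (P - A))"
    using n slack_modular_iff[OF _ _ d] by blast
  moreover have "A \<union> (P - A) = P" "A \<inter> (P - A) = {}" using A by auto
  ultimately show ?thesis using rk_submodular[OF M, of A "P - A"] rk_empty by simp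
qed

lemma rank_form_reduced:
  assumes P: "P \<in> \<P>" "A \<subseteq> P" "rk M P < rk M A + rk M (P - A)"
  shows "rank_form M A ` spanned_lattice (base_polytope M) = \<int>"
proof -
  obtain B where B: "B \<in> bases M" "Suc (card (B \<inter> A)) = rk M A" using base_defect_one[OF P] .
  have "rank_form M A (indicator_vec B, 1) = 1" by (simp add: rank_form_base flip: B(2))
  then show ?thesis
    by (intro linear_form_onto_integers[OF linear_rank_form _ base_in_lattice[OF B(1)]] rank_form_integral)
qed

text \<open>The dilate contains \<open>v\<close> because the slacks are nonnegative. A facet is contained in the face of a set
  of slack one, and the rank form of this set is a reduced equation taking the value one at \<open>v\<close>.\<close>

lemma gorenstein_of_blocks:
  assumes d: "0 < \<delta>" and block: "\<And>P. P \<in> \<P> \<Longrightarrow> gorenstein_block (slack \<delta> v (rk M)) P"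
    and P0: "P0 \<in> \<P>" "2 \<le> card P0"
  shows "gorenstein_of_index \<delta> (base_polytope M)"
proof -
  let ?f = "slack \<delta> v (rk M)"
  define x :: "real ^ 'e" where "x = (\<chi> e. if e \<in> ground M then of_int (v e) else 0)"
  have x: "x $ e = (if e \<in> ground M then of_int (v e) else 0)" for e by (simp add: x_def)
  have xs: "(\<Sum>e\<in>A. x $ e) = of_int (sum v (A \<inter> ground M))" for A
    by (simp add: x sum.If_cases)
  have form: "rank_form M A (x, real \<delta>) = of_int (?f (A \<inter> ground M))" for A
    unfolding rank_form_eq xs slack_def using rk_Int_ground[OF M, of A] by simp
  have fsum: "?f A = (\<Sum>P\<in>\<P>. ?f (A \<inter> P))" if A: "A \<subseteq> ground M" for A
    unfolding slack_def using rk_over_parts[OF A] sum_over_parts[OF A, of v]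
    by (simp add: sum_subtractf sum_distrib_left)
  have ge: "0 \<le> rank_form M A (x, real \<delta>)" for A
  proof -
    have "0 \<le> ?f (A \<inter> ground M)"
      unfolding fsum[OF Int_lower2]
      by (rule sum_nonneg) (use gorenstein_blockD(5)[OF block] in auto)
    then show ?thesis by (simp add: form)
  qed
  have "?f (ground M) = (\<Sum>P\<in>\<P>. ?f P)"
    unfolding fsum[OF order_refl] by (rule sum.cong) (use part_subset in \<open>auto simp: Int_absorb1\<close>)
  then have eq: "rank_form M UNIV (x, real \<delta>) = 0"
    using gorenstein_blockD(2)[OF block] by (simp add: form)
  obtain B where B: "\<And>i. i < \<delta> \<Longrightarrow> B i \<in> bases M" "x = (\<Sum>i<\<delta>. indicator_vec (B i))"
    using integer_vector_sum_of_bases[OF M _ ge eq] x by (metis Ints_0 Ints_of_int)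
  note xd = sum_of_bases_in_dilate[where B = B, OF B(1) d, folded B(2)]
  have "\<exists>h. reduced_equation (base_polytope M) F h \<and> h (x, real \<delta>) = 1" if F: "F facet_of C" for F
  proof -
    obtain a where a: "linear a" "\<And>z. z \<in> C \<Longrightarrow> 0 \<le> (a z :: real)"
      "\<And>z. z \<in> F \<Longrightarrow> z \<in> C \<and> a z = 0" "\<exists>B\<in>bases M. a (indicator_vec B, 1) \<noteq> 0"
      using facet_functional[OF F] by metis
    obtain P A where PA: "P \<in> \<P>" "A \<noteq> {}" "A \<subset> P"
      "\<And>B. B \<in> {B \<in> bases M. a (indicator_vec B, 1) = 0} \<Longrightarrow> B \<in> bases M \<and> card (B \<inter> A) = rk M A"
      using facet_tight_set[OF a(1,2,4) P0] by blast
    have "\<exists>Q\<in>\<P>. \<exists>T. T \<noteq> {} \<and> T \<subset> Q \<and> ?f T = 1 \<and>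
        (\<forall>B\<in>{B \<in> bases M. a (indicator_vec B, 1) = 0}. card (B \<inter> T) = rk M T)"
      by (rule tight_set_with_slack_one[OF d block PA])
    then obtain Q T where T: "Q \<in> \<P>" "T \<noteq> {}" "T \<subset> Q" "?f T = 1"
      "\<And>B. B \<in> bases M \<Longrightarrow> a (indicator_vec B, 1) = 0 \<Longrightarrow> card (B \<inter> T) = rk M T"
      by blast
    have "rank_form M T z = 0" if z: "z \<in> F" for z
    proof (rule linear_zero_on_face[OF a(1) _ linear_rank_form])
      show "z \<in> C" "a z = 0" using a(3)[OF z] by auto
      show "0 \<le> a (indicator_vec B, 1)" if "B \<in> bases M" for B using a(2)[OF base_in_cone[OF that]] .
      show "rank_form M T (indicator_vec B, 1) = 0"
        if "B \<in> bases M" "a (indicator_vec B, 1) = 0" for B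
        using T(5)[OF that] by (simp add: rank_form_base)
    qed
    moreover have "rank_form M T ` spanned_lattice (base_polytope M) = \<int>"
      by (rule rank_form_reduced[OF T(1)])
        (use T rk_less_of_block[OF d block[OF T(1)] T(1-3)] in auto)
    ultimately have "reduced_equation (base_polytope M) F (rank_form M T)"
      unfolding reduced_equation_def using linear_rank_form rank_form_nonneg[OF M] by blast
    moreover have "T \<inter> ground M = T" using T(3) part_subset[OF T(1)] by blast
    ultimately show ?thesis using form[of T] T(4) by auto
  qed
  then show ?thesis
    unfolding gorenstein_of_index_def
    using lattice_polytope_base_polytope integer_decomposition_base_polytope[OF M] xd by blast
qed

text \<open>The base polytope is a point, and the cone over it is a ray, whose only facet is the apex. The height is
  its reduced equation.\<close>

lemma gorenstein_of_singletons:
  assumes single: "\<And>P. P \<in> \<P> \<Longrightarrow> card P \<le> 1"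
  shows "gorenstein_of_index 1 (base_polytope M)"
proof -
  obtain B0 where B0: "B0 \<in> bases M" by (rule obtain_base)
  have const: "w p = w q" if "P \<in> \<P>" "p \<in> P" "q \<in> P" for P p q and w :: "'e \<Rightarrow> real"
  proof -
    have "card P \<le> Suc 0" using single[OF that(1)] by simp
    then have "p = q" unfolding card_le_Suc0_iff_eq[OF finite_part[OF that(1)]] using that(2,3) by blast
    then show ?thesis by simp
  qed
  have "\<exists>h. reduced_equation (base_polytope M) F h \<and> h (indicator_vec B0, real 1) = 1"
    if F: "F facet_of C" for F
  proof -
    obtain a where a: "linear a" "\<And>z. z \<in> C \<Longrightarrow> 0 \<le> (a z :: real)"
      "\<And>z. z \<in> F \<Longrightarrow> z \<in> C \<and> a z = 0" "\<exists>B\<in>bases M. a (indicator_vec B, 1) \<noteq> 0"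
      using facet_functional[OF F] by metis
    obtain B1 where B1: "B1 \<in> bases M" "a (indicator_vec B1, 1) \<noteq> 0" using a(4) by blast
    have ne: "a (indicator_vec B, 1) \<noteq> 0" if B: "B \<in> bases M" for B
      using weight_constant_on_parts[of "\<lambda>e. a (axis e 1, 0)", OF const B B1(1)] B1(2)
      unfolding linear_at_base[OF a(1)] by simp
    have lin: "linear (snd :: (real ^ 'e) \<times> real \<Rightarrow> real)" by (rule linearI) simp_all
    have "snd z = 0" if z: "z \<in> F" for z
    proof (rule linear_zero_on_face[OF a(1) _ lin])
      show "z \<in> C" "a z = 0" using a(3)[OF z] by auto
      show "0 \<le> a (indicator_vec B, 1)" if "B \<in> bases M" for B using a(2)[OF base_in_cone[OF that]] .
    qed (use ne in blast)
    moreover have "0 \<le> snd z" if "z \<in> C" for z :: "(real ^ 'e) \<times> real"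
      by (rule linear_nonneg_on_cone[OF lin _ that]) simp
    moreover have "snd ` spanned_lattice (base_polytope M) = \<int>"
      by (rule linear_form_onto_integers[OF lin _ base_in_lattice[OF B0]])
        (auto intro: linear_integral_on_lattice[OF lin])
    ultimately have "reduced_equation (base_polytope M) F snd"
      unfolding reduced_equation_def using lin by blast
    then show ?thesis by auto
  qed
  moreover have "indicator_vec B0 \<in> (\<lambda>p. real 1 *\<^sub>R p) ` base_polytope M"
    using base_in_polytope[OF B0] by simp
  moreover have "(indicator_vec B0, real 1) \<in> spanned_lattice (base_polytope M)"
    using base_in_lattice[OF B0] by simp
  ultimately show ?thesis
    unfolding gorenstein_of_index_def
    using lattice_polytope_base_polytope integer_decomposition_base_polytope[OF M] by blast
qed

text \<open>A form that vanishes on the face of an unsplittable set is a weight that does not distinguish the bases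
  of the face. So it is constant on the pieces into which the matroid of the face decomposes.\<close>

lemma form_proportional_to_rank_form:
  fixes h :: "(real ^ 'e) \<times> real \<Rightarrow> real"
  assumes irr: "\<And>P X. P \<in> \<P> \<Longrightarrow> X \<noteq> {} \<Longrightarrow> X \<subset> P \<Longrightarrow> rk M P < rk M X + rk M (P - X)"
    and P: "P \<in> \<P>" and A: "A \<noteq> {}" "A \<subset> P"
    and inside: "\<And>S S'. S \<noteq> {} \<Longrightarrow> S' \<noteq> {} \<Longrightarrow> S \<inter> S' = {} \<Longrightarrow> S \<union> S' = A \<Longrightarrow> rk M S + rk M S' \<noteq> rk M A"
    and outside: "\<And>S S'. S \<subset> P \<Longrightarrow> S' \<subset> P \<Longrightarrow> S \<inter> S' = A \<Longrightarrow> S \<union> S' = P \<Longrightarrow>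
      rk M S + rk M S' \<noteq> rk M P + rk M A"
    and h: "linear h" "\<And>B. B \<in> bases M \<Longrightarrow> card (B \<inter> A) = rk M A \<Longrightarrow> h (indicator_vec B, 1) = 0"
  obtains \<mu> where "\<And>B. B \<in> bases M \<Longrightarrow> h (indicator_vec B, 1) = \<mu> * rank_form M A (indicator_vec B, 1)"
proof -
  let ?r = "face_rank M A" and ?N = "matroid_of_rank (ground M) (face_rank M A)"
  have AE: "A \<subseteq> ground M" using A part_subset[OF P] by blast
  note R = face_rank_function[OF M AE]
  have N: "is_matroid ?N" by (rule is_matroid_matroid_of_rank[OF R])
  have gN: "ground ?N = ground M" by (simp add: matroid_of_rank_def)
  define w where "w e = h (axis e 1, 0)" for e
  have hw: "h (indicator_vec B, 1) = sum w B + h (0, 1)" for B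
    unfolding linear_at_base[OF h(1)] w_def ..
  have const: "sum w B = sum w B'" if "B \<in> bases ?N" "B' \<in> bases ?N" for B B'
    using h(2)[OF face_base[OF M AE that(1)]] h(2)[OF face_base[OF M AE that(2)]] hw[of B] hw[of B']
    by linarith
  have sep: "?r (X \<inter> {e \<in> ground M. c \<le> w e}) + ?r (X - {e \<in> ground M. c \<le> w e}) = ?r X"
    if X: "X \<subseteq> ground M" for c X
  proof (rule rank_function_separator_additive[OF R _ _ X])
    let ?U = "{e \<in> ground M. c \<le> w e}"
    show "?U \<subseteq> ground M" by blast
    have "rk ?N ?U + rk ?N (ground ?N - ?U) = rk ?N (ground ?N)"
      by (rule constant_weight_separator[OF N const]) (auto simp: gN)
    then show "?r ?U + ?r (ground M - ?U) = ?r (ground M)"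
      using rk_matroid_of_rank[OF R] by (simp add: gN)
  qed
  have level: "w p = w q" if X: "X \<subseteq> ground M" and
    no: "\<And>Y. Y \<subset> X \<Longrightarrow> Y \<noteq> {} \<Longrightarrow> ?r Y + ?r (X - Y) \<noteq> ?r X" and pq: "p \<in> X" "q \<in> X" for X p q
  proof -
    have le: "\<not> w p < w q" if pq: "p \<in> X" "q \<in> X" for p q
    proof
      assume lt: "w p < w q"
      let ?Y = "X \<inter> {e \<in> ground M. w q \<le> w e}"
      have q: "q \<in> ?Y" using pq X by blast
      have "p \<notin> ?Y" using lt by simp
      then have 1: "?Y \<subset> X" using pq by blast
      have "X - ?Y = X - {e \<in> ground M. w q \<le> w e}" by blast
      then have "?r ?Y + ?r (X - ?Y) = ?r X" using sep[OF X, of "w q"] by simp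
      moreover have "?Y \<noteq> {}" using q by blast
      ultimately show False using no[OF 1] by blast
    qed
    show ?thesis using le[OF pq] le[OF pq(2,1)] by simp
  qed
  have r_in: "?r X = rk M X" if "X \<subseteq> A" for X
    unfolding face_rank_def using that by (simp add: Int_absorb2 Un_absorb1)
  have r_out: "?r X = rk M (X \<union> A) - rk M A" if "X \<inter> A = {}" for X
    unfolding face_rank_def using that rk_empty by simp
  have geA: "rk M A \<le> rk M (X \<union> A)" for X by (rule rk_mono[OF M]) simp
  have wA: "w p = w q" if "p \<in> A" "q \<in> A" for p q
  proof (rule level[OF AE _ that])
    fix Y assume Y: "Y \<subset> A" "Y \<noteq> {}"
    then have "rk M Y + rk M (A - Y) \<noteq> rk M A" by (intro inside) auto
    then show "?r Y + ?r (A - Y) \<noteq> ?r A" using Y r_in[of Y] r_in[of "A - Y"] r_in[of A] by auto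
  qed
  have wPA: "w p = w q" if "p \<in> P - A" "q \<in> P - A" for p q
  proof (rule level[OF _ _ that])
    show "P - A \<subseteq> ground M" using part_subset[OF P] by blast
    fix Y assume Y: "Y \<subset> P - A" "Y \<noteq> {}"
    have "rk M (Y \<union> A) + rk M (((P - A) - Y) \<union> A) \<noteq> rk M P + rk M A"
      by (rule outside) (use Y A in auto)
    moreover have "(P - A) \<union> A = P" using A by auto
    ultimately show "?r Y + ?r ((P - A) - Y) \<noteq> ?r (P - A)"
      using r_out[of Y] r_out[of "(P - A) - Y"] r_out[of "P - A"] Y geA[of Y] geA[of "(P - A) - Y"] geA[of "P - A"]
      by fastforce
  qed
  have wQ: "w p = w q" if Q: "Q \<in> \<P>" "Q \<noteq> P" and pq: "p \<in> Q" "q \<in> Q" for Q p q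
  proof (rule level[OF part_subset[OF Q(1)] _ pq])
    fix Y assume Y: "Y \<subset> Q" "Y \<noteq> {}"
    have "?r Z = rk M Z" if "Z \<subseteq> Q" for Z
    proof -
      have "Z \<inter> A = {}" using parts_disjoint[OF Q(1) P Q(2)] that A by blast
      then show ?thesis
        using r_out rk_Un_parts[OF Q(1) P Q(2) that psubset_imp_subset[OF A(2)]] by simp
    qed
    then show "?r Y + ?r (Q - Y) \<noteq> ?r Q" using irr[OF Q(1) Y(2,1)] Y by auto
  qed
  obtain p0 q0 where p0: "p0 \<in> A" and q0: "q0 \<in> P - A" using A by blast
  define \<mu> where "\<mu> = w q0 - w p0"
  \<comment> \<open>The correction on \<open>A\<close> levels the two values on \<open>P\<close>, so the new weight is the same on all bases.\<close>
  define w' where "w' e = w e + (if e \<in> A then \<mu> else 0)" for e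
  have w': "w' p = w' q" if Q: "Q \<in> \<P>" and pq: "p \<in> Q" "q \<in> Q" for Q p q
  proof (cases "Q = P")
    case True
    have "w' e = w q0" if "e \<in> P" for e
      using that wA[OF _ p0] wPA[OF _ q0] by (auto simp: w'_def \<mu>_def)
    then show ?thesis using pq True by simp
  next
    case False
    then have "p \<notin> A" "q \<notin> A" using parts_disjoint[OF Q P] A pq by auto
    then show ?thesis using wQ[OF Q False pq] by (simp add: w'_def)
  qed
  have sw': "sum w' B = sum w B + \<mu> * real (card (B \<inter> A))" if "finite B" for B
    unfolding w'_def using that by (simp add: sum.distrib sum.If_cases)
  obtain B0 where B0: "B0 \<in> bases M" "card (B0 \<inter> A) = rk M A" using base_chain[OF M order_refl] by metis
  have "h (indicator_vec B, 1) = \<mu> * rank_form M A (indicator_vec B, 1)" if B: "B \<in> bases M" for B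
  proof -
    have "sum w' B = sum w' B0" by (rule weight_constant_on_parts[OF w' B B0(1)])
    then have "sum w B + \<mu> * real (card (B \<inter> A)) = sum w B0 + \<mu> * real (rk M A)"
      using sw'[OF finite_base[OF B]] sw'[OF finite_base[OF B0(1)]] B0(2) by simp
    then show ?thesis using hw[of B] hw[of B0] h(2)[OF B0] by (simp add: rank_form_base algebra_simps)
  qed
  then show ?thesis by (rule that)
qed

text \<open>The face of a proper subset of a component is a proper face and lies in a facet, where the
  distinguished point does not lie; hence its slack is positive. If the set does not split, the reduced
  equation of that facet is the rank form of the set, so the slack is one.\<close>

lemma blocks_of_gorenstein:
  assumes irr: "\<And>P X. P \<in> \<P> \<Longrightarrow> X \<noteq> {} \<Longrightarrow> X \<subset> P \<Longrightarrow> rk M P < rk M X + rk M (P - X)"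
    and d: "0 < \<delta>" and G: "gorenstein_of_index \<delta> (base_polytope M)"
  shows "\<exists>v. \<forall>P\<in>\<P>. gorenstein_block (slack \<delta> v (rk M)) P"
proof -
  obtain x where x: "x \<in> (\<lambda>p. real \<delta> *\<^sub>R p) ` base_polytope M"
    "(x, real \<delta>) \<in> spanned_lattice (base_polytope M)"
    and facets: "\<And>F. F facet_of C \<Longrightarrow> \<exists>h. reduced_equation (base_polytope M) F h \<and> h (x, real \<delta>) = 1"
    using G unfolding gorenstein_of_index_def by blast
  have xC: "(x, real \<delta>) \<in> C" by (rule dilate_in_cone[OF x(1)])
  define v where "v e = \<lfloor>x $ e\<rfloor>" for e
  have xv: "x $ e = of_int (v e)" for e using lattice_integer_coords[OF x(2), of e] by (simp add: v_def)
  let ?f = "slack \<delta> v (rk M)"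
  have form: "rank_form M A (x, real \<delta>) = of_int (?f A)" for A
    by (simp add: rank_form_eq slack_def xv)
  have ge: "0 \<le> ?f A" for A using rank_form_nonneg[OF M xC, of A] by (simp add: form)
  have "rank_form M (ground M) (x, real \<delta>) = 0"
    by (rule linear_zero_on_cone[OF linear_rank_form _ xC])
      (use bases_iff[OF M] base_subset in \<open>auto simp: rank_form_base Int_absorb2\<close>)
  then have "?f (ground M) = 0" by (simp add: form)
  moreover have "?f (ground M) = (\<Sum>P\<in>\<P>. ?f P)"
  proof -
    have "(\<Sum>P\<in>\<P>. sum v (ground M \<inter> P)) = (\<Sum>P\<in>\<P>. sum v P)"
      by (rule sum.cong) (use part_subset in \<open>auto simp: Int_absorb1\<close>)
    then show ?thesis unfolding slack_def using rk_sum sum_over_parts[of "ground M" v]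
      by (simp add: sum_subtractf flip: sum_distrib_left of_nat_sum)
  qed
  ultimately have fP: "?f P = 0" if "P \<in> \<P>" for P
    using sum_nonneg_eq_0_iff[OF finite_parts, of ?f] ge that by simp
  have "gorenstein_block ?f P" if P: "P \<in> \<P>" for P
    unfolding gorenstein_block_def
  proof (intro conjI allI impI)
    show "?f {} = 0" using rk_empty by (simp add: slack_def)
    show "?f P = 0" by (rule fP[OF P])
    fix A assume A: "A \<noteq> {}" "A \<subset> P"
    let ?Z = "C \<inter> {z. (- indicator_vec A, real (rk M A)) \<bullet> z = 0}"
    have Z: "z \<in> ?Z \<longleftrightarrow> z \<in> C \<and> rank_form M A z = 0" for z by (simp add: rank_form_def)
    have face: "?Z face_of C"
      by (rule face_of_Int_supporting_hyperplane_ge[OF convex_cone_over])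
        (use rank_form_nonneg[OF M] in \<open>auto simp: rank_form_def\<close>)
    obtain B0 where B0: "B0 \<in> bases M" "card (B0 \<inter> A) = rk M A" using base_chain[OF M order_refl] by metis
    have in_Z: "(indicator_vec B, 1) \<in> ?Z" if "B \<in> bases M" "card (B \<inter> A) = rk M A" for B
      unfolding Z using that base_in_cone by (simp add: rank_form_base)
    have ne: "?Z \<noteq> {}" using in_Z[OF B0] by blast
    obtain B1 where B1: "B1 \<in> bases M" "Suc (card (B1 \<inter> A)) = rk M A"
      using base_defect_one[OF P psubset_imp_subset[OF A(2)] irr[OF P A]] .
    have form1: "rank_form M A (indicator_vec B1, 1) = 1" by (simp add: rank_form_base flip: B1(2))
    have "(indicator_vec B1, 1) \<notin> ?Z" unfolding Z using form1 by simp
    then have neC: "?Z \<noteq> C" using base_in_cone[OF B1(1)] by blast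
    obtain F where F: "F facet_of C" "?Z \<subseteq> F"
      using face_of_polyhedron_subset_facet[OF polyhedron_cone_over face ne neC] .
    obtain h where h: "reduced_equation (base_polytope M) F h" "h (x, real \<delta>) = 1"
      using facets[OF F(1)] by blast
    have hl: "linear h" and hF: "\<And>z. z \<in> F \<Longrightarrow> h z = 0" and hC: "\<And>z. z \<in> C \<Longrightarrow> 0 \<le> h z"
      and hZ: "h ` spanned_lattice (base_polytope M) = \<int>"
      using h(1) unfolding reduced_equation_def by blast+
    have "?f A \<noteq> 0"
    proof
      assume "?f A = 0"
      then have "(x, real \<delta>) \<in> ?Z" unfolding Z using xC form[of A] by simp
      then show False using F(2) hF h(2) by fastforce
    qed
    then show "1 \<le> ?f A" using ge[of A] by linarith
    show "?f A = 1 \<or> splits_inside ?f A \<or> splits_outside ?f P A"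
    proof (rule ccontr)
      assume n: "\<not> ?thesis"
      have finP: "finite S" if "S \<subseteq> P" for S using that finite_part[OF P] finite_subset by blast
      have inside: "rk M S + rk M S' \<noteq> rk M A"
        if S: "S \<noteq> {}" "S' \<noteq> {}" "S \<inter> S' = {}" "S \<union> S' = A" for S S'
      proof
        assume eq: "rk M S + rk M S' = rk M A"
        have fin: "finite S" "finite S'" using S(4) A(2) by (auto intro!: finP)
        have "?f S + ?f S' = ?f A"
          using slack_modular_iff[OF fin d, of v "rk M"] eq S(3,4) rk_empty \<open>?f {} = 0\<close> by simp
        then show False using n S unfolding splits_inside_def by blast
      qed
      have outside: "rk M S + rk M S' \<noteq> rk M P + rk M A"
        if S: "S \<subset> P" "S' \<subset> P" "S \<inter> S' = A" "S \<union> S' = P" for S S'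
      proof
        assume eq: "rk M S + rk M S' = rk M P + rk M A"
        have fin: "finite S" "finite S'" using S(1,2) by (auto intro!: finP)
        have "?f S + ?f S' = ?f A"
          using slack_modular_iff[OF fin d, of v "rk M"] eq S(3,4) fP[OF P] by simp
        then show False using n S unfolding splits_outside_def by blast
      qed
      obtain \<mu> where \<mu>: "\<And>B. B \<in> bases M \<Longrightarrow>
          h (indicator_vec B, 1) = \<mu> * rank_form M A (indicator_vec B, 1)"
      proof (rule form_proportional_to_rank_form[OF irr P A inside outside hl])
        show "h (indicator_vec B, 1) = 0" if "B \<in> bases M" "card (B \<inter> A) = rk M A" for B
          using hF in_Z[OF that] F(2) by blast
      qed auto
      have lin: "linear (\<lambda>z. h z - \<mu> * rank_form M A z)"
        using linear_compose_sub[OF hl linear_compose_scale_right[OF linear_rank_form, of \<mu>]] by simp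
      have onC: "h z - \<mu> * rank_form M A z = 0" if "z \<in> C" for z
        by (rule linear_zero_on_cone[OF lin _ that]) (simp add: \<mu>)
      have onL: "h z - \<mu> * rank_form M A z = 0" if "z \<in> spanned_lattice (base_polytope M)" for z
        by (rule linear_zero_on_lattice[OF lin onC[OF in_polytope_in_cone] that])
      have "1 \<in> h ` spanned_lattice (base_polytope M)" unfolding hZ by simp
      then obtain z where z: "z \<in> spanned_lattice (base_polytope M)" "h z = 1" by auto
      have "h (indicator_vec B1, 1) \<in> \<int>" using hZ base_in_lattice[OF B1(1)] by blast
      then have "\<mu> \<in> \<int>" using \<mu>[OF B1(1)] form1 by simp
      then obtain m where m: "\<mu> = of_int m" by (auto elim: Ints_cases)
      obtain k where k: "rank_form M A z = of_int k"
        using rank_form_integral[OF z(1), of M A] by (auto elim: Ints_cases)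
      \<comment> \<open>Both forms are integral on the lattice, and the reduced one attains 1, so the factor is a unit.\<close>
      have "of_int (m * k) = (1::real)" using onL[OF z(1)] z(2) m k by simp
      then have "m * k = 1" by (simp only: of_int_eq_1_iff)
      moreover have "0 \<le> m" using hC[OF base_in_cone[OF B1(1)]] \<mu>[OF B1(1)] form1 m by simp
      ultimately have "m = 1" using zmult_eq_1_iff by auto
      then have "h (x, real \<delta>) = rank_form M A (x, real \<delta>)" using onC[OF xC] m by simp
      then have "?f A = 1" using h(2) form[of A] by simp
      then show False using n by blast
    qed
  qed
  then show ?thesis by blast
qed

end

section \<open>Uncrossing\<close>

definition intersecting_submodular :: "'a set set \<Rightarrow> ('a set \<Rightarrow> nat) \<Rightarrow> bool" where
  "intersecting_submodular \<F> g \<longleftrightarrow> (\<forall>A\<in>\<F>. \<forall>B\<in>\<F>. A \<inter> B \<noteq> {} \<longrightarrow>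
     A \<inter> B \<in> \<F> \<and> A \<union> B \<in> \<F> \<and> g (A \<union> B) + g (A \<inter> B) \<le> g A + g B)"

lemma intersecting_submodularD:
  assumes "intersecting_submodular \<F> g" "A \<in> \<F>" "B \<in> \<F>" "A \<inter> B \<noteq> {}"
  shows "A \<inter> B \<in> \<F>" "A \<union> B \<in> \<F>" "g (A \<union> B) + g (A \<inter> B) \<le> g A + g B"
  using assms unfolding intersecting_submodular_def by blast+

text \<open>The bound is part of the relation, so that least costs need not be mentioned while partitions are being
  rearranged.\<close>

definition partition_cost_le :: "'a set set \<Rightarrow> ('a set \<Rightarrow> nat) \<Rightarrow> 'a set \<Rightarrow> nat \<Rightarrow> bool" where
  "partition_cost_le \<F> g U k \<longleftrightarrow> (\<exists>\<P>. finite \<P> \<and> \<P> \<subseteq> \<F> \<and> disjoint \<P> \<and> \<Union>\<P> = U \<and> sum g \<P> \<le> k)"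

lemma partition_cost_leI:
  "finite \<P> \<Longrightarrow> \<P> \<subseteq> \<F> \<Longrightarrow> disjoint \<P> \<Longrightarrow> \<Union>\<P> = U \<Longrightarrow> sum g \<P> \<le> k \<Longrightarrow> partition_cost_le \<F> g U k"
  unfolding partition_cost_le_def by blast

lemma partition_cost_le_Un:
  assumes "partition_cost_le \<F> g U k" "partition_cost_le \<F> g V l" "U \<inter> V = {}"
  shows "partition_cost_le \<F> g (U \<union> V) (k + l)"
proof -
  obtain \<P> where P: "finite \<P>" "\<P> \<subseteq> \<F>" "disjoint \<P>" "\<Union>\<P> = U" "sum g \<P> \<le> k"
    using assms(1) unfolding partition_cost_le_def by blast
  obtain \<Q> where Q: "finite \<Q>" "\<Q> \<subseteq> \<F>" "disjoint \<Q>" "\<Union>\<Q> = V" "sum g \<Q> \<le> l"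
    using assms(2) unfolding partition_cost_le_def by blast
  show ?thesis
  proof (rule partition_cost_leI)
    show "finite (\<P> \<union> \<Q>)" "\<P> \<union> \<Q> \<subseteq> \<F>" "\<Union>(\<P> \<union> \<Q>) = U \<union> V" using P Q by auto
    show "disjoint (\<P> \<union> \<Q>)" by (rule disjoint_union[OF P(3) Q(3)]) (use P Q assms(3) in simp)
    have "sum g (\<P> \<union> \<Q>) \<le> sum g \<P> + sum g \<Q>" using sum.union_inter[OF P(1) Q(1), of g] by simp
    then show "sum g (\<P> \<union> \<Q>) \<le> k + l" using P(5) Q(5) by linarith
  qed
qed

text \<open>A set absorbs one after the other the members of a partition that it meets; each step is one
  application of submodularity, in which the intersection is the trace on the original set.\<close>

lemma absorb_partition:
  assumes sub: "intersecting_submodular \<F> g" and X: "X \<in> \<F>"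
    and "finite \<Q>" "\<Q> \<subseteq> \<F>" "disjoint \<Q>" "\<And>Q. Q \<in> \<Q> \<Longrightarrow> X \<inter> Q \<noteq> {}"
  shows "X \<union> \<Union>\<Q> \<in> \<F> \<and> g (X \<union> \<Union>\<Q>) + (\<Sum>Q\<in>\<Q>. g (X \<inter> Q)) \<le> g X + sum g \<Q>"
  using assms(3-6)
proof (induction \<Q> rule: finite_induct)
  case empty
  then show ?case using X by simp
next
  case (insert Q \<Q>)
  have "disjoint \<Q>" using insert.prems(2) by (rule pairwise_subset) blast
  then have IH: "X \<union> \<Union>\<Q> \<in> \<F>" "g (X \<union> \<Union>\<Q>) + (\<Sum>Q\<in>\<Q>. g (X \<inter> Q)) \<le> g X + sum g \<Q>"
    using insert.IH insert.prems(1,3) by auto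
  have "R \<inter> Q = {}" if "R \<in> \<Q>" for R
    using disjointD[OF insert.prems(2), of R Q] that insert.hyps(2) by blast
  then have trace: "(X \<union> \<Union>\<Q>) \<inter> Q = X \<inter> Q" by blast
  have Q: "Q \<in> \<F>" "X \<inter> Q \<noteq> {}" using insert.prems by auto
  note s = intersecting_submodularD[OF sub IH(1) Q(1), unfolded trace, OF Q(2)]
  have "X \<union> \<Union>\<Q> \<union> Q = X \<union> \<Union>(insert Q \<Q>)" by blast
  then show ?case using s IH(2) insert.hyps by simp
qed

lemma partition_cost_add_set:
  assumes sub: "intersecting_submodular \<F> g" and U: "partition_cost_le \<F> g U k" and X: "X \<in> \<F>"
  shows "\<exists>k1 k2. partition_cost_le \<F> g (U \<union> X) k1 \<and> partition_cost_le \<F> g (U \<inter> X) k2 \<and> k1 + k2 \<le> k + g X"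
proof -
  obtain \<P> where P: "finite \<P>" "\<P> \<subseteq> \<F>" "disjoint \<P>" "\<Union>\<P> = U" "sum g \<P> \<le> k"
    using U unfolding partition_cost_le_def by blast
  define \<Q> where "\<Q> = {Q \<in> \<P>. X \<inter> Q \<noteq> {}}"
  have Q: "\<Q> \<subseteq> \<P>" "finite \<Q>" "\<Q> \<subseteq> \<F>" "\<And>Q. Q \<in> \<Q> \<Longrightarrow> X \<inter> Q \<noteq> {}"
    using P(1,2) by (auto simp: \<Q>_def)
  have dQ: "disjoint \<Q>" using P(3) Q(1) by (rule pairwise_subset)
  have a: "X \<union> \<Union>\<Q> \<in> \<F>" "g (X \<union> \<Union>\<Q>) + (\<Sum>Q\<in>\<Q>. g (X \<inter> Q)) \<le> g X + sum g \<Q>"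
    using absorb_partition[OF sub X Q(2,3) dQ Q(4)] by auto
  have nQ: "X \<inter> R = {}" if "R \<in> \<P> - \<Q>" for R using that by (auto simp: \<Q>_def)
  have dj: "A \<inter> B = {}" if "A \<in> \<P>" "B \<in> \<P>" "A \<noteq> B" for A B using disjointD[OF P(3) that] .
  have "partition_cost_le \<F> g (U \<union> X) (g (X \<union> \<Union>\<Q>) + sum g (\<P> - \<Q>))"
  proof (rule partition_cost_leI)
    show "finite (insert (X \<union> \<Union>\<Q>) (\<P> - \<Q>))" using P(1) by simp
    show "insert (X \<union> \<Union>\<Q>) (\<P> - \<Q>) \<subseteq> \<F>" using a(1) P(2) by blast
    show "\<Union>(insert (X \<union> \<Union>\<Q>) (\<P> - \<Q>)) = U \<union> X" using P(4) Q(1) by blast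
    show "sum g (insert (X \<union> \<Union>\<Q>) (\<P> - \<Q>)) \<le> g (X \<union> \<Union>\<Q>) + sum g (\<P> - \<Q>)"
      using P(1) by (simp add: sum.insert_if)
    have "(X \<union> \<Union>\<Q>) \<inter> R = {}" if "R \<in> \<P> - \<Q>" for R
    proof -
      have "S \<inter> R = {}" if "S \<in> \<Q>" for S using dj[of S R] that \<open>R \<in> \<P> - \<Q>\<close> Q(1) by blast
      then show ?thesis using nQ[OF that] by blast
    qed
    moreover have "disjoint (\<P> - \<Q>)" using P(3) by (rule pairwise_subset) blast
    ultimately show "disjoint (insert (X \<union> \<Union>\<Q>) (\<P> - \<Q>))"
      unfolding pairwise_insert disjnt_def by (metis Int_commute)
  qed
  moreover have "partition_cost_le \<F> g (U \<inter> X) (\<Sum>Q\<in>\<Q>. g (X \<inter> Q))"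
  proof (rule partition_cost_leI)
    show "finite ((\<inter>) X ` \<Q>)" using Q(2) by simp
    show "(\<inter>) X ` \<Q> \<subseteq> \<F>" using intersecting_submodularD(1)[OF sub X] Q(3,4) by blast
    show "\<Union>((\<inter>) X ` \<Q>) = U \<inter> X" using P(4) by (auto simp: \<Q>_def)
    show "disjoint ((\<inter>) X ` \<Q>)"
    proof (rule disjointI)
      fix A B assume AB: "A \<in> (\<inter>) X ` \<Q>" "B \<in> (\<inter>) X ` \<Q>" "A \<noteq> B"
      then obtain Q Q' where "Q \<in> \<Q>" "Q' \<in> \<Q>" "A = X \<inter> Q" "B = X \<inter> Q'" by blast
      then show "A \<inter> B = {}" using dj[of Q Q'] AB(3) Q(1) by blast
    qed
    show "sum g ((\<inter>) X ` \<Q>) \<le> (\<Sum>Q\<in>\<Q>. g (X \<inter> Q))"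
      using sum_image_le[OF Q(2), of g "(\<inter>) X"] by (simp add: o_def)
  qed
  moreover have "sum g \<P> = sum g \<Q> + sum g (\<P> - \<Q>)"
    using sum.subset_diff[OF Q(1) P(1), of g] by simp
  then have "g (X \<union> \<Union>\<Q>) + sum g (\<P> - \<Q>) + (\<Sum>Q\<in>\<Q>. g (X \<inter> Q)) \<le> k + g X"
    using a(2) P(5) by linarith
  ultimately show ?thesis by blast
qed

text \<open>This is the submodularity of the Dilworth truncation. The members of a partition of the second set are
  added to the first set one at a time; their traces on the first set make up the intersection.\<close>

lemma partition_cost_submodular:
  assumes sub: "intersecting_submodular \<F> g"
    and U: "partition_cost_le \<F> g U k" and V: "partition_cost_le \<F> g V l"
  shows "\<exists>k1 k2. partition_cost_le \<F> g (U \<union> V) k1 \<and> partition_cost_le \<F> g (U \<inter> V) k2 \<and> k1 + k2 \<le> k + l"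
proof -
  obtain \<Q> where Q: "finite \<Q>" "\<Q> \<subseteq> \<F>" "disjoint \<Q>" "\<Union>\<Q> = V" "sum g \<Q> \<le> l"
    using V unfolding partition_cost_le_def by blast
  have "\<exists>k1 k2. partition_cost_le \<F> g (U \<union> \<Union>\<Q>) k1 \<and> partition_cost_le \<F> g (U \<inter> \<Union>\<Q>) k2 \<and>
      k1 + k2 \<le> k + sum g \<Q>"
    using Q(1-3)
  proof (induction \<Q> rule: finite_induct)
    case empty
    have "partition_cost_le \<F> g {} 0" by (rule partition_cost_leI[of "{}"]) auto
    then show ?case using U by auto
  next
    case (insert X \<Q>)
    have "disjoint \<Q>" using insert.prems(2) by (rule pairwise_subset) blast
    then obtain k1 k2 where k: "partition_cost_le \<F> g (U \<union> \<Union>\<Q>) k1"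
      "partition_cost_le \<F> g (U \<inter> \<Union>\<Q>) k2" "k1 + k2 \<le> k + sum g \<Q>"
      using insert.IH insert.prems(1) by auto
    have X: "X \<in> \<F>" using insert.prems(1) by blast
    obtain a b where ab: "partition_cost_le \<F> g ((U \<union> \<Union>\<Q>) \<union> X) a"
      "partition_cost_le \<F> g ((U \<union> \<Union>\<Q>) \<inter> X) b" "a + b \<le> k1 + g X"
      using partition_cost_add_set[OF sub k(1) X] by blast
    have "R \<inter> X = {}" if "R \<in> \<Q>" for R
      using disjointD[OF insert.prems(2), of R X] that insert.hyps(2) by blast
    then have e: "(U \<union> \<Union>\<Q>) \<inter> X = U \<inter> X" "(U \<inter> \<Union>\<Q>) \<inter> (U \<inter> X) = {}" by blast+
    have "partition_cost_le \<F> g ((U \<inter> \<Union>\<Q>) \<union> (U \<inter> X)) (k2 + b)"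
      by (rule partition_cost_le_Un[OF k(2) _ e(2)]) (use ab(2) e(1) in simp)
    moreover have "(U \<inter> \<Union>\<Q>) \<union> (U \<inter> X) = U \<inter> \<Union>(insert X \<Q>)"
      "(U \<union> \<Union>\<Q>) \<union> X = U \<union> \<Union>(insert X \<Q>)" by blast+
    moreover have "a + (k2 + b) \<le> k + sum g (insert X \<Q>)" using k(3) ab(3) insert.hyps by simp
    ultimately show ?case using ab(1) by metis
  qed
  then obtain k1 k2 where "partition_cost_le \<F> g (U \<union> V) k1" "partition_cost_le \<F> g (U \<inter> V) k2"
    "k1 + k2 \<le> k + sum g \<Q>" unfolding Q(4) by blast
  then show ?thesis using Q(5) by (meson add_left_mono le_trans)
qed

section \<open>The rank function of a crossing family\<close>

text \<open>The common hypotheses on the families for all \<open>\<delta>\<close>. For \<open>\<delta> = 2\<close> the family is meant to contain the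
  sets \<open>E - {e}\<close>.\<close>

locale crossing_family =
  fixes \<delta> :: nat and E :: "'a set" and \<G> :: "'a set set"
  assumes delta: "2 \<le> \<delta>" and finE: "finite E" and GE: "\<G> \<subseteq> Pow E"
    and singletons: "\<And>e. e \<in> E \<Longrightarrow> {e} \<in> \<G>"
    and crossing: "\<And>A B. A \<in> \<G> \<Longrightarrow> B \<in> \<G> \<Longrightarrow> A \<inter> B \<noteq> {} \<Longrightarrow> A \<union> B \<noteq> E \<Longrightarrow> A \<inter> B \<in> \<G> \<and> A \<union> B \<in> \<G>"
    and cardE: "\<delta> dvd card E" and card_member: "\<And>A. A \<in> \<G> \<Longrightarrow> card A mod \<delta> = 1"
begin

abbreviation closed_sets where "closed_sets \<equiv> intersection_family E \<G>"
abbreviation c where "c \<equiv> intersection_number E \<G>"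

lemma finG: "finite \<G>"
  using GE finE by (meson finite_Pow_iff finite_subset)

lemma member_proper: "A \<in> \<G> \<Longrightarrow> A \<noteq> {}" "A \<in> \<G> \<Longrightarrow> A \<noteq> E" "A \<in> \<G> \<Longrightarrow> A \<subseteq> E"
proof -
  assume A: "A \<in> \<G>"
  then have "card A mod \<delta> \<noteq> 0" using card_member by simp
  then show "A \<noteq> {}" "A \<noteq> E" using cardE by (auto simp: mod_eq_0_iff_dvd)
  show "A \<subseteq> E" using A GE by blast
qed

lemma closedD: "F \<in> closed_sets \<Longrightarrow> F \<noteq> {}" "F \<in> closed_sets \<Longrightarrow> F \<subseteq> E"
  unfolding intersection_family_def by auto

lemma closedI: "\<H> \<subseteq> \<G> \<Longrightarrow> F = E \<inter> \<Inter>\<H> \<Longrightarrow> F \<noteq> {} \<Longrightarrow> F \<in> closed_sets"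
  unfolding intersection_family_def by blast

lemma c_le:
  assumes "\<H> \<subseteq> \<G>" "F = E \<inter> \<Inter>\<H>" shows "c F \<le> card \<H>"
proof -
  have "finite \<H>" using assms(1) finG finite_subset by blast
  then show ?thesis unfolding intersection_number_def by (intro Least_le) (use assms in blast)
qed

lemma c_witness:
  assumes "F \<in> closed_sets"
  obtains \<H> where "\<H> \<subseteq> \<G>" "finite \<H>" "card \<H> = c F" "F = E \<inter> \<Inter>\<H>"
proof -
  obtain \<H> where H: "\<H> \<subseteq> \<G>" "F = E \<inter> \<Inter>\<H>" using assms unfolding intersection_family_def by blast
  have "finite \<H>" using H(1) finG finite_subset by blast
  let ?Q = "\<lambda>k. \<exists>\<H>. \<H> \<subseteq> \<G> \<and> finite \<H> \<and> card \<H> = k \<and> F = E \<inter> \<Inter>\<H>"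
  have "?Q (card \<H>)" using H \<open>finite \<H>\<close> by (intro exI[of _ \<H>] conjI refl)
  then have "?Q (c F)" unfolding intersection_number_def by (rule LeastI[of ?Q])
  then obtain \<H>' where "\<H>' \<subseteq> \<G> \<and> finite \<H>' \<and> card \<H>' = c F \<and> F = E \<inter> \<Inter>\<H>'" ..
  then show ?thesis using that[of \<H>'] by simp
qed

text \<open>Two members of a shortest representation that do not cover \<open>E\<close> could be replaced by their
  intersection.\<close>

lemma shortest_representation_covers:
  assumes F: "F \<noteq> {}" and H: "\<H> \<subseteq> \<G>" "card \<H> = c F" "F = E \<inter> \<Inter>\<H>"
    and AB: "A \<in> \<H>" "B \<in> \<H>" "A \<noteq> B"
  shows "A \<union> B = E"
proof (rule ccontr)
  assume n: "A \<union> B \<noteq> E"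
  have finH: "finite \<H>" using H(1) finG finite_subset by blast
  have "F \<subseteq> A \<inter> B" using H(3) AB by blast
  then have "A \<inter> B \<noteq> {}" using F by blast
  then have AG: "A \<inter> B \<in> \<G>" using crossing[of A B] AB H(1) n by blast
  let ?H = "insert (A \<inter> B) (\<H> - {A, B})"
  have "c F \<le> card ?H"
    by (rule c_le) (use AG H(1,3) AB in auto)
  also have "\<dots> \<le> Suc (card (\<H> - {A, B}))" by (rule card_insert_le_m1) simp_all
  also have "card (\<H> - {A, B}) = card \<H> - 2"
    using AB finH by (subst card_Diff_subset) auto
  finally have "c F \<le> Suc (card \<H> - 2)" .
  moreover have "2 \<le> card \<H>" using AB card_mono[OF finH, of "{A, B}"] by auto
  ultimately show False using H(2) by simp
qed

lemma member_closed: "A \<in> \<G> \<Longrightarrow> A \<in> closed_sets" "A \<in> \<G> \<Longrightarrow> c A \<le> 1"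
proof -
  assume A: "A \<in> \<G>"
  have e: "A = E \<inter> \<Inter>{A}" using member_proper(3)[OF A] by auto
  show "A \<in> closed_sets" by (rule closedI[OF _ e]) (use A member_proper in auto)
  show "c A \<le> 1" using c_le[OF _ e] A by simp
qed

lemma c_zero:
  assumes "F \<in> closed_sets" "c F = 0" shows "F = E"
proof -
  obtain \<H> where H: "\<H> \<subseteq> \<G>" "finite \<H>" "card \<H> = c F" "F = E \<inter> \<Inter>\<H>" using c_witness[OF assms(1)] .
  then have "\<H> = {}" using assms(2) by simp
  then show ?thesis using H(4) by simp
qed

lemma c_one:
  assumes "F \<in> closed_sets" "c F = 1" shows "F \<in> \<G>"
proof -
  obtain \<H> where H: "\<H> \<subseteq> \<G>" "finite \<H>" "card \<H> = c F" "F = E \<inter> \<Inter>\<H>" using c_witness[OF assms(1)] .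
  then obtain A where A: "\<H> = {A}" using assms(2) card_1_singletonE by metis
  then have "A \<subseteq> E" using H(1) GE by blast
  then show ?thesis using H(1,4) A by (simp add: Int_absorb1)
qed

text \<open>Complements turn the crossing family into an intersecting one as soon as a common point is fixed,
  and shortest representations into partitions.\<close>

definition complements_avoiding :: "'a \<Rightarrow> 'a set set" where
  "complements_avoiding p = {S. S \<subseteq> E \<and> p \<in> E - S \<and> E - S \<in> \<G>}"

lemma complements_intersecting: "intersecting_submodular (complements_avoiding p) (\<lambda>_. 1)"
  unfolding intersecting_submodular_def
proof (intro ballI impI conjI)
  fix S T assume ST: "S \<in> complements_avoiding p" "T \<in> complements_avoiding p" "S \<inter> T \<noteq> {}"
  have 1: "E - S \<in> \<G>" "E - T \<in> \<G>" "S \<subseteq> E" "T \<subseteq> E" "p \<in> (E - S) \<inter> (E - T)"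
    using ST by (auto simp: complements_avoiding_def)
  have "(E - S) \<union> (E - T) \<noteq> E" using ST(3) 1(3) by blast
  then have "(E - S) \<inter> (E - T) \<in> \<G>" "(E - S) \<union> (E - T) \<in> \<G>" using crossing[OF 1(1,2)] 1(5) by blast+
  moreover have "(E - S) \<inter> (E - T) = E - (S \<union> T)" "(E - S) \<union> (E - T) = E - (S \<inter> T)" by auto
  ultimately show "S \<inter> T \<in> complements_avoiding p" "S \<union> T \<in> complements_avoiding p"
    unfolding complements_avoiding_def using 1(3-5) by auto
qed simp

lemma closed_imp_partition:
  assumes F: "F \<in> closed_sets" and p: "p \<in> F"
  shows "partition_cost_le (complements_avoiding p) (\<lambda>_. 1) (E - F) (c F)"
proof -
  obtain \<H> where H: "\<H> \<subseteq> \<G>" "finite \<H>" "card \<H> = c F" "F = E \<inter> \<Inter>\<H>" using c_witness[OF F] .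
  show ?thesis
  proof (rule partition_cost_leI)
    show "finite ((-) E ` \<H>)" using H(2) by simp
    show "(-) E ` \<H> \<subseteq> complements_avoiding p"
    proof
      fix S assume "S \<in> (-) E ` \<H>"
      then obtain A where A: "A \<in> \<H>" "S = E - A" by blast
      have "A \<subseteq> E" "A \<in> \<G>" "p \<in> A" using A(1) H(1,4) GE p by blast+
      then show "S \<in> complements_avoiding p"
        unfolding A(2) complements_avoiding_def by (auto simp: double_diff)
    qed
    show "disjoint ((-) E ` \<H>)"
    proof (rule disjointI)
      fix S T assume "S \<in> (-) E ` \<H>" "T \<in> (-) E ` \<H>" "S \<noteq> T"
      then obtain A B where AB: "A \<in> \<H>" "B \<in> \<H>" "A \<noteq> B" "S = E - A" "T = E - B" by blast
      have "A \<union> B = E"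
        by (rule shortest_representation_covers[OF closedD(1)[OF F] H(1,3,4) AB(1-3)])
      then show "S \<inter> T = {}" unfolding AB by blast
    qed
    show "\<Union>((-) E ` \<H>) = E - F" unfolding H(4) by blast
    show "(\<Sum>_\<in>(-) E ` \<H>. 1) \<le> c F" using card_image_le[OF H(2), of "(-) E"] H(3) by simp
  qed
qed

lemma partition_imp_closed:
  assumes F: "F \<subseteq> E" "p \<in> F" and k: "partition_cost_le (complements_avoiding p) (\<lambda>_. 1) (E - F) k"
  shows "F \<in> closed_sets" "c F \<le> k"
proof -
  obtain \<P> where "finite \<P> \<and> \<P> \<subseteq> complements_avoiding p \<and> disjoint \<P> \<and> \<Union>\<P> = E - F \<and> sum (\<lambda>_. 1) \<P> \<le> k"
    using k unfolding partition_cost_le_def ..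
  then have P: "finite \<P>" "\<P> \<subseteq> complements_avoiding p" "\<Union>\<P> = E - F" "card \<P> \<le> k" by simp_all
  have H: "(-) E ` \<P> \<subseteq> \<G>" using P(2) by (auto simp: complements_avoiding_def)
  have "E \<inter> \<Inter>((-) E ` \<P>) = E - \<Union>\<P>" by blast
  then have e: "F = E \<inter> \<Inter>((-) E ` \<P>)" using P(3) double_diff[OF F(1) order_refl] by simp
  show "F \<in> closed_sets" by (rule closedI[OF H e]) (use F in blast)
  show "c F \<le> k" using c_le[OF H e] card_image_le[OF P(1), of "(-) E"] P(4) by simp
qed

lemma closed_sets_intersecting: "intersecting_submodular closed_sets c"
  unfolding intersecting_submodular_def
proof (intro ballI impI)
  fix A B assume AB: "A \<in> closed_sets" "B \<in> closed_sets" "A \<inter> B \<noteq> {}"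
  then obtain p where p: "p \<in> A" "p \<in> B" by blast
  have sub: "A \<subseteq> E" "B \<subseteq> E" using AB closedD by auto
  obtain k l where kl: "partition_cost_le (complements_avoiding p) (\<lambda>_. 1) ((E - A) \<union> (E - B)) k"
    "partition_cost_le (complements_avoiding p) (\<lambda>_. 1) ((E - A) \<inter> (E - B)) l" "k + l \<le> c A + c B"
    using partition_cost_submodular[OF complements_intersecting
        closed_imp_partition[OF AB(1) p(1)] closed_imp_partition[OF AB(2) p(2)]] by blast
  have e: "(E - A) \<union> (E - B) = E - (A \<inter> B)" "(E - A) \<inter> (E - B) = E - (A \<union> B)" by auto
  have "A \<inter> B \<in> closed_sets" "c (A \<inter> B) \<le> k"
    using partition_imp_closed[OF _ _ kl(1)[unfolded e]] sub p by auto
  moreover have "A \<union> B \<in> closed_sets" "c (A \<union> B) \<le> l"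
    using partition_imp_closed[OF _ _ kl(2)[unfolded e]] sub p by auto
  ultimately show "A \<inter> B \<in> closed_sets \<and> A \<union> B \<in> closed_sets \<and> c (A \<union> B) + c (A \<inter> B) \<le> c A + c B"
    using kl(3) by simp
qed

text \<open>The slack function to be constructed.\<close>

definition excess :: "'a set \<Rightarrow> nat" where
  "excess A = (LEAST k. partition_cost_le closed_sets c A k)"

lemma excess_le: "partition_cost_le closed_sets c A k \<Longrightarrow> excess A \<le> k"
  unfolding excess_def by (rule Least_le)

lemma excess_partition:
  assumes "A \<subseteq> E" shows "partition_cost_le closed_sets c A (excess A)"
proof -
  have "partition_cost_le closed_sets c A (sum c ((\<lambda>e. {e}) ` A))"
  proof (rule partition_cost_leI)
    show "finite ((\<lambda>e. {e}) ` A)" using assms finE finite_subset by blast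
    show "(\<lambda>e. {e}) ` A \<subseteq> closed_sets" using member_closed(1) singletons assms by blast
    show "disjoint ((\<lambda>e. {e}) ` A)" by (rule disjointI) blast
  qed auto
  then show ?thesis unfolding excess_def by (rule LeastI)
qed

lemma excess_witness:
  assumes "A \<subseteq> E"
  obtains \<P> where "finite \<P>" "\<P> \<subseteq> closed_sets" "disjoint \<P>" "\<Union>\<P> = A" "sum c \<P> = excess A"
proof -
  obtain \<P> where P: "finite \<P>" "\<P> \<subseteq> closed_sets" "disjoint \<P>" "\<Union>\<P> = A" "sum c \<P> \<le> excess A"
    using excess_partition[OF assms] unfolding partition_cost_le_def by blast
  moreover have "excess A \<le> sum c \<P>" by (rule excess_le[OF partition_cost_leI[OF P(1-4) order_refl]])
  ultimately show ?thesis using that by simp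
qed

lemma excess_submodular: "submodular_on E excess"
  unfolding submodular_on_def
proof (intro allI impI)
  fix A B assume AB: "A \<subseteq> E" "B \<subseteq> E"
  obtain k l where "partition_cost_le closed_sets c (A \<union> B) k" "partition_cost_le closed_sets c (A \<inter> B) l"
    "k + l \<le> excess A + excess B"
    using partition_cost_submodular[OF closed_sets_intersecting excess_partition[OF AB(1)]
        excess_partition[OF AB(2)]] by blast
  then show "excess (A \<union> B) + excess (A \<inter> B) \<le> excess A + excess B"
    using excess_le by (meson add_mono le_trans)
qed

lemma excess_closed: "F \<in> closed_sets \<Longrightarrow> excess F \<le> c F"
  by (rule excess_le, rule partition_cost_leI[of "{F}"]) auto

lemma excess_empty: "excess {} = 0"
  using excess_le[OF partition_cost_leI[of "{}" closed_sets "{}" c 0]] by simp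

lemma excess_ground: "excess E = 0"
proof (cases "E = {}")
  case True
  then show ?thesis using excess_empty by simp
next
  case False
  have e: "E = E \<inter> \<Inter>{}" by simp
  have "E \<in> closed_sets" by (rule closedI[OF _ e False]) simp
  moreover have "c E = 0" using c_le[OF _ e] by simp
  ultimately show ?thesis using excess_closed[of E] by simp
qed

lemma excess_Un: "A \<subseteq> E \<Longrightarrow> B \<subseteq> E \<Longrightarrow> excess (A \<union> B) \<le> excess A + excess B"
  using submodular_onD[OF excess_submodular, of A B] by simp

lemma excess_pos:
  assumes "A \<noteq> {}" "A \<subset> E" shows "1 \<le> excess A"
proof (rule ccontr)
  assume n: "\<not> ?thesis"
  obtain \<P> where P: "finite \<P>" "\<P> \<subseteq> closed_sets" "disjoint \<P>" "\<Union>\<P> = A" "sum c \<P> = excess A"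
    using excess_witness[OF psubset_imp_subset[OF assms(2)]] .
  obtain F where F: "F \<in> \<P>" using P(4) assms(1) by blast
  have "sum c \<P> = 0" using P(5) n by simp
  then have "c F = 0" using P(1) F by simp
  then have "F = E" using c_zero F P(2) by blast
  then show False using F P(4) assms(2) by blast
qed

text \<open>Removing one member from a shortest representation leaves a second closed set, which meets this member
  in the given set and covers \<open>E\<close> together with it.\<close>

lemma closed_splits_outside:
  assumes A: "A \<in> closed_sets" and ex: "excess A = c A" and two: "2 \<le> c A"
  obtains S S' where "S \<subset> E" "S' \<subset> E" "S \<inter> S' = A" "S \<union> S' = E" "excess S + excess S' = excess A"
proof -
  obtain \<H> where H: "\<H> \<subseteq> \<G>" "finite \<H>" "card \<H> = c A" "A = E \<inter> \<Inter>\<H>" using c_witness[OF A] .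
  obtain X where X: "X \<in> \<H>" using two H(3) by fastforce
  define S' where "S' = E \<inter> \<Inter>(\<H> - {X})"
  have "\<not> \<H> \<subseteq> {X}" using two H(3) card_mono[of "{X}" \<H>] by auto
  then obtain Y where Y: "Y \<in> \<H>" "Y \<noteq> X" by blast
  have XG: "X \<in> \<G>" "Y \<in> \<G>" using X Y H(1) by auto
  have cov: "X \<union> Z = E" if "Z \<in> \<H> - {X}" for Z
    using shortest_representation_covers[OF closedD(1)[OF A] H(1,3,4) X] that by blast
  have 1: "X \<subset> E" using member_proper[OF XG(1)] by blast
  have 2: "S' \<subset> E" using member_proper[OF XG(2)] Y by (auto simp: S'_def)
  have 3: "X \<inter> S' = A" using X 1 unfolding S'_def H(4) by blast
  have 4: "X \<union> S' = E" using cov 1 unfolding S'_def by blast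
  have "S' \<in> closed_sets"
    by (rule closedI[of "\<H> - {X}"]) (use H(1) S'_def 3 closedD(1)[OF A] in blast)+
  then have "excess S' \<le> c S'" by (rule excess_closed)
  also have "c S' \<le> card (\<H> - {X})" by (rule c_le) (use H(1) S'_def in blast)+
  also have "\<dots> = c A - 1" using X H(2,3) by simp
  finally have "excess S' \<le> c A - 1" .
  moreover have "excess X \<le> 1" using excess_closed member_closed[OF XG(1)] by force
  moreover have "excess E + excess A \<le> excess X + excess S'"
    using submodular_onD[OF excess_submodular, of X S'] 1 2 3 4 by auto
  ultimately have "excess X + excess S' = excess A" using ex two by simp
  then show ?thesis using that 1 2 3 4 by blast
qed

lemma excess_partition_additive:
  assumes P: "finite \<P>" "\<P> \<subseteq> closed_sets" "disjoint \<P>" "sum c \<P> = excess (\<Union>\<P>)" and F: "F \<in> \<P>"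
  shows "excess F = c F" "excess F + excess (\<Union>(\<P> - {F})) = excess (\<Union>\<P>)" "F \<inter> \<Union>(\<P> - {F}) = {}"
proof -
  have sub: "F \<subseteq> E" "\<Union>(\<P> - {F}) \<subseteq> E" using P(2) F closedD(2) by blast+
  have "excess (\<Union>(\<P> - {F})) \<le> sum c (\<P> - {F})"
    by (rule excess_le, rule partition_cost_leI) (use P pairwise_subset[OF P(3)] in auto)
  moreover have "excess F \<le> c F" using excess_closed F P(2) by blast
  moreover have "F \<union> \<Union>(\<P> - {F}) = \<Union>\<P>" using F by blast
  then have "excess (\<Union>\<P>) \<le> excess F + excess (\<Union>(\<P> - {F}))" using excess_Un[OF sub] by simp
  moreover have "sum c \<P> = c F + sum c (\<P> - {F})" by (rule sum.remove[OF P(1) F])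
  ultimately show "excess F = c F" "excess F + excess (\<Union>(\<P> - {F})) = excess (\<Union>\<P>)"
    using P(4) by linarith+
  show "F \<inter> \<Union>(\<P> - {F}) = {}" using disjointD[OF P(3) F] by blast
qed

text \<open>A set whose optimal partition has several parts splits into one part and the others; a closed set of
  excess at least two splits into two larger closed sets; the remaining sets have excess one.\<close>

lemma excess_block: "gorenstein_block (\<lambda>A. int (excess A)) E"
  unfolding gorenstein_block_def
proof (intro conjI allI impI)
  show "int (excess {}) = 0" "int (excess E) = 0" using excess_empty excess_ground by simp_all
  fix A assume A: "A \<noteq> {}" "A \<subset> E"
  show "1 \<le> int (excess A)" using excess_pos[OF A] by simp
  obtain \<P> where P: "finite \<P>" "\<P> \<subseteq> closed_sets" "disjoint \<P>" "\<Union>\<P> = A" "sum c \<P> = excess A"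
    using excess_witness[OF psubset_imp_subset[OF A(2)]] .
  obtain F where F: "F \<in> \<P>" using P(4) A(1) by blast
  note add = excess_partition_additive[OF P(1-3) P(5)[folded P(4)] F]
  show "int (excess A) = 1 \<or> splits_inside (\<lambda>A. int (excess A)) A \<or> splits_outside (\<lambda>A. int (excess A)) E A"
  proof (cases "\<P> = {F}")
    case False
    then obtain F' where F': "F' \<in> \<P>" "F' \<noteq> F" using F by blast
    have "splits_inside (\<lambda>A. int (excess A)) A"
      unfolding splits_inside_def
    proof (intro exI conjI)
      show "F \<noteq> {}" using F P(2) closedD(1) by blast
      show "\<Union>(\<P> - {F}) \<noteq> {}" using F' P(2) closedD(1) by blast
      show "F \<inter> \<Union>(\<P> - {F}) = {}" by (rule add(3))
      show "F \<union> \<Union>(\<P> - {F}) = A" using F P(4) by blast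
      show "int (excess F) + int (excess (\<Union>(\<P> - {F}))) = int (excess A)" using add(2) P(4) by simp
    qed
    then show ?thesis by blast
  next
    case True
    then have AF: "A = F" using P(4) by simp
    show ?thesis
    proof (cases "excess A = 1")
      case False
      then have "2 \<le> c A" using add(1) excess_pos[OF A] AF by simp
      moreover have "A \<in> closed_sets" using F P(2) AF by blast
      ultimately obtain S S' where "S \<subset> E" "S' \<subset> E" "S \<inter> S' = A" "S \<union> S' = E"
        "excess S + excess S' = excess A"
        using closed_splits_outside[of A] add(1) AF by blast
      then have "splits_outside (\<lambda>A. int (excess A)) E A"
        unfolding splits_outside_def by (metis of_nat_add)
      then show ?thesis by blast
    qed simp
  qed
qed

text \<open>The complements of the members of a shortest representation partition the complement of \<open>F\<close>, and each
  has cardinality congruent to \<open>-1\<close> modulo \<open>\<delta>\<close>.\<close>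

lemma dvd_closed:
  assumes F: "F \<in> closed_sets" shows "int \<delta> dvd int (card F) - int (c F)"
proof -
  obtain \<H> where H: "\<H> \<subseteq> \<G>" "finite \<H>" "card \<H> = c F" "F = E \<inter> \<Inter>\<H>" using c_witness[OF F] .
  have HE: "A \<subseteq> E" "finite A" if "A \<in> \<H>" for A
    using that H(1) member_proper(3) finE finite_subset by blast+
  have "card (\<Union>A\<in>\<H>. E - A) = (\<Sum>A\<in>\<H>. card (E - A))"
  proof (rule card_UN_disjoint[OF H(2)])
    show "\<forall>A\<in>\<H>. finite (E - A)" using finE by simp
    show "\<forall>A\<in>\<H>. \<forall>B\<in>\<H>. A \<noteq> B \<longrightarrow> (E - A) \<inter> (E - B) = {}"
      using shortest_representation_covers[OF closedD(1)[OF F] H(1,3,4)] by blast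
  qed
  moreover have "(\<Union>A\<in>\<H>. E - A) = E - F" unfolding H(4) by blast
  ultimately have "int (card (E - F)) = (\<Sum>A\<in>\<H>. int (card (E - A)))" by simp
  moreover have "int (card (E - F)) = int (card E) - int (card F)"
    using closedD(2)[OF F] finE by (simp add: card_Diff_subset finite_subset card_mono of_nat_diff)
  moreover have "int (card (E - A)) = int (card E) - int (card A)" if "A \<in> \<H>" for A
    using HE[OF that] finE by (simp add: card_Diff_subset card_mono of_nat_diff)
  ultimately have "int (card E) - int (card F) = (\<Sum>A\<in>\<H>. int (card E) - int (card A))" by simp
  moreover have "(\<Sum>A\<in>\<H>. int (card E) - (int (card A) - 1)) = (\<Sum>A\<in>\<H>. int (card E) - int (card A)) + int (c F)"
    using H(3) by (simp add: sum_subtractf algebra_simps)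
  ultimately have "int (card F) - int (c F) = int (card E) - (\<Sum>A\<in>\<H>. int (card E) - (int (card A) - 1))"
    by simp
  moreover have "int \<delta> dvd int (card E)" using cardE by simp
  moreover have "int \<delta> dvd int (card A) - 1" if "A \<in> \<H>" for A
  proof -
    have "int (card A) mod int \<delta> = 1" using card_member that H(1) by (metis of_nat_1 subsetD zmod_int)
    then show ?thesis using mod_eq_dvd_iff[of "int (card A)" "int \<delta>" 1] delta by simp
  qed
  ultimately show ?thesis by (simp add: dvd_diff dvd_sum)
qed

lemma dvd_excess:
  assumes A: "A \<subseteq> E" shows "int \<delta> dvd int (card A) - int (excess A)"
proof -
  obtain \<P> where P: "finite \<P>" "\<P> \<subseteq> closed_sets" "disjoint \<P>" "\<Union>\<P> = A" "sum c \<P> = excess A"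
    using excess_witness[OF A] .
  have "finite F" if "F \<in> \<P>" for F using that P(2) closedD(2) finE finite_subset by blast
  then have "card A = sum card \<P>" using card_Union_disjoint[OF P(3)] P(4) by simp
  then have "int (card A) - int (excess A) = (\<Sum>F\<in>\<P>. int (card F) - int (c F))"
    by (simp add: sum_subtractf flip: P(5))
  then show ?thesis using dvd_closed P(2) by (auto intro!: dvd_sum)
qed

definition family_rk :: "'a set \<Rightarrow> nat" where
  "family_rk A = ((\<delta> - 1) * card A + excess A) div \<delta>"

lemma int_delta_minus: "int (\<delta> - 1) = int \<delta> - 1"
  using delta by simp

lemma family_rk:
  assumes "A \<subseteq> E" shows "\<delta> * family_rk A = (\<delta> - 1) * card A + excess A"
proof -
  have "int ((\<delta> - 1) * card A + excess A) = int \<delta> * int (card A) - (int (card A) - int (excess A))"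
    unfolding of_nat_add of_nat_mult int_delta_minus by (simp add: algebra_simps)
  moreover have "int \<delta> dvd int \<delta> * int (card A) - (int (card A) - int (excess A))"
    by (rule dvd_diff) (use dvd_excess[OF assms] in simp_all)
  ultimately have "int \<delta> dvd int ((\<delta> - 1) * card A + excess A)" by (simp only:)
  then have "\<delta> dvd (\<delta> - 1) * card A + excess A" by (simp only: of_nat_dvd_iff)
  then show ?thesis unfolding family_rk_def by simp
qed

lemma slack_family_rk:
  assumes "A \<subseteq> E" shows "slack \<delta> (\<lambda>_. int \<delta> - 1) family_rk A = int (excess A)"
proof -
  have "int (\<delta> * family_rk A) = int ((\<delta> - 1) * card A + excess A)" using family_rk[OF assms] by simp
  then have "int \<delta> * int (family_rk A) = (int \<delta> - 1) * int (card A) + int (excess A)"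
    unfolding of_nat_add of_nat_mult int_delta_minus .
  then show ?thesis unfolding slack_def by (simp add: algebra_simps)
qed

lemma slack_family_block: "gorenstein_block (slack \<delta> (\<lambda>_. int \<delta> - 1) family_rk) E"
  by (rule gorenstein_block_cong[OF slack_family_rk[symmetric] excess_block])

text \<open>The excess grows by at most one when an element is added, which bounds the rank from above. By
  submodularity it drops at most as much as it does from \<open>E - {e}\<close> to \<open>E\<close>, so the bound on the excess
  of \<open>E - {e}\<close> makes the rank monotone.\<close>

lemma rank_function_family_rk:
  assumes compl: "\<And>e. e \<in> E \<Longrightarrow> excess (E - {e}) \<le> \<delta> - 1"
  shows "rank_function E family_rk"
  unfolding rank_function_def
proof (intro conjI allI impI)
  show "finite E" by (rule finE)
  show "family_rk {} = 0" by (simp add: family_rk_def excess_empty)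
  show "submodular_on E family_rk"
    unfolding submodular_on_def
  proof (intro allI impI)
    fix A B assume AB: "A \<subseteq> E" "B \<subseteq> E"
    have fin: "finite A" "finite B" using AB finE finite_subset by auto
    have "\<delta> * (family_rk (A \<union> B) + family_rk (A \<inter> B)) =
        (\<delta> - 1) * (card (A \<union> B) + card (A \<inter> B)) + (excess (A \<union> B) + excess (A \<inter> B))"
      using family_rk[of "A \<union> B"] family_rk[of "A \<inter> B"] AB by (simp add: algebra_simps le_infI1)
    also have "\<dots> \<le> (\<delta> - 1) * (card A + card B) + (excess A + excess B)"
      using card_Un_Int[OF fin] submodular_onD[OF excess_submodular AB] by simp
    also have "\<dots> = \<delta> * (family_rk A + family_rk B)"
      using family_rk[OF AB(1)] family_rk[OF AB(2)] by (simp add: algebra_simps)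
    finally show "family_rk (A \<union> B) + family_rk (A \<inter> B) \<le> family_rk A + family_rk B"
      using delta by simp
  qed
  fix A e assume A: "A \<subseteq> E" and e: "e \<in> E"
  have fin: "finite A" using A finE finite_subset by blast
  have i: "insert e A \<subseteq> E" using A e by simp
  have main: "family_rk A \<le> family_rk (insert e A) \<and> family_rk (insert e A) \<le> Suc (family_rk A)"
    if eA: "e \<notin> A"
  proof -
    have up: "excess (insert e A) \<le> excess A + 1"
    proof -
      have "excess {e} \<le> 1"
        using excess_closed[OF member_closed(1)] member_closed(2) singletons[OF e] by (meson le_trans)
      then show ?thesis using excess_Un[of A "{e}"] A e by simp
    qed
    have "A \<union> {e} \<union> (E - {e}) = E" "insert e A \<inter> (E - {e}) = A" "insert e A \<union> (E - {e}) = E"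
      using A e eA by auto
    then have down: "excess A \<le> excess (insert e A) + (\<delta> - 1)"
      using submodular_onD[OF excess_submodular i, of "E - {e}"] compl[OF e] excess_ground by auto
    have card: "(\<delta> - 1) * card (insert e A) = (\<delta> - 1) * card A + (\<delta> - 1)" using eA fin by simp
    have "\<delta> * family_rk A \<le> \<delta> * family_rk (insert e A)"
      using family_rk[OF A] family_rk[OF i] down card by linarith
    moreover have "\<delta> * family_rk (insert e A) \<le> \<delta> * Suc (family_rk A)"
      using family_rk[OF A] family_rk[OF i] up card delta by simp
    ultimately show ?thesis using delta unfolding mult_le_cancel1 by simp
  qed
  show "family_rk A \<le> family_rk (insert e A)" using main by (cases "e \<in> A") (simp_all add: insert_absorb)
  show "family_rk (insert e A) \<le> Suc (family_rk A)" using main by (cases "e \<in> A") (simp_all add: insert_absorb)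
qed

text \<open>If a part of an optimal partition of \<open>E - {e}\<close> were not a member of the family, it would split from
  the outside, and the complement of the piece containing \<open>e\<close> would have excess zero.\<close>

lemma complement_partition:
  assumes e: "e \<in> E" and ex: "excess (E - {e}) = \<delta> - 1"
  obtains \<P> where "card \<P> = \<delta> - 1" "disjoint \<P>" "\<Union>\<P> = E - {e}" "\<P> \<subseteq> \<G>"
    "\<And>P A. P \<in> \<P> \<Longrightarrow> A \<in> \<G> \<Longrightarrow> P \<subseteq> A \<Longrightarrow> A \<subseteq> E - {e} \<Longrightarrow> A = P"
proof -
  let ?f = "\<lambda>A. int (excess A)"
  have sub: "submodular_on E ?f"
    using excess_submodular unfolding submodular_on_def by (metis of_nat_add zle_int)
  obtain \<P> where P: "finite \<P>" "\<P> \<subseteq> closed_sets" "disjoint \<P>" "\<Union>\<P> = E - {e}" "sum c \<P> = excess (E - {e})"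
    using excess_witness[OF Diff_subset] .
  have add: "?f (X \<union> Y) = ?f X + ?f Y" if "F \<in> \<P>" "X \<subseteq> F" "Y \<subseteq> E - {e} - F" for F X Y
  proof (rule submodular_additive_restrict[OF sub, of F "\<Union>(\<P> - {F})"])
    note a = excess_partition_additive[OF P(1-3) P(5)[folded P(4)] that(1)]
    have U: "F \<union> \<Union>(\<P> - {F}) = \<Union>\<P>" using that(1) by blast
    show "?f {} = 0" by (simp add: excess_empty)
    show "F \<union> \<Union>(\<P> - {F}) \<subseteq> E" using U P(4) by blast
    show "F \<inter> \<Union>(\<P> - {F}) = {}" by (rule a(3))
    show "?f F + ?f (\<Union>(\<P> - {F})) = ?f (F \<union> \<Union>(\<P> - {F}))" using a(2) U by simp
    show "X \<subseteq> F" by (rule that(2))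
    have "E - {e} - F \<subseteq> \<Union>(\<P> - {F})" unfolding P(4)[symmetric] by blast
    then show "Y \<subseteq> \<Union>(\<P> - {F})" using that(3) by (rule order_trans[rotated])
  qed
  have noT: False if FP: "F \<in> \<P>" and S: "S \<subset> E" "S \<inter> S' = F" "S \<union> S' = E"
    "excess S + excess S' = excess F" "e \<in> S" for F S S'
  proof -
    have "S' = F \<union> (E - S)" using S by blast
    moreover have "E - S \<subseteq> E - {e} - F" using S by blast
    ultimately have "?f S' = ?f F + ?f (E - S)" using add[OF FP order_refl] by simp
    moreover have "1 \<le> excess (E - S)"
      by (rule excess_pos) (use S in blast)+
    ultimately show False using S(4) by linarith
  qed
  have c1: "c F = 1" if FP: "F \<in> \<P>" for F
  proof (rule ccontr)
    assume "c F \<noteq> 1"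
    have F: "F \<in> closed_sets" "F \<subseteq> E - {e}" using FP P(2,4) by auto
    have exF: "excess F = c F" using excess_partition_additive(1)[OF P(1-3) P(5)[folded P(4)] FP] .
    have "c F \<noteq> 0" using c_zero[OF F(1)] F(2) e by blast
    then have "2 \<le> c F" using \<open>c F \<noteq> 1\<close> by simp
    then obtain S S' where S: "S \<subset> E" "S' \<subset> E" "S \<inter> S' = F" "S \<union> S' = E" "excess S + excess S' = excess F"
      using closed_splits_outside[OF F(1) exF] by blast
    show False
    proof (cases "e \<in> S")
      case True
      then show ?thesis using noT[OF FP S(1,3,4,5)] by blast
    next
      case False
      then have "e \<in> S'" using S(4) e by blast
      then show ?thesis using noT[OF FP S(2), of S] S(3,4,5) by (simp add: Int_commute Un_commute add.commute)
    qed
  qed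
  then have "card \<P> = \<delta> - 1" using P(5) ex by simp
  moreover have "\<P> \<subseteq> \<G>" using c1 c_one P(2) by blast
  moreover have "A = F" if "F \<in> \<P>" "A \<in> \<G>" "F \<subseteq> A" "A \<subseteq> E - {e}" for F A
  proof -
    have AF: "A = F \<union> (A - F)" using that(3) by blast
    have "?f A = ?f F + ?f (A - F)" using add[OF that(1) order_refl, of "A - F"] that(4) AF by auto
    moreover have "excess A \<le> 1" using excess_closed member_closed[OF that(2)] by force
    moreover have "F \<noteq> {}" "F \<subset> E" using closedD(1) that e P(2) by blast+
    then have "1 \<le> excess F" using excess_pos by blast
    ultimately have "excess (A - F) = 0" by linarith
    moreover have "A - F \<subset> E" using that(4) e by blast
    ultimately have "A - F = {}" using excess_pos[of "A - F"] by fastforce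
    then show ?thesis using AF by blast
  qed
  ultimately show ?thesis using that P(3,4) by blast
qed

end

section \<open>The matroid of a family\<close>

text \<open>Containing a minimal dependent set means containing some dependent set, and a set contains
  \<open>r + 1\<close> elements of \<open>F\<close> exactly if it meets \<open>F\<close> in more than \<open>r\<close> elements.\<close>

lemma indeps_family_matroid:
  assumes E: "finite E"
  shows "I \<in> indeps (family_matroid \<delta> E \<G>) \<longleftrightarrow>
    I \<subseteq> E \<and> (\<forall>F\<in>intersection_family E \<G>. card (I \<inter> F) \<le> family_rank \<delta> E \<G> F)"
proof -
  let ?D = "family_dependents \<delta> E \<G>"
  have minimal: "(\<exists>C\<in>?D. (\<forall>D\<in>?D. D \<subseteq> C \<longrightarrow> D = C) \<and> C \<subseteq> I) \<longleftrightarrow> (\<exists>C\<in>?D. C \<subseteq> I)" if I: "I \<subseteq> E"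
  proof
    assume "\<exists>C\<in>?D. C \<subseteq> I"
    then obtain C0 where C0: "C0 \<in> ?D \<and> C0 \<subseteq> I" by blast
    have "\<exists>C. (C \<in> ?D \<and> C \<subseteq> I) \<and> (\<forall>D. D \<in> ?D \<and> D \<subseteq> I \<longrightarrow> card C \<le> card D)"
      by (rule ex_has_least_nat[where P = "\<lambda>C. C \<in> ?D \<and> C \<subseteq> I", OF C0])
    then obtain C where C: "C \<in> ?D" "C \<subseteq> I" "\<And>D. D \<in> ?D \<Longrightarrow> D \<subseteq> I \<Longrightarrow> card C \<le> card D" by blast
    have finC: "finite C" by (rule finite_subset[OF order_trans[OF C(2) I] E])
    have "D = C" if "D \<in> ?D" "D \<subseteq> C" for D
    proof (rule card_seteq[OF finC that(2)])
      show "card C \<le> card D" by (rule C(3)[OF that(1)]) (use that(2) C(2) in blast)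
    qed
    then show "\<exists>C\<in>?D. (\<forall>D\<in>?D. D \<subseteq> C \<longrightarrow> D = C) \<and> C \<subseteq> I" using C(1,2) by blast
  qed blast
  have large: "(\<exists>C\<in>?D. C \<subseteq> I) \<longleftrightarrow> (\<exists>F\<in>intersection_family E \<G>. family_rank \<delta> E \<G> F < card (I \<inter> F))"
    if I: "I \<subseteq> E"
  proof
    assume "\<exists>C\<in>?D. C \<subseteq> I"
    then obtain C F where CF: "F \<in> intersection_family E \<G>" "C \<subseteq> F" "card C = family_rank \<delta> E \<G> F + 1" "C \<subseteq> I"
      unfolding family_dependents_def by blast
    have "finite (I \<inter> F)" using finite_subset[OF I E] by simp
    then have "card C \<le> card (I \<inter> F)" by (rule card_mono) (use CF in blast)
    then show "\<exists>F\<in>intersection_family E \<G>. family_rank \<delta> E \<G> F < card (I \<inter> F)"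
      using CF(1,3) by (intro bexI[OF _ CF(1)]) simp
  next
    assume "\<exists>F\<in>intersection_family E \<G>. family_rank \<delta> E \<G> F < card (I \<inter> F)"
    then obtain F where F: "F \<in> intersection_family E \<G>" "family_rank \<delta> E \<G> F + 1 \<le> card (I \<inter> F)"
      by auto
    obtain C where C: "C \<subseteq> I \<inter> F" "card C = family_rank \<delta> E \<G> F + 1" "finite C"
      using obtain_subset_with_card_n[OF F(2)] .
    then have "C \<in> ?D" unfolding family_dependents_def using F(1) by blast
    then show "\<exists>C\<in>?D. C \<subseteq> I" using C(1) by blast
  qed
  have "I \<in> indeps (family_matroid \<delta> E \<G>) \<longleftrightarrow>
      I \<subseteq> E \<and> \<not> (\<exists>C\<in>?D. (\<forall>D\<in>?D. D \<subseteq> C \<longrightarrow> D = C) \<and> C \<subseteq> I)"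
    unfolding family_matroid_def matroid_of_circuits_def by simp blast
  also have "\<dots> \<longleftrightarrow> I \<subseteq> E \<and> \<not> (\<exists>F\<in>intersection_family E \<G>. family_rank \<delta> E \<G> F < card (I \<inter> F))"
    by (rule conj_cong[OF refl]) (simp only: minimal large)
  finally show ?thesis by (simp only: not_less ball_simps bex_simps)
qed

lemma ground_family_matroid [simp]: "ground (family_matroid \<delta> E \<G>) = E"
  by (simp add: family_matroid_def matroid_of_circuits_def)

lemma matroid_eqI:
  fixes M N :: "'a matroid"
  assumes "ground M = ground N" "\<And>I. I \<in> indeps M \<longleftrightarrow> I \<in> indeps N"
  shows "M = N"
proof -
  have "indeps M = indeps N" using assms(2) by blast
  then show ?thesis using assms(1) by simp
qed

context crossing_family
begin

text \<open>A set that obeys the inequalities of all closed sets is independent: the inequalities of the parts of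
  its own optimal partition add up to the rank inequality of the set.\<close>

lemma family_matroid_eq:
  assumes compl: "\<And>e. e \<in> E \<Longrightarrow> excess (E - {e}) \<le> \<delta> - 1"
  shows "family_matroid \<delta> E \<G> = matroid_of_rank E family_rk"
proof (rule matroid_eqI)
  note R = rank_function_family_rk[OF compl]
  show "ground (family_matroid \<delta> E \<G>) = ground (matroid_of_rank E family_rk)"
    by (simp add: matroid_of_rank_def)
  fix I
  have le: "family_rk F \<le> family_rank \<delta> E \<G> F" if "F \<in> closed_sets" for F
    unfolding family_rk_def family_rank_def using excess_closed[OF that] by (intro div_le_mono) simp
  have "I \<subseteq> E \<Longrightarrow> (\<forall>F\<in>closed_sets. card (I \<inter> F) \<le> family_rank \<delta> E \<G> F) \<longleftrightarrow> family_rk I = card I"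
  proof
    assume I: "I \<subseteq> E" and r: "family_rk I = card I"
    show "\<forall>F\<in>closed_sets. card (I \<inter> F) \<le> family_rank \<delta> E \<G> F"
    proof
      fix F assume F: "F \<in> closed_sets"
      have "family_rk I + card (I \<inter> F) \<le> family_rk (I \<inter> F) + card I"
        by (rule rank_function_card_le[OF R Int_lower1 I])
      moreover have "family_rk (I \<inter> F) \<le> family_rk F"
        by (rule rank_function_mono[OF R Int_lower2 closedD(2)[OF F]])
      ultimately show "card (I \<inter> F) \<le> family_rank \<delta> E \<G> F" using le[OF F] r by linarith
    qed
  next
    assume I: "I \<subseteq> E" and c: "\<forall>F\<in>closed_sets. card (I \<inter> F) \<le> family_rank \<delta> E \<G> F"
    obtain \<P> where P: "finite \<P>" "\<P> \<subseteq> closed_sets" "disjoint \<P>" "\<Union>\<P> = I" "sum c \<P> = excess I"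
      using excess_witness[OF I] .
    have "finite F" if "F \<in> \<P>" for F using that P(2) closedD(2) finE finite_subset by blast
    then have card: "card I = sum card \<P>" using card_Union_disjoint[OF P(3)] P(4) by simp
    have "\<delta> * card F \<le> (\<delta> - 1) * card F + c F" if F: "F \<in> \<P>" for F
    proof -
      have "I \<inter> F = F" using F P(4) by blast
      then have "card F \<le> family_rank \<delta> E \<G> F" using c F P(2) by force
      then have "\<delta> * card F \<le> \<delta> * family_rank \<delta> E \<G> F" by simp
      also have "\<dots> \<le> (\<delta> - 1) * card F + c F" unfolding family_rank_def by (rule times_div_less_eq_dividend)
      finally show ?thesis .
    qed
    then have "(\<Sum>F\<in>\<P>. \<delta> * card F) \<le> (\<Sum>F\<in>\<P>. (\<delta> - 1) * card F + c F)" by (rule sum_mono)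
    then have "\<delta> * card I \<le> \<delta> * family_rk I"
      using card family_rk[OF I] P(5) by (simp add: sum.distrib flip: sum_distrib_left)
    then show "family_rk I = card I"
      using delta rank_function_le_card[OF R I] unfolding mult_le_cancel1 by simp
  qed
  then show "I \<in> indeps (family_matroid \<delta> E \<G>) \<longleftrightarrow> I \<in> indeps (matroid_of_rank E family_rk)"
    unfolding indeps_family_matroid[OF finE] matroid_of_rank_def by auto
qed

lemma excess_complement_le:
  assumes "\<H> \<subseteq> \<G>" "disjoint \<H>" "\<Union>\<H> = E - {e}" "card \<H> \<le> \<delta> - 1"
  shows "excess (E - {e}) \<le> \<delta> - 1"
proof (rule excess_le, rule partition_cost_leI)
  show "finite \<H>" using assms(1) finG finite_subset by blast
  show "\<H> \<subseteq> closed_sets" using assms(1) member_closed(1) by blast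
  have "sum c \<H> \<le> (\<Sum>_\<in>\<H>. 1)" by (rule sum_mono) (use assms(1) member_closed(2) in blast)
  then show "sum c \<H> \<le> \<delta> - 1" using assms(4) by simp
qed (use assms in auto)

text \<open>A closed set whose shortest representation uses \<open>k\<close> complements of single elements is cut out of a
  closed set that has \<open>k\<close> more elements and is represented by the \<open>k\<close> fewer remaining members. The
  larger set gives at least as strong a bound, since cardinality and number of members enter the rank for
  \<open>\<delta> = 2\<close> with the same weight.\<close>

lemma family_matroid_without_complements:
  assumes sub: "\<G>' \<subseteq> \<G>" and rest: "\<And>A. A \<in> \<G> - \<G>' \<Longrightarrow> \<exists>e\<in>E. A = E - {e}"
  shows "family_matroid 2 E \<G>' = family_matroid 2 E \<G>"
proof (rule matroid_eqI)
  fix I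
  let ?c' = "intersection_number E \<G>'"
  have c': "?c' F \<le> card \<H>" if "\<H> \<subseteq> \<G>'" "F = E \<inter> \<Inter>\<H>" for F \<H>
  proof -
    have "finite \<H>" using that(1) sub finG finite_subset by (meson order_trans)
    then show ?thesis unfolding intersection_number_def by (intro Least_le) (use that in blast)
  qed
  have le: "c F \<le> ?c' F" if F: "F \<in> intersection_family E \<G>'" for F
  proof -
    obtain \<H> where H: "\<H> \<subseteq> \<G>'" "F = E \<inter> \<Inter>\<H>" using F unfolding intersection_family_def by blast
    have finH: "finite \<H>" using H(1) sub finG finite_subset by (meson order_trans)
    let ?Q = "\<lambda>k. \<exists>\<H>. \<H> \<subseteq> \<G>' \<and> finite \<H> \<and> card \<H> = k \<and> F = E \<inter> \<Inter>\<H>"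
    have "?Q (card \<H>)" using H finH by (intro exI[of _ \<H>] conjI refl)
    then have "?Q (?c' F)" unfolding intersection_number_def by (rule LeastI[of ?Q])
    then obtain \<H>' where H': "\<H>' \<subseteq> \<G>' \<and> finite \<H>' \<and> card \<H>' = ?c' F \<and> F = E \<inter> \<Inter>\<H>'" ..
    then have "\<H>' \<subseteq> \<G>" using sub by blast
    then show ?thesis using c_le[of \<H>' F] H' by simp
  qed
  have "(\<forall>F\<in>intersection_family E \<G>'. card (I \<inter> F) \<le> family_rank 2 E \<G>' F) \<longleftrightarrow>
      (\<forall>F\<in>closed_sets. card (I \<inter> F) \<le> family_rank 2 E \<G> F)" if I: "I \<subseteq> E"
  proof
    assume h: "\<forall>F\<in>closed_sets. card (I \<inter> F) \<le> family_rank 2 E \<G> F"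
    show "\<forall>F\<in>intersection_family E \<G>'. card (I \<inter> F) \<le> family_rank 2 E \<G>' F"
    proof
      fix F assume F: "F \<in> intersection_family E \<G>'"
      then have "F \<in> closed_sets" using sub unfolding intersection_family_def by blast
      then have "card (I \<inter> F) \<le> family_rank 2 E \<G> F" using h by blast
      also have "\<dots> \<le> family_rank 2 E \<G>' F"
        unfolding family_rank_def using le[OF F] by (intro div_le_mono) simp
      finally show "card (I \<inter> F) \<le> family_rank 2 E \<G>' F" .
    qed
  next
    assume h: "\<forall>F\<in>intersection_family E \<G>'. card (I \<inter> F) \<le> family_rank 2 E \<G>' F"
    show "\<forall>F\<in>closed_sets. card (I \<inter> F) \<le> family_rank 2 E \<G> F"
    proof
      fix F assume F: "F \<in> closed_sets"
      obtain \<H> where H: "\<H> \<subseteq> \<G>" "finite \<H>" "card \<H> = c F" "F = E \<inter> \<Inter>\<H>" using c_witness[OF F] .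
      define \<H>1 where "\<H>1 = \<H> \<inter> \<G>'"
      define \<H>2 where "\<H>2 = \<H> - \<G>'"
      define F' where "F' = E \<inter> \<Inter>\<H>1"
      define D where "D = {e \<in> E. E - {e} \<in> \<H>2}"
      have FF: "F \<subseteq> F'" unfolding F'_def H(4) \<H>1_def by blast
      have F': "F' \<in> intersection_family E \<G>'"
        unfolding intersection_family_def using FF closedD(1)[OF F] F'_def \<H>1_def by blast
      have FD: "F' = F \<union> D"
      proof
        show "F' \<subseteq> F \<union> D"
        proof
          fix x assume x: "x \<in> F'"
          show "x \<in> F \<union> D"
          proof (cases "x \<in> F")
            case False
            then obtain A where A: "A \<in> \<H>" "x \<notin> A" using x unfolding F'_def H(4) by blast
            then have A2: "A \<in> \<H>2" using x unfolding F'_def \<H>1_def \<H>2_def by blast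
            then obtain e where e: "e \<in> E" "A = E - {e}" using rest[of A] H(1) unfolding \<H>2_def by blast
            then have "x = e" using A(2) x unfolding F'_def by blast
            then show ?thesis using e A2 unfolding D_def by blast
          qed blast
        qed
        show "F \<union> D \<subseteq> F'"
        proof
          fix x assume "x \<in> F \<union> D"
          then show "x \<in> F'"
          proof
            assume x: "x \<in> D"
            have "x \<in> A" if A: "A \<in> \<H>1" for A
            proof -
              have "A \<noteq> E - {x}" "E - {x} \<in> \<H>" "A \<in> \<H>" using x A unfolding D_def \<H>1_def \<H>2_def by auto
              then have "A \<union> (E - {x}) = E"
                by (intro shortest_representation_covers[OF closedD(1)[OF F] H(1,3,4)]) auto
              then show ?thesis using x unfolding D_def by blast
            qed
            then show ?thesis using x unfolding F'_def D_def by blast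
          qed (use FF in blast)
        qed
      qed
      have disj: "F \<inter> D = {}" unfolding D_def \<H>2_def H(4) by blast
      have "card D = card ((\<lambda>e. E - {e}) ` D)"
      proof (rule card_image[symmetric])
        show "inj_on (\<lambda>e. E - {e}) D" by (rule inj_onI) (auto simp: D_def)
      qed
      also have "(\<lambda>e. E - {e}) ` D = \<H>2"
      proof
        show "(\<lambda>e. E - {e}) ` D \<subseteq> \<H>2" unfolding D_def by blast
        show "\<H>2 \<subseteq> (\<lambda>e. E - {e}) ` D"
        proof
          fix A assume A: "A \<in> \<H>2"
          then obtain e where "e \<in> E" "A = E - {e}" using rest[of A] H(1) unfolding \<H>2_def by blast
          then show "A \<in> (\<lambda>e. E - {e}) ` D" using A unfolding D_def by blast
        qed
      qed
      finally have cD: "card D = card \<H>2" .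
      have "card \<H> = card \<H>1 + card \<H>2"
        unfolding \<H>1_def \<H>2_def using card_Int_Diff[OF H(2)] .
      moreover have "card F' = card F + card D"
        unfolding FD by (rule card_Un_disjoint[OF _ _ disj])
          (use closedD(2)[OF F] finE finite_subset in \<open>auto simp: D_def\<close>)
      moreover have "?c' F' \<le> card \<H>1" by (rule c'[OF _ F'_def]) (simp add: \<H>1_def)
      ultimately have "card F' + ?c' F' \<le> card F + c F" using H(3) cD by simp
      then have "family_rank 2 E \<G>' F' \<le> family_rank 2 E \<G> F"
        unfolding family_rank_def by (intro div_le_mono) simp
      moreover have "card (I \<inter> F) \<le> card (I \<inter> F')"
        by (rule card_mono) (use FF I finE finite_subset in blast)+
      moreover have "card (I \<inter> F') \<le> family_rank 2 E \<G>' F'" using h F' by blast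
      ultimately show "card (I \<inter> F) \<le> family_rank 2 E \<G> F" by linarith
    qed
  qed
  then show "I \<in> indeps (family_matroid 2 E \<G>') \<longleftrightarrow> I \<in> indeps (family_matroid 2 E \<G>)"
    unfolding indeps_family_matroid[OF finE] by blast
qed simp

end

section \<open>Congruences for cardinalities\<close>

lemma ground_cardinality_iff:
  assumes "2 \<le> \<delta>"
  shows "(\<exists>g::int. [g = 0] (mod (int \<delta> - 1)) \<and> real n = real \<delta> * of_int g / (real \<delta> - 1)) \<longleftrightarrow> \<delta> dvd n"
proof
  assume "\<exists>g::int. [g = 0] (mod (int \<delta> - 1)) \<and> real n = real \<delta> * of_int g / (real \<delta> - 1)"
  then obtain g k where g: "g = (int \<delta> - 1) * k" "real n = real \<delta> * of_int g / (real \<delta> - 1)"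
    by (auto simp: cong_0_iff)
  have "real_of_int (int n) = real_of_int (int \<delta> * k)" using g assms by simp
  then have "int n = int \<delta> * k" by (simp only: of_int_eq_iff)
  then have "int \<delta> dvd int n" by simp
  then show "\<delta> dvd n" by simp
next
  assume "\<delta> dvd n"
  then obtain m where m: "n = \<delta> * m" by blast
  show "\<exists>g::int. [g = 0] (mod (int \<delta> - 1)) \<and> real n = real \<delta> * of_int g / (real \<delta> - 1)"
    by (rule exI[of _ "(int \<delta> - 1) * int m"]) (use m assms in \<open>auto simp: cong_0_iff\<close>)
qed

lemma member_cardinality_iff:
  assumes "2 \<le> \<delta>"
  shows "(\<exists>g::int. [g = 1] (mod (int \<delta> - 1)) \<and> real n = (real \<delta> * of_int g - 1) / (real \<delta> - 1)) \<longleftrightarrow> n mod \<delta> = 1"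
proof
  assume "\<exists>g::int. [g = 1] (mod (int \<delta> - 1)) \<and> real n = (real \<delta> * of_int g - 1) / (real \<delta> - 1)"
  then obtain g where g: "[g = 1] (mod (int \<delta> - 1))" "real n = (real \<delta> * of_int g - 1) / (real \<delta> - 1)"
    by blast
  then obtain k where "g - 1 = (int \<delta> - 1) * k" unfolding cong_iff_dvd_diff by (elim dvdE)
  then have k: "g = 1 + (int \<delta> - 1) * k" by simp
  have "real n * (real \<delta> - 1) = real \<delta> * of_int g - 1" using g(2) assms by (simp add: field_simps)
  also have "\<dots> = (1 + real \<delta> * of_int k) * (real \<delta> - 1)" unfolding k by (simp add: algebra_simps)
  finally have "real n = 1 + real \<delta> * of_int k" using assms by simp
  then have "real_of_int (int n) = real_of_int (1 + int \<delta> * k)" by simp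
  then have "int n = 1 + int \<delta> * k" by (simp only: of_int_eq_iff)
  then have "int n mod int \<delta> = 1" using assms by simp
  then have "int (n mod \<delta>) = int 1" by (simp add: zmod_int)
  then show "n mod \<delta> = 1" by (simp only: of_nat_eq_iff)
next
  assume n: "n mod \<delta> = 1"
  define m where "m = n div \<delta>"
  have m: "n = \<delta> * m + 1" using n by (metis m_def mult_div_mod_eq)
  show "\<exists>g::int. [g = 1] (mod (int \<delta> - 1)) \<and> real n = (real \<delta> * of_int g - 1) / (real \<delta> - 1)"
  proof (intro exI conjI)
    show "[1 + (int \<delta> - 1) * int m = 1] (mod (int \<delta> - 1))" by (simp add: cong_iff_dvd_diff)
    show "real n = (real \<delta> * of_int (1 + (int \<delta> - 1) * int m) - 1) / (real \<delta> - 1)"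
      using assms unfolding m by (simp add: field_simps)
  qed
qed

lemma odd_member_iff: "(\<exists>g::int. int n = 2 * g - 1) \<longleftrightarrow> n mod 2 = 1"
proof
  assume "\<exists>g::int. int n = 2 * g - 1"
  then show "n mod 2 = 1" by presburger
next
  assume "n mod 2 = 1"
  then have "int n = 2 * (int (n div 2) + 1) - 1" by presburger
  then show "\<exists>g::int. int n = 2 * g - 1" by blast
qed

lemma crossing_family_of_G_family:
  assumes "G_family \<delta> E \<G>" shows "crossing_family \<delta> E \<G>"
proof -
  have d: "2 \<le> \<delta>" using assms unfolding G_family_def by blast
  show ?thesis
    using assms unfolding crossing_family_def G_family_def ground_cardinality_iff[OF d] member_cardinality_iff[OF d]
    by blast
qed

lemma G'_family_matroid:
  assumes "G'_family \<delta> E \<G>"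
  obtains r where "rank_function E r" "family_matroid \<delta> E \<G> = matroid_of_rank E r"
    "gorenstein_block (slack \<delta> (\<lambda>_. int \<delta> - 1) r) E"
proof -
  have G: "G_family \<delta> E \<G>" using assms unfolding G'_family_def by blast
  interpret crossing_family \<delta> E \<G> by (rule crossing_family_of_G_family[OF G])
  have "excess (E - {e}) \<le> \<delta> - 1" if e: "e \<in> E" for e
  proof -
    obtain \<H> where H: "card \<H> = \<delta> - 1" "disjoint \<H>" "\<Union>\<H> = E - {e}" "\<forall>H\<in>\<H>. H \<in> \<G>"
      using assms e unfolding G'_family_def by meson
    show ?thesis by (rule excess_complement_le[OF _ H(2,3)]) (use H(1,4) in auto)
  qed
  then show ?thesis
    using that[OF rank_function_family_rk family_matroid_eq slack_family_block] by blast
qed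

lemma G'2_family_matroid:
  assumes G: "G'2_family E \<G>"
  obtains r where "rank_function E r" "family_matroid 2 E \<G> = matroid_of_rank E r"
    "gorenstein_block (slack 2 (\<lambda>_. 1) r) E"
proof -
  define \<G>2 where "\<G>2 = \<G> \<union> (\<lambda>e. E - {e}) ` E"
  have fin: "finite E" and GE: "\<G> \<subseteq> Pow E" and sing: "\<And>e. e \<in> E \<Longrightarrow> {e} \<in> \<G>"
    and cross: "\<And>A B. A \<in> \<G> \<Longrightarrow> B \<in> \<G> \<Longrightarrow> A \<inter> B \<noteq> {} \<Longrightarrow> A \<union> B \<noteq> E \<Longrightarrow>
      A \<inter> B \<in> \<G> \<and> ((\<forall>e\<in>E. A \<union> B \<noteq> E - {e}) \<longrightarrow> A \<union> B \<in> \<G>)"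
    and even: "\<exists>g::int. int (card E) = 2 * g" and odd: "\<And>A. A \<in> \<G> \<Longrightarrow> \<exists>g::int. int (card A) = 2 * g - 1"
    using G unfolding G'2_family_def by blast+
  have cE: "2 dvd card E" using even by presburger
  interpret crossing_family 2 E \<G>2
  proof
    show "(2::nat) \<le> 2" "finite E" "2 dvd card E" using fin cE by simp_all
    show "\<G>2 \<subseteq> Pow E" unfolding \<G>2_def using GE by blast
    show "{e} \<in> \<G>2" if "e \<in> E" for e using sing[OF that] unfolding \<G>2_def by blast
    show "card A mod 2 = 1" if A: "A \<in> \<G>2" for A
    proof (cases "A \<in> \<G>")
      case True
      then show ?thesis using odd[OF True] odd_member_iff by simp
    next
      case False
      then obtain e where e: "e \<in> E" "A = E - {e}" using A unfolding \<G>2_def by blast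
      then have "card E = Suc (card A)" using fin card_Suc_Diff1[OF fin e(1)] by simp
      then show ?thesis using cE by presburger
    qed
    fix A B assume AB: "A \<in> \<G>2" "B \<in> \<G>2" "A \<inter> B \<noteq> {}" "A \<union> B \<noteq> E"
    have sub: "A \<subseteq> E" "B \<subseteq> E" using AB GE unfolding \<G>2_def by blast+
    consider e where "e \<in> E" "A = E - {e}" | e where "e \<in> E" "B = E - {e}" | "A \<in> \<G>" "B \<in> \<G>"
      using AB(1,2) unfolding \<G>2_def by blast
    then show "A \<inter> B \<in> \<G>2 \<and> A \<union> B \<in> \<G>2"
    proof cases
      case 1
      then have "B \<subseteq> A" using sub AB(4) by blast
      then show ?thesis using AB(1,2) by (simp add: Int_absorb1 Un_absorb2)
    next
      case 2
      then have "A \<subseteq> B" using sub AB(4) by blast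
      then show ?thesis using AB(1,2) by (simp add: Int_absorb2 Un_absorb1)
    next
      case 3
      then show ?thesis using cross[OF 3 AB(3,4)] unfolding \<G>2_def by blast
    qed
  qed
  have "excess (E - {e}) \<le> 2 - 1" if e: "e \<in> E" for e
    by (rule excess_complement_le[of "{E - {e}}"]) (use e in \<open>auto simp: \<G>2_def\<close>)
  note this = this and fm = family_matroid_eq[OF this] and rf = rank_function_family_rk[OF this]
  have "family_matroid 2 E \<G> = family_matroid 2 E \<G>2"
    by (rule family_matroid_without_complements) (auto simp: \<G>2_def)
  then show ?thesis using that[OF rf] fm slack_family_block by simp
qed

section \<open>The family of a matroid with a Gorenstein block\<close>

text \<open>A connected matroid with a Gorenstein point all of whose coordinates are \<open>\<delta> - 1\<close>.\<close>

locale uniform_block =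
  fixes \<delta> :: nat and E :: "'a set" and r :: "'a set \<Rightarrow> nat"
  assumes two: "2 \<le> \<delta>" and R: "rank_function E r" and card2: "2 \<le> card E"
    and block: "gorenstein_block (slack \<delta> (\<lambda>_. int \<delta> - 1) r) E"
begin

abbreviation f where "f \<equiv> slack \<delta> (\<lambda>_. int \<delta> - 1) r"

definition flacets :: "'a set set" where
  "flacets = {A. A \<noteq> {} \<and> A \<subset> E \<and> f A = 1}"

lemma finE: "finite E"
  using rank_functionD(1)[OF R] .

lemma f_eq: "f A = int \<delta> * int (r A) - (int \<delta> - 1) * int (card A)"
  by (simp add: slack_def algebra_simps)

lemma f_dvd: "int \<delta> dvd f A - int (card A)"
proof -
  have "f A - int (card A) = int \<delta> * (int (r A) - int (card A))" unfolding f_eq by (simp add: algebra_simps)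
  then show ?thesis by simp
qed

lemma f_sub: "A \<subseteq> E \<Longrightarrow> B \<subseteq> E \<Longrightarrow> f (A \<union> B) + f (A \<inter> B) \<le> f A + f B"
  using submodular_onD[OF slack_submodular[OF R]] .

lemma f_singleton: "e \<in> E \<Longrightarrow> f {e} = 1"
proof -
  assume e: "e \<in> E"
  have "{e} \<noteq> E" using card2 by auto
  then have "1 \<le> f {e}" using gorenstein_blockD(3)[OF block, of "{e}"] e by blast
  moreover have "r {e} \<le> 1" using rank_function_le_card[OF R, of "{e}"] e by simp
  moreover have "r {e} \<noteq> 0" using calculation(1) two unfolding f_eq by (auto intro: ccontr)
  ultimately have "r {e} = 1" by simp
  then show "f {e} = 1" unfolding f_eq by simp
qed

sublocale crossing_family \<delta> E flacets
proof
  show "2 \<le> \<delta>" "finite E" by (rule two finE)+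
  show "flacets \<subseteq> Pow E" unfolding flacets_def by blast
  show "{e} \<in> flacets" if e: "e \<in> E" for e
  proof -
    have "{e} \<noteq> E" using card2 by auto
    then show ?thesis using f_singleton[OF e] e unfolding flacets_def by blast
  qed
  show "\<delta> dvd card E"
    using f_dvd[of E] gorenstein_blockD(2)[OF block] by simp
  show "card A mod \<delta> = 1" if A: "A \<in> flacets" for A
  proof -
    have "int \<delta> dvd int (card A) - 1"
      using f_dvd[of A] A dvd_minus_iff[of "int \<delta>" "1 - int (card A)"] unfolding flacets_def by simp
    then have "int (card A) mod int \<delta> = 1 mod int \<delta>" by (simp add: mod_eq_dvd_iff)
    then have "int (card A mod \<delta>) = int 1" using two by (simp add: zmod_int)
    then show ?thesis by (simp only: of_nat_eq_iff)
  qed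
  fix A B assume AB: "A \<in> flacets" "B \<in> flacets" "A \<inter> B \<noteq> {}" "A \<union> B \<noteq> E"
  have sub: "A \<subseteq> E" "B \<subseteq> E" "f A = 1" "f B = 1" using AB unfolding flacets_def by auto
  have p: "A \<inter> B \<noteq> {}" "A \<inter> B \<subset> E" "A \<union> B \<noteq> {}" "A \<union> B \<subset> E"
    using AB unfolding flacets_def by blast+
  have "1 \<le> f (A \<inter> B)" "1 \<le> f (A \<union> B)"
    using gorenstein_blockD(3)[OF block p(1,2)] gorenstein_blockD(3)[OF block p(3,4)] .
  then have "f (A \<inter> B) = 1" "f (A \<union> B) = 1" using f_sub[OF sub(1,2)] sub(3,4) by linarith+
  then show "A \<inter> B \<in> flacets \<and> A \<union> B \<in> flacets" unfolding flacets_def using p by blast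
qed

text \<open>The slack of an intersection of \<open>k\<close> flacets is at most \<open>k\<close>, since slacks of unions are nonnegative.\<close>

lemma f_le_excess:
  assumes A: "A \<subseteq> E" shows "f A \<le> int (excess A)"
proof -
  have 1: "f (E \<inter> \<Inter>\<H>) \<le> int (card \<H>)" if "finite \<H>" "\<H> \<subseteq> flacets" for \<H>
    using that
  proof (induction \<H> rule: finite_induct)
    case empty
    then show ?case using gorenstein_blockD(2)[OF block] by simp
  next
    case (insert X \<H>)
    have X: "X \<subseteq> E" "f X = 1" using insert.prems unfolding flacets_def by auto
    have "f (X \<union> (E \<inter> \<Inter>\<H>)) + f (X \<inter> (E \<inter> \<Inter>\<H>)) \<le> f X + f (E \<inter> \<Inter>\<H>)"
      by (rule f_sub) (use X in blast)+
    moreover have "0 \<le> f (X \<union> (E \<inter> \<Inter>\<H>))" by (rule gorenstein_blockD(5)[OF block]) (use X in blast)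
    moreover have "X \<inter> (E \<inter> \<Inter>\<H>) = E \<inter> \<Inter>(insert X \<H>)" by auto
    ultimately show ?case using insert X by simp
  qed
  have 2: "f F \<le> int (c F)" if F: "F \<in> closed_sets" for F
  proof -
    obtain \<H> where H: "\<H> \<subseteq> flacets" "finite \<H>" "card \<H> = c F" "F = E \<inter> \<Inter>\<H>" using c_witness[OF F] .
    then show ?thesis using 1[OF H(2,1)] by simp
  qed
  obtain \<P> where P: "finite \<P>" "\<P> \<subseteq> closed_sets" "disjoint \<P>" "\<Union>\<P> = A" "sum c \<P> = excess A"
    using excess_witness[OF A] .
  have "f (\<Union>\<Q>) \<le> (\<Sum>F\<in>\<Q>. int (c F))" if "finite \<Q>" "\<Q> \<subseteq> \<P>" for \<Q>
    using that
  proof (induction \<Q> rule: finite_induct)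
    case empty
    then show ?case using gorenstein_blockD(1)[OF block] by simp
  next
    case (insert F \<Q>)
    have sub: "F \<subseteq> E" "\<Union>\<Q> \<subseteq> E" using insert.prems P(4) A by blast+
    have "f (F \<union> \<Union>\<Q>) + f (F \<inter> \<Union>\<Q>) \<le> f F + f (\<Union>\<Q>)" by (rule f_sub[OF sub])
    moreover have "0 \<le> f (F \<inter> \<Union>\<Q>)"
      by (rule gorenstein_blockD(5)[OF block le_infI1[OF sub(1)]])
    moreover have "f F \<le> int (c F)" using 2 insert.prems P(2) by blast
    ultimately show ?case using insert by simp
  qed
  from this[OF P(1) order_refl] show ?thesis using P(4) by (simp flip: P(5))
qed

text \<open>A set that is not a flacet splits into two sets of smaller slack, and the excess, being submodular with
  value zero on \<open>E\<close>, is subadditive for both kinds of splitting.\<close>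

lemma excess_le_f: "A \<subseteq> E \<Longrightarrow> int (excess A) \<le> f A"
proof (induction "nat (f A)" arbitrary: A rule: less_induct)
  case less
  note D = gorenstein_blockD[OF block]
  show ?case
  proof (cases "A = {} \<or> A = E")
    case True
    then show ?thesis using excess_empty excess_ground D(1,2) by auto
  next
    case False
    then have A: "A \<noteq> {}" "A \<subset> E" using less.prems by auto
    consider "f A = 1" | "splits_inside f A" | "splits_outside f E A" using D(4)[OF A] by blast
    then show ?thesis
    proof cases
      case 1
      then have "A \<in> flacets" unfolding flacets_def using A by blast
      then have "excess A \<le> 1" using excess_closed[OF member_closed(1)] member_closed(2) by (meson le_trans)
      then show ?thesis using 1 by simp
    next
      case 2
      then obtain S S' where S: "S \<noteq> {}" "S' \<noteq> {}" "S \<inter> S' = {}" "S \<union> S' = A" "f S + f S' = f A"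
        unfolding splits_inside_def by blast
      have p: "S \<subset> E" "S' \<subset> E" using S(4) A(2) by blast+
      have "1 \<le> f S" "1 \<le> f S'" using D(3)[OF S(1) p(1)] D(3)[OF S(2) p(2)] .
      then have "int (excess S) \<le> f S" "int (excess S') \<le> f S'"
        using less.hyps[of S] less.hyps[of S'] S(5) p by auto
      moreover have "excess A \<le> excess S + excess S'" using excess_Un[of S S'] p S(4) by auto
      ultimately show ?thesis using S(5) by linarith
    next
      case 3
      then obtain S S' where S: "S \<subset> E" "S' \<subset> E" "S \<inter> S' = A" "S \<union> S' = E" "f S + f S' = f A"
        unfolding splits_outside_def by blast
      have p: "S \<noteq> {}" "S' \<noteq> {}" using S(3) A(1) by blast+
      have "1 \<le> f S" "1 \<le> f S'" using D(3)[OF p(1) S(1)] D(3)[OF p(2) S(2)] .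
      then have "int (excess S) \<le> f S" "int (excess S') \<le> f S'"
        using less.hyps[of S] less.hyps[of S'] S(1,2,5) by auto
      moreover have "excess E + excess A \<le> excess S + excess S'"
        using submodular_onD[OF excess_submodular, of S S'] S by auto
      ultimately show ?thesis using S(5) by linarith
    qed
  qed
qed

lemma excess_eq_f: "A \<subseteq> E \<Longrightarrow> int (excess A) = f A"
  using f_le_excess excess_le_f by (intro antisym) auto

lemma family_rk_eq: "A \<subseteq> E \<Longrightarrow> family_rk A = r A"
proof -
  assume A: "A \<subseteq> E"
  have "int \<delta> * int (family_rk A) = int \<delta> * int (r A)"
    using slack_family_rk[OF A] excess_eq_f[OF A] unfolding slack_def by simp
  then show ?thesis using two by simp
qed

text \<open>The slack of \<open>E - {e}\<close> is positive and congruent to \<open>-1\<close> modulo \<open>\<delta>\<close>, and monotonicity of the rank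
  leaves no room for more than \<open>\<delta> - 1\<close>.\<close>

lemma excess_complement: "e \<in> E \<Longrightarrow> excess (E - {e}) = \<delta> - 1"
proof -
  assume e: "e \<in> E"
  have p: "E - {e} \<noteq> {}" "E - {e} \<subset> E" using e card2 by (auto simp: subset_singleton_iff)
  have cE: "card E = Suc (card (E - {e}))" using card_Suc_Diff1[OF finE e] by simp
  have le: "r (E - {e}) \<le> r E" by (rule rank_function_mono[OF R]) auto
  have fE: "int \<delta> * int (r E) = (int \<delta> - 1) * int (card E)"
    using gorenstein_blockD(2)[OF block] unfolding f_eq by simp
  have eq: "f (E - {e}) = int \<delta> * (int (r (E - {e})) - int (r E)) + (int \<delta> - 1)"
    unfolding f_eq using fE cE by (simp add: algebra_simps)
  have "r (E - {e}) = r E"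
  proof (rule ccontr)
    assume "r (E - {e}) \<noteq> r E"
    then have "int (r (E - {e})) - int (r E) \<le> - 1" using le by linarith
    then have "int \<delta> * (int (r (E - {e})) - int (r E)) \<le> int \<delta> * (- 1)" by (intro mult_left_mono) auto
    then show False using gorenstein_blockD(3)[OF block p] eq by linarith
  qed
  then have "int (excess (E - {e})) = int \<delta> - 1" using excess_eq_f[of "E - {e}"] eq by auto
  then show "excess (E - {e}) = \<delta> - 1" using two by linarith
qed

lemma family_matroid_flacets: "family_matroid \<delta> E flacets = matroid_of_rank E r"
proof -
  have "family_matroid \<delta> E flacets = matroid_of_rank E family_rk"
    by (rule family_matroid_eq) (simp add: excess_complement)
  also have "\<dots> = matroid_of_rank E r"
    unfolding matroid_of_rank_def using family_rk_eq by auto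
  finally show ?thesis .
qed

lemma G'_family_flacets: "G'_family \<delta> E flacets"
  unfolding G'_family_def
proof (intro conjI ballI)
  show "G_family \<delta> E flacets"
    unfolding G_family_def ground_cardinality_iff[OF two] member_cardinality_iff[OF two]
  proof (intro conjI ballI impI)
    fix A B assume AB: "A \<in> flacets" "B \<in> flacets" "A \<inter> B \<noteq> {} \<and> A \<union> B \<noteq> E"
    show "A \<inter> B \<in> flacets" "A \<union> B \<in> flacets"
      using crossing[OF AB(1,2) conjunct1[OF AB(3)] conjunct2[OF AB(3)]] by simp_all
  qed (fact two finE GE cardE | erule singletons card_member)+
  fix e assume e: "e \<in> E"
  obtain \<P> where P: "card \<P> = \<delta> - 1" "disjoint \<P>" "\<Union>\<P> = E - {e}" "\<P> \<subseteq> flacets"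
    "\<And>P A. P \<in> \<P> \<Longrightarrow> A \<in> flacets \<Longrightarrow> P \<subseteq> A \<Longrightarrow> A \<subseteq> E - {e} \<Longrightarrow> A = P"
    using complement_partition[OF e excess_complement[OF e]] by blast
  show "\<exists>\<H>. card \<H> = \<delta> - 1 \<and> disjoint \<H> \<and> \<Union>\<H> = E - {e} \<and>
      (\<forall>H\<in>\<H>. H \<in> flacets \<and> (\<forall>A\<in>flacets. H \<subseteq> A \<and> A \<subseteq> E - {e} \<longrightarrow> A = H))"
  proof (intro exI[of _ \<P>] conjI ballI impI)
    show "card \<P> = \<delta> - 1" "disjoint \<P>" "\<Union>\<P> = E - {e}" by (fact P)+
    fix H assume H: "H \<in> \<P>"
    show "H \<in> flacets" using H P(4) by blast
    show "A = H" if "A \<in> flacets" "H \<subseteq> A \<and> A \<subseteq> E - {e}" for A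
      using P(5)[OF H that(1)] that(2) by simp
  qed
qed

text \<open>On a ground set with two elements the complements of single elements are the singletons, which the
  family has to contain.\<close>

lemma G'2_family_flacets:
  assumes d: "\<delta> = 2"
  shows "\<exists>\<G>. G'2_family E \<G> \<and> family_matroid 2 E \<G> = matroid_of_rank E r"
proof -
  define \<G> where "\<G> = (if card E = 2 then flacets else flacets - (\<lambda>e. E - {e}) ` E)"
  have sub: "\<G> \<subseteq> flacets" unfolding \<G>_def by auto
  have m1: "card A mod 2 = 1" if "A \<in> flacets" for A using card_member[OF that] d by simp
  have "G'2_family E \<G>"
    unfolding G'2_family_def odd_member_iff
  proof (intro conjI ballI impI)
    show "finite E" by (rule finE)
    show "\<G> \<subseteq> Pow E" using sub GE by blast
    show "\<exists>g::int. int (card E) = 2 * g" using cardE d by presburger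
    show "card A mod 2 = 1" if "A \<in> \<G>" for A using m1 sub that by blast
    fix e assume e: "e \<in> E"
    show "E - {e} \<notin> \<G>" if "card E \<noteq> 2" using that e unfolding \<G>_def by auto
    show "{e} \<in> \<G>"
    proof (cases "card E = 2")
      case False
      have "{e} \<noteq> E - {e'}" if e': "e' \<in> E" for e'
      proof
        assume "{e} = E - {e'}"
        then have "card E = Suc (card {e})" using card_Suc_Diff1[OF finE e'] by simp
        then show False using False by simp
      qed
      then show ?thesis using singletons[OF e] False unfolding \<G>_def by auto
    qed (use singletons[OF e] \<G>_def in auto)
  next
    fix A B assume AB: "A \<in> \<G>" "B \<in> \<G>" "A \<inter> B \<noteq> {} \<and> A \<union> B \<noteq> E"
    have fl: "A \<inter> B \<in> flacets" "A \<union> B \<in> flacets" using crossing[of A B] AB sub by blast+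
    have AE: "A \<subset> E" "B \<subset> E" using AB sub unfolding flacets_def by blast+
    show "A \<inter> B \<in> \<G>"
    proof (cases "card E = 2")
      case False
      have "A \<inter> B \<noteq> E - {e}" if e: "e \<in> E" for e
      proof
        assume "A \<inter> B = E - {e}"
        then have "A = E - {e}" using AE(1) by blast
        then show False using AB(1) e False unfolding \<G>_def by auto
      qed
      then show ?thesis using fl(1) False unfolding \<G>_def by auto
    qed (use fl \<G>_def in auto)
    show "A \<union> B \<in> \<G>" if "\<forall>e\<in>E. A \<union> B \<noteq> E - {e}" using that fl(2) unfolding \<G>_def by auto
  qed
  moreover have "family_matroid 2 E \<G> = family_matroid 2 E flacets"
    by (rule family_matroid_without_complements[OF sub]) (auto simp: \<G>_def split: if_splits)
  ultimately show ?thesis using family_matroid_flacets d by auto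
qed

end

section \<open>The values of a Gorenstein point\<close>

text \<open>In terms of flacets this is Tutte's theorem that a connected matroid stays connected after
  deleting or after contracting any given element.\<close>

lemma block_element_value:
  assumes R: "rank_function E r" and block: "gorenstein_block (slack \<delta> v r) E"
    and card: "2 \<le> card E" and e: "e \<in> E"
  shows "r {e} = 1" "1 \<le> v e" "v e \<le> int \<delta> - 1" "v e = 1 \<or> v e = int \<delta> - 1"
proof -
  let ?f = "slack \<delta> v r"
  note D = gorenstein_blockD[OF block]
  have fin: "finite E" using rank_functionD(1)[OF R] .
  have p: "{e} \<noteq> {}" "{e} \<subset> E" "E - {e} \<noteq> {}" "E - {e} \<subset> E"
  proof -
    have "E \<noteq> {e}" using card by auto
    then show "{e} \<noteq> {}" "{e} \<subset> E" "E - {e} \<noteq> {}" "E - {e} \<subset> E" using e by blast+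
  qed
  have compl: "?f A + ?f (E - A) = int \<delta> * (int (r A) + int (r (E - A)) - int (r E))" if "A \<subseteq> E" for A
  proof -
    have "sum v E = sum v A + sum v (E - A)" using sum.subset_diff[OF that fin, of v] by simp
    then show ?thesis using D(2) unfolding slack_def by (simp add: algebra_simps)
  qed
  have pos: "1 \<le> ?f {e}" "1 \<le> ?f (E - {e})" using D(3)[OF p(1,2)] D(3)[OF p(3,4)] .
  have re: "r {e} \<le> 1" using rank_function_le_card[OF R, of "{e}"] e by simp
  have rE: "r (E - {e}) \<le> r E" by (rule rank_function_mono[OF R]) auto
  have sume: "?f {e} + ?f (E - {e}) = int \<delta> * (int (r {e}) + int (r (E - {e})) - int (r E))"
    by (rule compl) (use e in simp)
  have "0 < int \<delta> * (int (r {e}) + int (r (E - {e})) - int (r E))" using sume pos by linarith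
  then have "0 < int (r {e}) + int (r (E - {e})) - int (r E)"
    by (simp add: zero_less_mult_iff)
  then have r: "r {e} = 1" "r (E - {e}) = r E" using re rE by linarith+
  show "r {e} = 1" by (rule r(1))
  have fe: "?f {e} = int \<delta> - v e" using r(1) by (simp add: slack_def)
  have fE: "?f (E - {e}) = v e" using sume r fe by simp
  show "1 \<le> v e" "v e \<le> int \<delta> - 1" using pos fe fE by auto
  show "v e = 1 \<or> v e = int \<delta> - 1"
  proof (rule ccontr)
    assume n: "\<not> ?thesis"
    have "\<not> splits_inside ?f {e}"
      unfolding splits_inside_def by (metis Un_singleton_iff inf.idem)
    then have "splits_outside ?f E {e}" using D(4)[OF p(1,2)] n fe by auto
    then obtain S S' where S: "S \<subset> E" "S' \<subset> E" "S \<inter> S' = {e}" "S \<union> S' = E" "?f S + ?f S' = ?f {e}"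
      unfolding splits_outside_def by blast
    have "\<not> splits_outside ?f E (E - {e})"
    proof
      assume "splits_outside ?f E (E - {e})"
      then obtain U U' where U: "U \<subset> E" "U' \<subset> E" "U \<inter> U' = E - {e}" "U \<union> U' = E"
        unfolding splits_outside_def by blast
      then have "e \<notin> U" "e \<notin> U'" by blast+
      then show False using U(4) e by blast
    qed
    then have "splits_inside ?f (E - {e})" using D(4)[OF p(3,4)] n fE by auto
    then obtain T T' where T: "T \<noteq> {}" "T' \<noteq> {}" "T \<inter> T' = {}" "T \<union> T' = E - {e}" "?f T + ?f T' = ?f (E - {e})"
      unfolding splits_inside_def by blast
    have big: "int \<delta> \<le> ?f A + ?f (E - A)" if A: "A \<noteq> {}" "A \<subset> E" for A
    proof -
      have c: "E - A \<noteq> {}" "E - A \<subset> E" using A by blast+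
      have "1 \<le> ?f A" "1 \<le> ?f (E - A)" using D(3)[OF A] D(3)[OF c] .
      then have "0 < int \<delta> * (int (r A) + int (r (E - A)) - int (r E))"
        using compl[of A] A by (simp add: psubset_imp_subset)
      then have "1 \<le> int (r A) + int (r (E - A)) - int (r E)" "0 < \<delta>"
        by (simp_all add: zero_less_mult_iff)
      then have "int \<delta> * 1 \<le> int \<delta> * (int (r A) + int (r (E - A)) - int (r E))"
        by (intro mult_left_mono) auto
      then show ?thesis using compl[of A] A by (simp add: psubset_imp_subset)
    qed
    \<comment> \<open>Uncrossing a splitting of \<open>{e}\<close> with one of \<open>E - {e}\<close>: the four sets obtained form two
      complementary pairs, whose slacks add up to at least \<open>\<delta>\<close> each, while the total is \<open>\<delta>\<close>.\<close>
    have key: "T \<inter> X = {} \<or> T' \<inter> X' = {}"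
      if X: "X \<subset> E" "X' \<subset> E" "X \<inter> X' = {e}" "X \<union> X' = E" "?f X + ?f X' = ?f {e}" for X X'
    proof (rule ccontr)
      assume "\<not> ?thesis"
      then have ne: "T \<inter> X \<noteq> {}" "T' \<inter> X' \<noteq> {}" by auto
      have TE: "T \<subseteq> E" "T' \<subseteq> E" "e \<notin> T" "e \<notin> T'" using T(4) by auto
      have pr: "T \<inter> X \<subset> E" "T' \<inter> X' \<subset> E" using X(1,2) by blast+
      have c: "E - T \<inter> X = T' \<union> X'" "E - T' \<inter> X' = T \<union> X" using T(3,4) X(3,4) TE by blast+
      have "int \<delta> \<le> ?f (T \<inter> X) + ?f (T' \<union> X')" using big[OF ne(1) pr(1)] unfolding c .
      moreover have "int \<delta> \<le> ?f (T' \<inter> X') + ?f (T \<union> X)" using big[OF ne(2) pr(2)] unfolding c .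
      moreover have "?f (T \<union> X) + ?f (T \<inter> X) \<le> ?f T + ?f X"
        by (rule submodular_onD[OF slack_submodular[OF R]]) (use TE X(1) in blast)+
      moreover have "?f (T' \<union> X') + ?f (T' \<inter> X') \<le> ?f T' + ?f X'"
        by (rule submodular_onD[OF slack_submodular[OF R]]) (use TE X(2) in blast)+
      ultimately have "2 * int \<delta> \<le> int \<delta>" using T(5) X(5) fe fE by linarith
      then show False using pos fe fE by linarith
    qed
    have 1: "T \<inter> S = {} \<or> T' \<inter> S' = {}" by (rule key[OF S])
    have 2: "T \<inter> S' = {} \<or> T' \<inter> S = {}"
      by (rule key) (use S in \<open>auto simp: Int_commute Un_commute add.commute\<close>)
    have TE: "T \<subseteq> S \<union> S'" "T' \<subseteq> S \<union> S'" using T(4) S(4) by blast+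
    have "S \<noteq> {e}" "S' \<noteq> {e}" using S by blast+
    then obtain x x' where x: "x \<in> S" "x \<noteq> e" "x' \<in> S'" "x' \<noteq> e" using S(3) by blast
    have xT: "x \<in> T \<or> x \<in> T'" "x' \<in> T \<or> x' \<in> T'" using x T(4) S(1,2) by blast+
    show False using 1 2
    proof (elim disjE)
      assume "T \<inter> S = {}" "T \<inter> S' = {}"
      then show False using TE(1) T(1) by blast
    next
      assume "T \<inter> S = {}" "T' \<inter> S = {}"
      then show False using x(1) xT(1) by blast
    next
      assume "T' \<inter> S' = {}" "T \<inter> S' = {}"
      then show False using x(3) xT(2) by blast
    next
      assume "T' \<inter> S' = {}" "T' \<inter> S = {}"
      then show False using TE(2) T(2) by blast
    qed
  qed
qed

section \<open>Series extensions\<close>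

text \<open>Every element \<open>e\<close> is replaced by the elements of its fibre in series. The nullity of a set in the
  extension is the nullity of the set of elements whose whole fibre it contains.\<close>

locale series_extension =
  fixes E :: "'a set" and r :: "'a set \<Rightarrow> nat" and fib :: "'a \<Rightarrow> 'b set"
  assumes R: "rank_function E r"
    and fib: "\<And>e. e \<in> E \<Longrightarrow> finite (fib e)" "\<And>e. e \<in> E \<Longrightarrow> fib e \<noteq> {}"
    and fib_disjoint: "\<And>e e'. e \<in> E \<Longrightarrow> e' \<in> E \<Longrightarrow> e \<noteq> e' \<Longrightarrow> fib e \<inter> fib e' = {}"
begin

lemma finE: "finite E"
  using rank_functionD(1)[OF R] .

definition lift :: "'a set \<Rightarrow> 'b set" where
  "lift X = (\<Union>e\<in>X. fib e)"

definition full :: "'b set \<Rightarrow> 'a set" where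
  "full A = {e \<in> E. fib e \<subseteq> A}"

definition partial :: "'b set \<Rightarrow> 'b set" where
  "partial A = A - lift (full A)"

definition nullity :: "'a set \<Rightarrow> nat" where
  "nullity X = card X - r X"

definition ext_rank :: "'b set \<Rightarrow> nat" where
  "ext_rank A = card A - nullity (full A)"

lemma full_subset: "full A \<subseteq> E"
  unfolding full_def by blast

lemma finite_lift: "X \<subseteq> E \<Longrightarrow> finite (lift X)"
  unfolding lift_def using fib(1) finite_subset[OF _ finE] by blast

lemma fib_unique: "e \<in> E \<Longrightarrow> e' \<in> E \<Longrightarrow> x \<in> fib e \<Longrightarrow> x \<in> fib e' \<Longrightarrow> e = e'"
  using fib_disjoint by blast

lemma fib_lift_iff: "e \<in> E \<Longrightarrow> X \<subseteq> E \<Longrightarrow> x \<in> fib e \<Longrightarrow> x \<in> lift X \<longleftrightarrow> e \<in> X"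
  unfolding lift_def using fib_unique by blast

lemma full_lift: "X \<subseteq> E \<Longrightarrow> full (lift X) = X"
proof -
  assume X: "X \<subseteq> E"
  have "e \<in> X" if e: "e \<in> full (lift X)" for e
  proof -
    obtain x where "x \<in> fib e" using fib(2) e unfolding full_def by blast
    then show ?thesis using fib_lift_iff[OF _ X] e unfolding full_def by blast
  qed
  moreover have "e \<in> full (lift X)" if "e \<in> X" for e using that X unfolding full_def lift_def by blast
  ultimately show ?thesis by blast
qed

lemma lift_nonempty: "X \<subseteq> E \<Longrightarrow> X \<noteq> {} \<Longrightarrow> lift X \<noteq> {}"
  using full_lift[of X] full_lift[of "{}"] by (auto simp: lift_def)

lemma lift_Int: "X \<subseteq> E \<Longrightarrow> Y \<subseteq> E \<Longrightarrow> lift (X \<inter> Y) = lift X \<inter> lift Y"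
proof -
  assume X: "X \<subseteq> E" and Y: "Y \<subseteq> E"
  have "x \<in> lift (X \<inter> Y)" if x: "x \<in> lift X" "x \<in> lift Y" for x
  proof -
    obtain e where e: "e \<in> X" "x \<in> fib e" using x(1) unfolding lift_def by blast
    then have "e \<in> Y" using fib_lift_iff[of e Y x] X Y x(2) by blast
    then show ?thesis using e unfolding lift_def by blast
  qed
  moreover have "lift (X \<inter> Y) \<subseteq> lift X \<inter> lift Y" unfolding lift_def by blast
  ultimately show ?thesis by blast
qed

lemma lift_Un: "lift (X \<union> Y) = lift X \<union> lift Y"
  unfolding lift_def by blast

lemma lift_full: "lift (full A) \<subseteq> A"
  unfolding lift_def full_def by blast

lemma card_lift: "X \<subseteq> E \<Longrightarrow> card (lift X) = (\<Sum>e\<in>X. card (fib e))"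
  unfolding lift_def
proof (rule card_UN_disjoint)
  assume X: "X \<subseteq> E"
  show "finite X" using finite_subset[OF X finE] .
  show "\<forall>i\<in>X. finite (fib i)" using fib(1) X by blast
  show "\<forall>i\<in>X. \<forall>j\<in>X. i \<noteq> j \<longrightarrow> fib i \<inter> fib j = {}" using fib_disjoint X by blast
qed

lemma nullity_le: "X \<subseteq> E \<Longrightarrow> card (lift X) \<ge> nullity X"
proof -
  assume X: "X \<subseteq> E"
  have "card X = (\<Sum>e\<in>X. 1)" by simp
  also have "\<dots> \<le> (\<Sum>e\<in>X. card (fib e))"
  proof (rule sum_mono)
    fix e assume "e \<in> X"
    then have "finite (fib e)" "fib e \<noteq> {}" using fib X by blast+
    then show "1 \<le> card (fib e)" by (simp add: Suc_le_eq card_gt_0_iff)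
  qed
  finally show ?thesis using card_lift[OF X] unfolding nullity_def by simp
qed

lemma nullity_full_le: "finite A \<Longrightarrow> nullity (full A) \<le> card A"
  using nullity_le[OF full_subset, of A] card_mono[OF _ lift_full, of A] by linarith

lemma int_nullity: "X \<subseteq> E \<Longrightarrow> int (nullity X) = int (card X) - int (r X)"
  unfolding nullity_def using rank_function_le_card[OF R] by (simp add: of_nat_diff)

lemma int_ext_rank: "finite A \<Longrightarrow> int (ext_rank A) = int (card A) - int (nullity (full A))"
  unfolding ext_rank_def using nullity_full_le by (simp add: of_nat_diff)

lemma nullity_mono: "X \<subseteq> Y \<Longrightarrow> Y \<subseteq> E \<Longrightarrow> nullity X \<le> nullity Y"
  using rank_function_card_le[OF R, of X Y] unfolding nullity_def by linarith

lemma nullity_supermodular: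
  assumes "X \<subseteq> E" "Y \<subseteq> E"
  shows "nullity X + nullity Y \<le> nullity (X \<union> Y) + nullity (X \<inter> Y)"
proof -
  have fin: "finite X" "finite Y" using assms finE finite_subset by auto
  have sub: "X \<union> Y \<subseteq> E" "X \<inter> Y \<subseteq> E" using assms by auto
  have "card X + card Y = card (X \<union> Y) + card (X \<inter> Y)" using card_Un_Int[OF fin] .
  moreover have "r (X \<union> Y) + r (X \<inter> Y) \<le> r X + r Y"
    using submodular_onD[OF rank_functionD(3)[OF R] assms] .
  ultimately have "int (nullity X) + int (nullity Y) \<le> int (nullity (X \<union> Y)) + int (nullity (X \<inter> Y))"
    unfolding int_nullity[OF assms(1)] int_nullity[OF assms(2)] int_nullity[OF sub(1)] int_nullity[OF sub(2)]
    by linarith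
  then show ?thesis by linarith
qed

lemma rank_function_ext_rank: "rank_function (lift E) ext_rank"
  unfolding rank_function_def
proof (intro conjI allI impI)
  show fin: "finite (lift E)" by (rule finite_lift) simp
  have "full {} = {}" unfolding full_def using fib(2) by blast
  then show "ext_rank {} = 0" unfolding ext_rank_def by simp
  show "submodular_on (lift E) ext_rank"
    unfolding submodular_on_def
  proof (intro allI impI)
    fix A B assume AB: "A \<subseteq> lift E" "B \<subseteq> lift E"
    have f: "finite A" "finite B" "finite (A \<union> B)" "finite (A \<inter> B)"
      using finite_subset[OF AB(1) fin] finite_subset[OF AB(2) fin] by auto
    have "full (A \<inter> B) = full A \<inter> full B" "full A \<union> full B \<subseteq> full (A \<union> B)" unfolding full_def by blast+
    then have "nullity (full A) + nullity (full B) \<le> nullity (full (A \<union> B)) + nullity (full (A \<inter> B))"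
      using nullity_supermodular[OF full_subset full_subset, of A B]
        nullity_mono[OF _ full_subset, of "full A \<union> full B" "A \<union> B"] by simp
    moreover have "card A + card B = card (A \<union> B) + card (A \<inter> B)" using card_Un_Int[OF f(1,2)] .
    ultimately have "int (ext_rank (A \<union> B)) + int (ext_rank (A \<inter> B)) \<le> int (ext_rank A) + int (ext_rank B)"
      unfolding int_ext_rank[OF f(1)] int_ext_rank[OF f(2)] int_ext_rank[OF f(3)] int_ext_rank[OF f(4)]
      by linarith
    then show "ext_rank (A \<union> B) + ext_rank (A \<inter> B) \<le> ext_rank A + ext_rank B" by linarith
  qed
  fix A x assume A: "A \<subseteq> lift E" and x: "x \<in> lift E"
  have fA: "finite A" "finite (insert x A)" using finite_subset[OF A fin] by auto
  have "ext_rank A \<le> ext_rank (insert x A) \<and> ext_rank (insert x A) \<le> Suc (ext_rank A)"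
  proof (cases "x \<in> A")
    case True
    then show ?thesis by (simp add: insert_absorb)
  next
    case False
    obtain e where e: "e \<in> E" "x \<in> fib e" using x unfolding lift_def by blast
    have sub: "full A \<subseteq> full (insert x A)" "full (insert x A) \<subseteq> insert e (full A)"
      unfolding full_def using fib_unique[OF _ e(1) _ e(2)] by blast+
    have i: "insert e (full A) \<subseteq> E" using e(1) full_subset by blast
    have "nullity (full A) \<le> nullity (full (insert x A))" by (rule nullity_mono[OF sub(1) full_subset])
    moreover have "nullity (full (insert x A)) \<le> nullity (insert e (full A))" by (rule nullity_mono[OF sub(2) i])
    moreover have "nullity (insert e (full A)) \<le> Suc (nullity (full A))"
    proof -
      have "r (full A) \<le> r (insert e (full A))" by (rule rank_functionD(4)[OF R full_subset e(1)])
      moreover have "card (insert e (full A)) \<le> Suc (card (full A))" by (rule card_insert_le_m1) simp_all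
      ultimately show ?thesis unfolding nullity_def by linarith
    qed
    moreover have "card (insert x A) = Suc (card A)" using False fA by simp
    ultimately have "int (ext_rank A) \<le> int (ext_rank (insert x A))"
      "int (ext_rank (insert x A)) \<le> int (ext_rank A) + 1"
      unfolding int_ext_rank[OF fA(1)] int_ext_rank[OF fA(2)] by linarith+
    then show ?thesis by linarith
  qed
  then show "ext_rank A \<le> ext_rank (insert x A)" "ext_rank (insert x A) \<le> Suc (ext_rank A)" by auto
qed

lemma slack_ext_rank:
  assumes card: "\<And>e. e \<in> E \<Longrightarrow> int (card (fib e)) = int \<delta> - v e" and A: "A \<subseteq> lift E"
  shows "slack \<delta> (\<lambda>_. int \<delta> - 1) ext_rank A = int (card (partial A)) + slack \<delta> v r (full A)"
proof -
  have fA: "finite A" using finite_subset[OF A finite_lift[OF order_refl]] .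
  have "int (card A) = int (card (partial A)) + int (card (lift (full A)))"
    unfolding partial_def using card_Diff_subset[OF finite_lift[OF full_subset] lift_full, of A]
      card_mono[OF fA lift_full] by simp
  also have "int (card (lift (full A))) = (\<Sum>e\<in>full A. int \<delta> - v e)"
    unfolding card_lift[OF full_subset] of_nat_sum
    by (rule sum.cong[OF refl]) (use card full_subset in blast)
  also have "\<dots> = int \<delta> * int (card (full A)) - sum v (full A)" by (simp add: sum_subtractf)
  finally have c: "int (card A) = int (card (partial A)) + (int \<delta> * int (card (full A)) - sum v (full A))" .
  have "slack \<delta> (\<lambda>_. int \<delta> - 1) ext_rank A = int (card A) - int \<delta> * int (nullity (full A))"
    unfolding slack_def int_ext_rank[OF fA] by (simp add: algebra_simps)
  then show ?thesis unfolding int_nullity[OF full_subset] c slack_def by (simp add: algebra_simps)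
qed

text \<open>Fibres of size \<open>\<delta> - v e\<close> make the slack uniform: a set with incomplete fibres splits off single
  elements of slack one, and a union of fibres splits exactly as in the original matroid.\<close>

lemma ext_block:
  assumes card: "\<And>e. e \<in> E \<Longrightarrow> int (card (fib e)) = int \<delta> - v e"
    and block: "gorenstein_block (slack \<delta> v r) E"
  shows "gorenstein_block (slack \<delta> (\<lambda>_. int \<delta> - 1) ext_rank) (lift E)"
proof -
  let ?f = "slack \<delta> v r" and ?g = "slack \<delta> (\<lambda>_. int \<delta> - 1) ext_rank"
  have g: "?g A = int (card (partial A)) + ?f (full A)" if "A \<subseteq> lift E" for A
    by (rule slack_ext_rank[OF _ that]) (rule card)
  note D = gorenstein_blockD[OF block]
  have lift_sub: "lift X \<subseteq> lift E" if "X \<subseteq> E" for X using that unfolding lift_def by blast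
  have gl: "?g (lift X) = ?f X" if X: "X \<subseteq> E" for X
    using g[OF lift_sub[OF X]] unfolding partial_def full_lift[OF X] by simp
  show ?thesis
    unfolding gorenstein_block_def
  proof (intro conjI allI impI)
    show "?g {} = 0" using gl[of "{}"] D(1) by (simp add: lift_def)
    show "?g (lift E) = 0" using gl[of E] D(2) by simp
    fix A assume A: "A \<noteq> {}" "A \<subset> lift E"
    have AE: "A \<subseteq> lift E" using A(2) by simp
    have fA: "finite A" using finite_subset[OF AE finite_lift[OF order_refl]] .
    have "1 \<le> ?g A \<and> (?g A = 1 \<or> splits_inside ?g A \<or> splits_outside ?g (lift E) A)"
    proof (cases "partial A = {}")
      case True
      define X where "X = full A"
      have AX: "A = lift X" using True lift_full[of A] unfolding partial_def X_def by blast
      have X: "X \<noteq> {}" "X \<subset> E" using A AX full_subset[of A] unfolding X_def lift_def by auto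
      have XE: "X \<subseteq> E" using X by simp
      consider "?f X = 1" | "splits_inside ?f X" | "splits_outside ?f E X" using D(4)[OF X] by blast
      then show ?thesis
      proof cases
        case 1
        then show ?thesis using gl[OF XE] AX by simp
      next
        case 2
        then obtain S S' where S: "S \<noteq> {}" "S' \<noteq> {}" "S \<inter> S' = {}" "S \<union> S' = X" "?f S + ?f S' = ?f X"
          unfolding splits_inside_def by blast
        have SE: "S \<subseteq> E" "S' \<subseteq> E" using S(4) XE by blast+
        have "splits_inside ?g A"
          unfolding splits_inside_def
        proof (intro exI conjI)
          show "lift S \<noteq> {}" "lift S' \<noteq> {}" using lift_nonempty SE S(1,2) by simp_all
          show "lift S \<inter> lift S' = {}" using lift_Int[OF SE] S(3) by (simp add: lift_def)
          show "lift S \<union> lift S' = A" using lift_Un[of S S'] S(4) AX by simp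
          show "?g (lift S) + ?g (lift S') = ?g A" using gl[OF SE(1)] gl[OF SE(2)] gl[OF XE] S(5) AX by simp
        qed
        then show ?thesis using gl[OF XE] D(3)[OF X] AX by simp
      next
        case 3
        then obtain S S' where S: "S \<subset> E" "S' \<subset> E" "S \<inter> S' = X" "S \<union> S' = E" "?f S + ?f S' = ?f X"
          unfolding splits_outside_def by blast
        have SE: "S \<subseteq> E" "S' \<subseteq> E" using S(1,2) by blast+
        have proper: "lift Y \<subset> lift E" if "Y \<subset> E" for Y
        proof -
          have YE: "Y \<subseteq> E" using that by (rule psubset_imp_subset)
          have "lift Y \<noteq> lift E"
          proof
            assume "lift Y = lift E"
            then have "full (lift Y) = full (lift E)" by (rule arg_cong)
            then show False using that unfolding full_lift[OF YE] full_lift[OF order_refl] by simp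
          qed
          then show ?thesis using lift_sub[OF YE] by (rule psubsetI[rotated])
        qed
        have "splits_outside ?g (lift E) A"
          unfolding splits_outside_def
        proof (intro exI conjI)
          show "lift S \<subset> lift E" "lift S' \<subset> lift E" using proper S(1,2) by blast+
          show "lift S \<inter> lift S' = A" using lift_Int[OF SE] S(3) AX by simp
          show "lift S \<union> lift S' = lift E" using lift_Un[of S S'] S(4) by simp
          show "?g (lift S) + ?g (lift S') = ?g A" using gl[OF SE(1)] gl[OF SE(2)] gl[OF XE] S(5) AX by simp
        qed
        then show ?thesis using gl[OF XE] D(3)[OF X] AX by simp
      qed
    next
      case False
      then obtain q where q: "q \<in> partial A" by blast
      have qA: "q \<in> A" using q unfolding partial_def by blast
      have fp: "finite (partial A)" using fA unfolding partial_def by simp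
      have "0 \<le> ?f (full A)" by (rule D(5)[OF full_subset])
      moreover have "1 \<le> card (partial A)" using False fp by (simp add: Suc_le_eq card_gt_0_iff)
      ultimately have ge: "1 \<le> ?g A" using g[OF AE] by linarith
      have qn: "q \<notin> fib e" if "e \<in> full A" for e using q that unfolding partial_def lift_def by blast
      have fq: "full {q} = {}"
      proof -
        have False if e: "e \<in> full {q}" for e
        proof -
          have "e \<in> full A" "fib e \<subseteq> {q}" "e \<in> E" using e qA unfolding full_def by auto
          then show False using qn[of e] fib(2)[of e] by blast
        qed
        then show ?thesis by blast
      qed
      have gq: "?g {q} = 1"
      proof -
        have "{q} \<subseteq> lift E" using qA AE by blast
        moreover have "partial {q} = {q}" unfolding partial_def fq by (simp add: lift_def)
        ultimately show ?thesis using g[of "{q}"] fq D(1) by simp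
      qed
      show ?thesis
      proof (cases "A = {q}")
        case True
        then show ?thesis using gq by simp
      next
        case False
        have f1: "full (A - {q}) = full A"
        proof
          show "full (A - {q}) \<subseteq> full A" unfolding full_def by blast
          show "full A \<subseteq> full (A - {q})" using qn unfolding full_def by blast
        qed
        have "partial (A - {q}) = partial A - {q}" unfolding partial_def f1 by blast
        then have "card (partial A) = Suc (card (partial (A - {q})))"
          using card_Suc_Diff1[OF fp q] by simp
        then have "?g A = 1 + ?g (A - {q})"
          using g[OF AE] g[OF order_trans[OF Diff_subset AE], of "{q}"] f1 by simp
        then have "splits_inside ?g A"
          unfolding splits_inside_def using gq False qA A(1)
          by (intro exI[of _ "{q}"] exI[of _ "A - {q}"]) auto
        then show ?thesis using ge by blast
      qed
    qed
    then show "1 \<le> ?g A" "?g A = 1 \<or> splits_inside ?g A \<or> splits_outside ?g (lift E) A" by auto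
  qed
qed

lemma ext_circuit_fibre:
  assumes C: "C \<in> circuits (matroid_of_rank (lift E) ext_rank)" and e: "e \<in> E"
  shows "fib e \<inter> C = {} \<or> fib e \<subseteq> C"
proof (rule ccontr)
  assume "\<not> ?thesis"
  then obtain x y where xy: "x \<in> fib e" "x \<in> C" "y \<in> fib e" "y \<notin> C" by blast
  have CE: "C \<subseteq> lift E" using C by (auto simp: circuits_def matroid_of_rank_def)
  have fC: "finite C" using finite_subset[OF CE finite_lift[OF order_refl]] .
  have dep: "ext_rank C \<noteq> card C" using C CE by (auto simp: circuits_def matroid_of_rank_def)
  have "C - {x} \<subset> C" using xy(2) by blast
  moreover have "\<forall>D. D \<subset> C \<longrightarrow> D \<in> indeps (matroid_of_rank (lift E) ext_rank)"
    using C unfolding circuits_def by blast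
  ultimately have "C - {x} \<in> indeps (matroid_of_rank (lift E) ext_rank)" by blast
  then have ind: "ext_rank (C - {x}) = card (C - {x})" by (simp add: matroid_of_rank_def)
  have "fib e' \<subseteq> C - {x}" if e': "e' \<in> E" "fib e' \<subseteq> C" for e'
  proof -
    have "e' \<noteq> e" using e'(2) xy(3,4) by blast
    then show ?thesis using fib_unique[OF e'(1) e _ xy(1)] e'(2) by blast
  qed
  then have "full C = full (C - {x})" unfolding full_def by blast
  moreover have "nullity (full (C - {x})) = 0"
    using int_ext_rank[of "C - {x}"] ind fC by simp
  ultimately show False using dep int_ext_rank[OF fC] by simp
qed


lemma ground_ext [simp]: "ground (matroid_of_rank (lift E) ext_rank) = lift E"
  by (simp add: matroid_of_rank_def)

text \<open>The element \<open>e\<close> has slack \<open>\<delta> - 1 > 1\<close>, so it splits, and a single element can only split from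
  the outside. Such a splitting separates the contraction of the fibre.\<close>

lemma fibre_good_ear:
  assumes card: "\<And>e. e \<in> E \<Longrightarrow> int (card (fib e)) = int \<delta> - v e"
    and block: "gorenstein_block (slack \<delta> v r) E" and d: "2 < \<delta>"
    and e: "e \<in> E" "v e = 1" "r {e} = 1" and card2: "2 \<le> card E"
  shows "good_ear (matroid_of_rank (lift E) ext_rank) (\<delta> - 1) (fib e)"
proof -
  let ?N = "matroid_of_rank (lift E) ext_rank"
  let ?f = "slack \<delta> v r" and ?g = "slack \<delta> (\<lambda>_. int \<delta> - 1) ext_rank"
  have N: "is_matroid ?N" by (rule is_matroid_matroid_of_rank[OF rank_function_ext_rank])
  have rk: "rk ?N A = ext_rank A" if "A \<subseteq> lift E" for A
    by (rule rk_matroid_of_rank[OF rank_function_ext_rank that])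
  have fE: "fib e \<subseteq> lift E" using e(1) unfolding lift_def by blast
  have fe: "lift {e} = fib e" by (simp add: lift_def)
  have ear: "is_ear ?N (\<delta> - 1) (fib e)"
    unfolding is_ear_def
  proof (intro conjI ballI)
    show "fib e \<subseteq> ground ?N" using fE by simp
    show "finite (fib e)" by (rule fib(1)[OF e(1)])
    show "card (fib e) = \<delta> - 1" using card[OF e(1)] e(2) by simp
    show "fib e \<inter> C = {} \<or> fib e \<subseteq> C" if "C \<in> circuits ?N" for C by (rule ext_circuit_fibre[OF that e(1)])
  qed
  have lift_sub: "lift X \<subseteq> lift E" if "X \<subseteq> E" for X using that unfolding lift_def by blast
  have gl: "?g (lift X) = ?f X" if X: "X \<subseteq> E" for X
    using slack_ext_rank[OF card lift_sub[OF X]] unfolding partial_def full_lift[OF X] by simp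
  have ne: "E \<noteq> {e}" using card2 by auto
  have eE: "{e} \<noteq> {}" "{e} \<subset> E" using e(1) ne by blast+
  have "?f {e} \<noteq> 1" using e(2,3) d by (simp add: slack_def)
  moreover have "\<not> splits_inside ?f {e}"
    unfolding splits_inside_def by (metis Un_singleton_iff inf.idem)
  ultimately have "splits_outside ?f E {e}" using gorenstein_blockD(4)[OF block eE] by blast
  then obtain S S' where S: "S \<subset> E" "S' \<subset> E" "S \<inter> S' = {e}" "S \<union> S' = E" "?f S + ?f S' = ?f {e}"
    unfolding splits_outside_def by blast
  have SE: "S \<subseteq> E" "S' \<subseteq> E" using S(1,2) by blast+
  have nS: "S \<noteq> {e}" "S' \<noteq> {e}" using S by blast+
  have lS: "lift S \<inter> lift S' = fib e" "lift S \<union> lift S' = lift E"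
    using lift_Int[OF SE] lift_Un[of S S'] S(3,4) fe by simp_all
  have fin: "finite (lift S)" "finite (lift S')" using finite_lift SE by simp_all
  have "?g (lift S) + ?g (lift S') = ?g (lift S \<union> lift S') + ?g (lift S \<inter> lift S')"
    using gl[OF SE(1)] gl[OF SE(2)] gl[of "{e}"] gl[of E] e(1) S(5) gorenstein_blockD(2)[OF block]
    unfolding lS fe by simp
  then have mod: "ext_rank (lift S) + ext_rank (lift S') = ext_rank (lift E) + ext_rank (fib e)"
    using slack_modular_iff[OF fin, of \<delta>] d unfolding lS by auto
  let ?X = "lift S - fib e"
  have K: "fib e \<subseteq> ground ?N" using fE by simp
  have rkC: "rk (contraction ?N (fib e)) A = ext_rank (A \<union> fib e) - ext_rank (fib e)" if "A \<subseteq> lift E - fib e" for A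
  proof -
    have "A \<union> fib e \<subseteq> lift E" using that fE by blast
    then show ?thesis using rk_contraction[OF N K, of A] that rk[OF fE] rk[of "A \<union> fib e"] by simp
  qed
  have mono: "ext_rank (fib e) \<le> ext_rank (lift X)" if "e \<in> X" "X \<subseteq> E" for X
    by (rule rank_function_mono[OF rank_function_ext_rank]) (use that in \<open>auto simp: lift_def\<close>)
  have "\<not> connected_matroid (contraction ?N (fib e))"
    unfolding not_connected_matroid_iff[OF is_matroid_contraction[OF N K]]
  proof (intro exI conjI)
    have "\<not> lift S \<subseteq> fib e"
    proof
      assume "lift S \<subseteq> fib e"
      then have "lift S = lift {e}" using lS(1) fe by blast
      then have "full (lift S) = full (lift {e})" by (rule arg_cong)
      then show False using full_lift[OF SE(1)] full_lift[of "{e}"] e(1) nS(1) by simp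
    qed
    then show "?X \<noteq> {}" by blast
    have "\<not> lift S' \<subseteq> fib e"
    proof
      assume "lift S' \<subseteq> fib e"
      then have "lift S' = lift {e}" using lS(1) fe by blast
      then have "full (lift S') = full (lift {e})" by (rule arg_cong)
      then show False using full_lift[OF SE(2)] full_lift[of "{e}"] e(1) nS(2) by simp
    qed
    then show "?X \<subset> ground (contraction ?N (fib e))" using lS by auto
    have e1: "?X \<union> fib e = lift S" "(lift E - fib e - ?X) \<union> fib e = lift S'" "(lift E - fib e) \<union> fib e = lift E"
      using lS fE by auto
    have eS: "e \<in> S" "e \<in> S'" using S(3) by blast+
    have "rk (contraction ?N (fib e)) ?X = ext_rank (lift S) - ext_rank (fib e)"
      using rkC[of ?X] e1(1) lS(2) by auto
    moreover have "rk (contraction ?N (fib e)) (lift E - fib e - ?X) = ext_rank (lift S') - ext_rank (fib e)"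
      using rkC[of "lift E - fib e - ?X"] e1(2) by auto
    moreover have "rk (contraction ?N (fib e)) (lift E - fib e) = ext_rank (lift E) - ext_rank (fib e)"
      using rkC[of "lift E - fib e"] e1(3) by simp
    ultimately show "rk (contraction ?N (fib e)) ?X
        + rk (contraction ?N (fib e)) (ground (contraction ?N (fib e)) - ?X)
      = rk (contraction ?N (fib e)) (ground (contraction ?N (fib e)))"
      using mod mono[OF eS(1) SE(1)] mono[OF eS(2) SE(2)] by simp
  qed
  then show ?thesis unfolding good_ear_def using ear by blast
qed

text \<open>The fibres contained in the union of the contracted elements and a set of kept elements are the fibres of these elements,
  so the nullity of this union is the original one.\<close>

lemma contracted_extension_iso:
  assumes T: "T \<subseteq> E" and single: "\<And>e. e \<in> E - T \<Longrightarrow> card (fib e) = 1"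
    and rho: "\<And>e. e \<in> E \<Longrightarrow> \<rho> (fib e) \<in> fib e"
  shows "matroid_iso (matroid_of_rank E r)
    (contraction (matroid_of_rank (lift E) ext_rank) (\<Union>A\<in>fib ` T. A - {\<rho> A}))"
proof -
  let ?N = "matroid_of_rank (lift E) ext_rank"
  let ?K = "\<Union>A\<in>fib ` T. A - {\<rho> A}"
  define \<phi> where "\<phi> e = \<rho> (fib e)" for e
  have phi: "\<phi> e \<in> fib e" if "e \<in> E" for e using rho[OF that] by (simp add: \<phi>_def)
  have N: "is_matroid ?N" by (rule is_matroid_matroid_of_rank[OF rank_function_ext_rank])
  have KE: "?K \<subseteq> lift E" using T unfolding lift_def by blast
  then have K: "?K \<subseteq> ground ?N" by simp
  have finK: "finite ?K" using finite_subset[OF KE finite_lift[OF order_refl]] .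
  have fibK: "fib e \<inter> ?K = fib e - {\<phi> e}" if e: "e \<in> E" for e
  proof
    show "fib e \<inter> ?K \<subseteq> fib e - {\<phi> e}"
    proof
      fix x assume "x \<in> fib e \<inter> ?K"
      then obtain e' where e': "x \<in> fib e" "e' \<in> T" "x \<in> fib e'" "x \<noteq> \<rho> (fib e')" by blast
      then have "e' = e" using fib_unique[of e' e x] T e by blast
      then show "x \<in> fib e - {\<phi> e}" using e' by (simp add: \<phi>_def)
    qed
    show "fib e - {\<phi> e} \<subseteq> fib e \<inter> ?K"
    proof
      fix x assume x: "x \<in> fib e - {\<phi> e}"
      have "e \<in> T"
      proof (rule ccontr)
        assume "e \<notin> T"
        then have "card (fib e) = 1" using single e by blast
        then obtain y where "fib e = {y}" by (auto simp: card_1_singleton_iff)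
        then show False using x phi[OF e] by simp
      qed
      then show "x \<in> fib e \<inter> ?K" using x by (auto simp: \<phi>_def)
    qed
  qed
  have bij: "bij_betw \<phi> E (lift E - ?K)"
    unfolding bij_betw_def
  proof
    show "inj_on \<phi> E"
    proof (rule inj_onI)
      fix e e' assume "e \<in> E" "e' \<in> E" "\<phi> e = \<phi> e'"
      then show "e = e'" using fib_unique[of e e' "\<phi> e"] phi[of e] phi[of e'] by simp
    qed
    show "\<phi> ` E = lift E - ?K"
    proof
      show "\<phi> ` E \<subseteq> lift E - ?K"
      proof
        fix x assume "x \<in> \<phi> ` E"
        then obtain e where e: "e \<in> E" "x = \<phi> e" by blast
        then show "x \<in> lift E - ?K" using phi[OF e(1)] fibK[OF e(1)] unfolding lift_def by blast
      qed
      show "lift E - ?K \<subseteq> \<phi> ` E"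
      proof
        fix x assume x: "x \<in> lift E - ?K"
        then obtain e where e: "e \<in> E" "x \<in> fib e" unfolding lift_def by blast
        then have "x = \<phi> e" using x fibK[OF e(1)] by blast
        then show "x \<in> \<phi> ` E" using e(1) by blast
      qed
    qed
  qed
  have fullK: "full (\<phi> ` X \<union> ?K) = X" if X: "X \<subseteq> E" for X
  proof
    show "full (\<phi> ` X \<union> ?K) \<subseteq> X"
    proof
      fix e assume e: "e \<in> full (\<phi> ` X \<union> ?K)"
      then have eE: "e \<in> E" "\<phi> e \<in> \<phi> ` X \<union> ?K" using phi unfolding full_def by blast+
      have "\<phi> e \<notin> ?K" using fibK[OF eE(1)] phi[OF eE(1)] by blast
      then obtain e' where e': "e' \<in> X" "\<phi> e = \<phi> e'" using eE(2) by blast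
      then have "e = e'" using bij X eE(1) unfolding bij_betw_def inj_on_def by blast
      then show "e \<in> X" using e' by simp
    qed
    show "X \<subseteq> full (\<phi> ` X \<union> ?K)"
    proof
      fix e assume e: "e \<in> X"
      then have "fib e - {\<phi> e} \<subseteq> ?K" using fibK X by blast
      then have "fib e \<subseteq> insert (\<phi> e) ?K" by (simp only: Diff_subset_conv Un_insert_left Un_empty_left)
      also have "\<dots> \<subseteq> \<phi> ` X \<union> ?K" using e by simp
      finally show "e \<in> full (\<phi> ` X \<union> ?K)" using subsetD[OF X e] unfolding full_def by simp
    qed
  qed
  have "X \<in> indeps (matroid_of_rank E r) \<longleftrightarrow> \<phi> ` X \<in> indeps (contraction ?N ?K)" if X: "X \<subseteq> E" for X
  proof -
    have inj: "inj_on \<phi> X" using bij X unfolding bij_betw_def by (blast intro: inj_on_subset)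
    have img: "\<phi> ` X \<subseteq> lift E - ?K" using bij X unfolding bij_betw_def by blast
    have fX: "finite (\<phi> ` X)" using finite_subset[OF X finE] by simp
    have sub: "\<phi> ` X \<union> ?K \<subseteq> lift E" using img KE by blast
    have "card (\<phi> ` X \<union> ?K) = card X + card ?K"
      using card_Un_disjoint[OF fX finK] img card_image[OF inj] by auto
    then have "int (ext_rank (\<phi> ` X \<union> ?K)) = int (card X) + int (card ?K) - (int (card X) - int (r X))"
      using int_ext_rank[of "\<phi> ` X \<union> ?K"] fX finK fullK[OF X] int_nullity[OF X] by simp
    then have 1: "ext_rank (\<phi> ` X \<union> ?K) = card ?K + r X" by linarith
    have "full ?K = {}" using fullK[of "{}"] by simp
    then have 2: "ext_rank ?K = card ?K"
      unfolding ext_rank_def by (simp add: nullity_def)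
    have "rk (contraction ?N ?K) (\<phi> ` X) = r X"
      using rk_contraction[OF N K] img rk_matroid_of_rank[OF rank_function_ext_rank sub]
        rk_matroid_of_rank[OF rank_function_ext_rank KE] 1 2 by simp
    then have "\<phi> ` X \<in> indeps (contraction ?N ?K) \<longleftrightarrow> r X = card X"
      using indep_iff_rk[OF is_matroid_contraction[OF N K], of "\<phi> ` X"] img card_image[OF inj] by simp
    then show ?thesis using X by (simp add: matroid_of_rank_def)
  qed
  then show ?thesis
    unfolding matroid_iso_def using bij
    by (intro exI[of _ \<phi>]) (simp add: matroid_of_rank_def)
qed

end

text \<open>The fibre of \<open>e\<close> has \<open>\<delta> - v e\<close> elements, that is, \<open>\<delta> - 1\<close> elements if \<open>v e = 1\<close> and a single one if
  \<open>v e = \<delta> - 1\<close>.\<close>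

lemma block_is_contracted_G'_matroid:
  fixes r :: "'e::finite set \<Rightarrow> nat"
  assumes R: "rank_function E r" and block: "gorenstein_block (slack \<delta> v r) E"
    and card2: "2 \<le> card E" and d: "2 < \<delta>"
  shows "G'_matroid_good_ears_contracted \<delta> (matroid_of_rank E r)"
proof -
  note val = block_element_value[OF R block card2]
  obtain \<iota> :: "'e \<Rightarrow> nat" where \<iota>: "inj \<iota>" using finite_imp_inj_to_nat_seg[of "UNIV :: 'e set"] by auto
  define fib where "fib e = (\<lambda>i. prod_encode (\<iota> e, i)) ` {..<nat (int \<delta> - v e)}" for e
  have fib_card: "card (fib e) = nat (int \<delta> - v e)" for e
    unfolding fib_def by (subst card_image) (auto intro: inj_onI)
  interpret series_extension E r fib
  proof
    show "rank_function E r" by (rule R)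
    show "finite (fib e)" for e unfolding fib_def by simp
    show "fib e \<noteq> {}" if "e \<in> E" for e unfolding fib_def using val(3)[OF that] by (simp add: lessThan_empty_iff)
    show "fib e \<inter> fib e' = {}" if "e \<noteq> e'" for e e'
      unfolding fib_def using \<iota> that by (auto dest: injD)
  qed
  have card: "int (card (fib e)) = int \<delta> - v e" if "e \<in> E" for e
    using fib_card[of e] val(3)[OF that] by simp
  let ?N = "matroid_of_rank (lift E) ext_rank"
  have cardL: "2 \<le> card (lift E)"
  proof -
    have "(\<Sum>e\<in>E. 1) \<le> (\<Sum>e\<in>E. card (fib e))"
    proof (rule sum_mono)
      fix e assume "e \<in> E"
      then show "1 \<le> card (fib e)" using fib_card[of e] val(3)[of e] by simp
    qed
    then have "card E \<le> card (lift E)" unfolding card_lift[OF order_refl] by simp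
    then show ?thesis using card2 by simp
  qed
  interpret N: uniform_block \<delta> "lift E" ext_rank
    by standard (use d rank_function_ext_rank cardL ext_block[OF card block] in auto)
  have G: "G'_matroid \<delta> ?N"
    unfolding G'_matroid_def using N.G'_family_flacets N.family_matroid_flacets by metis
  define T where "T = {e \<in> E. v e = 1}"
  define \<rho> where "\<rho> A = (SOME x. x \<in> A)" for A :: "nat set"
  have rho: "\<rho> (fib e) \<in> fib e" if "e \<in> E" for e
    unfolding \<rho>_def using fib(2)[OF that] by (simp add: some_in_eq)
  have "good_ears_contracted (\<delta> - 1) ?N (contraction ?N (\<Union>A\<in>fib ` T. A - {\<rho> A}))"
    unfolding good_ears_contracted_def
  proof (intro exI[of _ "fib ` T"] exI[of _ \<rho>] conjI ballI refl)
    show "disjoint (fib ` T)"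
    proof (rule disjointI)
      fix A B assume "A \<in> fib ` T" "B \<in> fib ` T" "A \<noteq> B"
      then obtain e e' where "e \<in> T" "e' \<in> T" "A = fib e" "B = fib e'" "e \<noteq> e'" by blast
      then show "A \<inter> B = {}" using fib_disjoint[of e e'] unfolding T_def by blast
    qed
    fix A assume "A \<in> fib ` T"
    then obtain e where e: "e \<in> E" "v e = 1" "A = fib e" unfolding T_def by blast
    show "good_ear ?N (\<delta> - 1) A"
      unfolding e(3) by (rule fibre_good_ear[OF card block d e(1,2) val(1)[OF e(1)] card2])
    show "\<rho> A \<in> A" unfolding e(3) by (rule rho[OF e(1)])
  qed
  moreover have "matroid_iso (matroid_of_rank E r) (contraction ?N (\<Union>A\<in>fib ` T. A - {\<rho> A}))"
  proof (rule contracted_extension_iso[OF _ _ rho])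
    show "T \<subseteq> E" unfolding T_def by blast
    show "card (fib e) = 1" if "e \<in> E - T" for e
      using fib_card[of e] val(4)[of e] that unfolding T_def by auto
  qed
  ultimately show ?thesis
    unfolding G'_matroid_good_ears_contracted_def using G by blast
qed

section \<open>Contracting good ears\<close>

lemma dependent_contains_circuit:
  assumes D: "D \<subseteq> ground M" "D \<notin> indeps M" and fin: "finite (ground M)"
  obtains C where "C \<in> circuits M" "C \<subseteq> D"
proof -
  let ?Q = "\<lambda>C. C \<subseteq> D \<and> C \<notin> indeps M"
  have "\<exists>C. ?Q C \<and> (\<forall>C'. ?Q C' \<longrightarrow> card C \<le> card C')"
    by (rule ex_has_least_nat[where P = ?Q and k = D]) (use D in blast)
  then obtain C where C: "C \<subseteq> D" "C \<notin> indeps M" and min: "\<And>C'. ?Q C' \<Longrightarrow> card C \<le> card C'" by blast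
  have fC: "finite C" using finite_subset[OF order_trans[OF C(1) D(1)] fin] .
  have "C' \<in> indeps M" if C': "C' \<subset> C" for C'
  proof (rule ccontr)
    assume n: "C' \<notin> indeps M"
    have "card C \<le> card C'" by (rule min) (use n C' C(1) in blast)
    then show False using psubset_card_mono[OF fC C'] by simp
  qed
  then have "C \<in> circuits M" unfolding circuits_def using C D(1) by blast
  then show ?thesis using that C(1) by blast
qed

text \<open>Otherwise \<open>x\<close> would lie in a circuit contained in \<open>insert x X\<close>, and this circuit would have to contain
  the whole ear.\<close>

lemma ear_in_series:
  assumes M: "is_matroid M" and ear: "is_ear M s A" and xy: "x \<in> A" "y \<in> A" "x \<noteq> y"
    and X: "X \<subseteq> ground M" "x \<notin> X" "y \<notin> X"
  shows "rk M (insert x X) = Suc (rk M X)"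
proof (rule ccontr)
  assume n: "\<not> ?thesis"
  have xM: "x \<in> ground M" using ear xy(1) unfolding is_ear_def by blast
  have eq: "rk M (insert x X) = rk M X"
    using n rk_insert_le[OF M, of x X] rk_mono[OF M subset_insertI, of X x] by simp
  obtain I where I: "I \<in> indeps M" "I \<subseteq> X" "card I = rk M X" using rk_obtain[OF M] .
  have "insert x I \<notin> indeps M"
  proof
    assume "insert x I \<in> indeps M"
    then have "card (insert x I) \<le> rk M (insert x X)" using rk_ge[OF M] I(2) by blast
    moreover have "x \<notin> I" using I(2) X(2) by blast
    ultimately show False using eq I(3) matroidD(6)[OF M I(1)] by simp
  qed
  moreover have "insert x I \<subseteq> ground M" using xM I(2) X(1) by blast
  ultimately obtain C where C: "C \<in> circuits M" "C \<subseteq> insert x I"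
    using dependent_contains_circuit[of "insert x I" M] matroidD(1)[OF M] by blast
  have "x \<in> C"
  proof (rule ccontr)
    assume "x \<notin> C"
    then have "C \<in> indeps M" using C(2) matroidD(4)[OF M I(1)] by blast
    then show False using C(1) unfolding circuits_def by blast
  qed
  then have "A \<subseteq> C" using ear C(1) xy(1) unfolding is_ear_def by blast
  then show False using C(2) I(2) xy X(3) by blast
qed

text \<open>A separation of the contraction of the ear, with the ear added to both sides.\<close>

lemma good_ear_splits:
  assumes M: "is_matroid M" and good: "good_ear M s A"
  obtains S S' where "S \<subset> ground M" "S' \<subset> ground M" "S \<inter> S' = A" "S \<union> S' = ground M"
    "rk M S + rk M S' = rk M (ground M) + rk M A"
proof -
  let ?E = "ground M"
  have A: "A \<subseteq> ?E" using good unfolding good_ear_def is_ear_def by blast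
  have "\<not> connected_matroid (contraction M A)" using good unfolding good_ear_def by blast
  then obtain X where X: "X \<noteq> {}" "X \<subset> ?E - A"
    "rk (contraction M A) X + rk (contraction M A) (?E - A - X) = rk (contraction M A) (?E - A)"
    unfolding not_connected_matroid_iff[OF is_matroid_contraction[OF M A]] by auto
  have e: "(?E - A - X) \<union> A = ?E - X" "(?E - A) \<union> A = ?E" using A X(2) by auto
  have "rk M (X \<union> A) - rk M A + (rk M (?E - X) - rk M A) = rk M ?E - rk M A"
    using X(3) rk_contraction[OF M A, of X] rk_contraction[OF M A, of "?E - A - X"]
      rk_contraction[OF M A, of "?E - A"] X(2) e by auto
  moreover have "rk M A \<le> rk M (X \<union> A)" "rk M A \<le> rk M (?E - X)" "rk M A \<le> rk M ?E"
    by (rule rk_mono[OF M]; use A X(2) in blast)+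
  ultimately have "rk M (X \<union> A) + rk M (?E - X) = rk M ?E + rk M A" by linarith
  moreover have "X \<union> A \<subset> ?E" "?E - X \<subset> ?E" "(X \<union> A) \<inter> (?E - X) = A" "(X \<union> A) \<union> (?E - X) = ?E"
    using A X(1,2) by auto
  ultimately show ?thesis using that[of "X \<union> A" "?E - X"] by blast
qed

text \<open>A uniform Gorenstein block with disjoint good ears, described by ranks: the elements of an ear are
  in series, and the ear splits from the outside. The element \<open>\<rho> A\<close> of the ear \<open>A\<close> is kept.\<close>

locale ears_in_block =
  fixes \<delta> :: nat and E :: "'a set" and r :: "'a set \<Rightarrow> nat" and \<A> :: "'a set set" and \<rho> :: "'a set \<Rightarrow> 'a"
  assumes d: "2 < \<delta>" and R: "rank_function E r"
    and block: "gorenstein_block (slack \<delta> (\<lambda>_. int \<delta> - 1) r) E"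
    and ears_disjoint: "disjoint \<A>"
    and ear: "\<And>A. A \<in> \<A> \<Longrightarrow> A \<subseteq> E" "\<And>A. A \<in> \<A> \<Longrightarrow> card A = \<delta> - 1"
    and series: "\<And>A x y X. A \<in> \<A> \<Longrightarrow> x \<in> A \<Longrightarrow> y \<in> A \<Longrightarrow> x \<noteq> y \<Longrightarrow> X \<subseteq> E \<Longrightarrow> x \<notin> X \<Longrightarrow> y \<notin> X \<Longrightarrow>
      r (insert x X) = Suc (r X)"
    and good: "\<And>A. A \<in> \<A> \<Longrightarrow> \<exists>S S'. S \<subset> E \<and> S' \<subset> E \<and> S \<inter> S' = A \<and> S \<union> S' = E \<and> r S + r S' = r E + r A"
    and rho: "\<And>A. A \<in> \<A> \<Longrightarrow> \<rho> A \<in> A"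
begin

abbreviation f where "f \<equiv> slack \<delta> (\<lambda>_. int \<delta> - 1) r"

lemma finE: "finite E"
  using rank_functionD(1)[OF R] .

lemma finite_sub: "X \<subseteq> E \<Longrightarrow> finite X"
  using finE finite_subset by blast

definition K where "K = (\<Union>A\<in>\<A>. A - {\<rho> A})"
definition E' where "E' = E - K"

definition saturated :: "'a set \<Rightarrow> bool" where
  "saturated Z \<longleftrightarrow> Z \<subseteq> E \<and> (\<forall>A\<in>\<A>. A \<subseteq> Z \<or> A \<inter> Z = {})"

text \<open>A set of remaining elements together with the contracted elements of the ears that it meets.\<close>

definition up :: "'a set \<Rightarrow> 'a set" where
  "up D = D \<union> \<Union>{A \<in> \<A>. \<rho> A \<in> D}"

lemma ear_unique: "A \<in> \<A> \<Longrightarrow> B \<in> \<A> \<Longrightarrow> x \<in> A \<Longrightarrow> x \<in> B \<Longrightarrow> A = B"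
  using disjointD[OF ears_disjoint] by blast

lemma KE: "K \<subseteq> E"
  unfolding K_def using ear(1) by blast

lemma rho_E': "A \<in> \<A> \<Longrightarrow> \<rho> A \<in> E'"
proof -
  assume A: "A \<in> \<A>"
  have "\<rho> A \<notin> K"
  proof
    assume "\<rho> A \<in> K"
    then obtain B where B: "B \<in> \<A>" "\<rho> A \<in> B" "\<rho> A \<noteq> \<rho> B" unfolding K_def by blast
    then show False using ear_unique[OF A B(1) rho[OF A]] by blast
  qed
  then show ?thesis unfolding E'_def using ear(1)[OF A] rho[OF A] by blast
qed

lemma ear_Int_E': "A \<in> \<A> \<Longrightarrow> A \<inter> E' = {\<rho> A}"
  using rho_E'[of A] rho[of A] unfolding E'_def K_def by blast

lemma not_E': "x \<in> E \<Longrightarrow> x \<notin> E' \<Longrightarrow> \<exists>A\<in>\<A>. x \<in> A \<and> x \<noteq> \<rho> A"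
  unfolding E'_def K_def by blast

lemma up_E: "D \<subseteq> E' \<Longrightarrow> up D \<subseteq> E"
  unfolding up_def using ear(1) E'_def by blast

lemma up_Int_E': "D \<subseteq> E' \<Longrightarrow> up D \<inter> E' = D"
proof -
  assume D: "D \<subseteq> E'"
  have "x \<in> D" if x: "x \<in> up D" "x \<in> E'" for x
  proof (rule ccontr)
    assume "x \<notin> D"
    then obtain A where A: "A \<in> \<A>" "\<rho> A \<in> D" "x \<in> A" using x(1) unfolding up_def by blast
    then have "x = \<rho> A" using ear_Int_E'[OF A(1)] x(2) by blast
    then show False using A(2) \<open>x \<notin> D\<close> by simp
  qed
  then show ?thesis using D unfolding up_def by blast
qed

lemma saturated_up: "D \<subseteq> E' \<Longrightarrow> saturated (up D)"
  unfolding saturated_def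
proof (intro conjI ballI)
  assume D: "D \<subseteq> E'"
  show "up D \<subseteq> E" by (rule up_E[OF D])
  fix A assume A: "A \<in> \<A>"
  show "A \<subseteq> up D \<or> A \<inter> up D = {}"
  proof (cases "\<rho> A \<in> D")
    case True
    then show ?thesis using A unfolding up_def by blast
  next
    case False
    have "x \<notin> up D" if x: "x \<in> A" for x
    proof
      assume "x \<in> up D"
      then consider "x \<in> D" | B where "B \<in> \<A>" "\<rho> B \<in> D" "x \<in> B" unfolding up_def by blast
      then show False
      proof cases
        case 1
        then have "x = \<rho> A" using ear_Int_E'[OF A] x D by blast
        then show False using 1 False by simp
      next
        case 2
        then have "B = A" using ear_unique[OF 2(1) A 2(3) x] by simp
        then show False using 2(2) False by simp
      qed
    qed
    then show ?thesis by blast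
  qed
qed

text \<open>Sets that do not cut any ear correspond to sets of remaining elements.\<close>

lemma up_saturated: "saturated Z \<Longrightarrow> up (Z \<inter> E') = Z"
proof -
  assume Z: "saturated Z"
  have "up (Z \<inter> E') \<subseteq> Z" using Z rho unfolding up_def saturated_def by blast
  moreover have "x \<in> up (Z \<inter> E')" if x: "x \<in> Z" for x
  proof (cases "x \<in> E'")
    case True
    then show ?thesis using x unfolding up_def by blast
  next
    case False
    have "x \<in> E" using Z x unfolding saturated_def by blast
    then obtain A where A: "A \<in> \<A>" "x \<in> A" using not_E'[OF _ False] by blast
    have "A \<subseteq> Z \<or> A \<inter> Z = {}" using Z A(1) unfolding saturated_def by blast
    then have "A \<subseteq> Z" using A(2) x by blast
    then have "\<rho> A \<in> Z \<inter> E'" using rho[OF A(1)] rho_E'[OF A(1)] by blast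
    then have "A \<in> {A \<in> \<A>. \<rho> A \<in> Z \<inter> E'}" using A(1) by simp
    then show ?thesis using A(2) unfolding up_def by blast
  qed
  ultimately show ?thesis by blast
qed

lemma saturated_E: "saturated E"
  unfolding saturated_def using ear(1) by blast

lemma saturated_ear: "A \<in> \<A> \<Longrightarrow> saturated A"
  unfolding saturated_def using ear(1) disjointD[OF ears_disjoint] by blast

text \<open>As long as some element of every ear concerned stays outside, adding elements of ears raises the rank
  by one each time.\<close>

lemma series_add:
  assumes "finite B" "B \<subseteq> E" "B \<inter> Y = {}" "Y \<subseteq> E"
    and "\<And>x. x \<in> B \<Longrightarrow> \<exists>A\<in>\<A>. \<exists>y\<in>A. x \<in> A \<and> y \<noteq> x \<and> y \<notin> Y \<union> B"
  shows "r (Y \<union> B) = r Y + card B"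
  using assms(1-3,5)
proof (induction B rule: finite_induct)
  case empty
  then show ?case by simp
next
  case (insert x B)
  have IH: "r (Y \<union> B) = r Y + card B"
  proof (rule insert.IH)
    show "B \<subseteq> E" "B \<inter> Y = {}" using insert.prems by blast+
    fix z assume "z \<in> B"
    then obtain A y where "A \<in> \<A>" "y \<in> A" "z \<in> A" "y \<noteq> z" "y \<notin> Y \<union> insert x B"
      using insert.prems(3)[of z] by blast
    then show "\<exists>A\<in>\<A>. \<exists>y\<in>A. z \<in> A \<and> y \<noteq> z \<and> y \<notin> Y \<union> B" by blast
  qed
  obtain A y where A: "A \<in> \<A>" "y \<in> A" "x \<in> A" "y \<noteq> x" "y \<notin> Y \<union> insert x B"
    using insert.prems(3)[of x] by blast
  have "r (insert x (Y \<union> B)) = Suc (r (Y \<union> B))"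
  proof (rule series[OF A(1,3,2) A(4)[symmetric]])
    show "Y \<union> B \<subseteq> E" using assms(4) insert.prems(1) by blast
    show "x \<notin> Y \<union> B" using insert.hyps(2) insert.prems(2) by blast
    show "y \<notin> Y \<union> B" using A(5) by blast
  qed
  then show ?case using IH insert.hyps by simp
qed

lemma f_series:
  assumes "A \<in> \<A>" "x \<in> A" "y \<in> A" "x \<in> S" "y \<notin> S" "S \<subseteq> E"
  shows "f S = f (S - {x}) + 1"
proof -
  have fin: "finite S" by (rule finite_sub[OF assms(6)])
  have "x \<noteq> y" using assms(4,5) by blast
  have "r (insert x (S - {x})) = Suc (r (S - {x}))"
    by (rule series[OF assms(1-3) \<open>x \<noteq> y\<close>]) (use assms(5,6) in blast)+
  moreover have "insert x (S - {x}) = S" using assms(4) by blast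
  moreover have "card S = Suc (card (S - {x}))" using card_Suc_Diff1[OF fin assms(4)] by simp
  ultimately show ?thesis unfolding slack_def by (simp add: algebra_simps)
qed

lemma f_sub: "A \<subseteq> E \<Longrightarrow> B \<subseteq> E \<Longrightarrow> f (A \<union> B) + f (A \<inter> B) \<le> f A + f B"
  using submodular_onD[OF slack_submodular[OF R]] .

lemma f_nonneg: "A \<subseteq> E \<Longrightarrow> 0 \<le> f A"
  by (rule gorenstein_blockD(5)[OF block])

text \<open>If \<open>S\<close> cut an ear, then removing an element of this ear from \<open>S\<close> would lower the slack by one and
  leave the intersection with \<open>S'\<close> as it is, which submodularity does not allow.\<close>

lemma outside_splitting_saturated:
  assumes Z: "saturated Z" and S: "S \<subseteq> E" "S' \<subseteq> E" "S \<inter> S' = Z" "S \<union> S' = E" "f S + f S' = f Z"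
  shows "saturated S"
  unfolding saturated_def
proof (intro conjI ballI)
  show "S \<subseteq> E" by (rule S(1))
  fix A assume A: "A \<in> \<A>"
  show "A \<subseteq> S \<or> A \<inter> S = {}"
  proof (rule ccontr)
    assume "\<not> ?thesis"
    then obtain x y where xy: "x \<in> A" "x \<in> S" "y \<in> A" "y \<notin> S" by blast
    have "A \<inter> Z = {}" using Z A xy(3,4) S(3) unfolding saturated_def by blast
    then have "x \<notin> S'" using xy(1,2) S(3) by blast
    then have "(S - {x}) \<inter> S' = Z" using S(3) by blast
    moreover have "f ((S - {x}) \<union> S') + f ((S - {x}) \<inter> S') \<le> f (S - {x}) + f S'"
      by (rule f_sub) (use S(1,2) in blast)+
    moreover have "0 \<le> f ((S - {x}) \<union> S')" by (rule f_nonneg) (use S(1,2) in blast)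
    moreover have "f S = f (S - {x}) + 1" by (rule f_series[OF A xy(1,3,2,4) S(1)])
    ultimately show False using S(5) by simp
  qed
qed

lemma outside_splitting_down:
  assumes D: "D \<subseteq> E'" and S: "S \<subset> E" "S' \<subset> E" "S \<inter> S' = up D" "S \<union> S' = E" "f S + f S' = f (up D)"
  shows "splits_outside (\<lambda>D. f (up D)) E' D"
proof -
  have SE: "S \<subseteq> E" "S' \<subseteq> E" using S(1,2) by blast+
  have sat: "saturated S" by (rule outside_splitting_saturated[OF saturated_up[OF D] SE S(3-5)])
  have sat': "saturated S'"
    by (rule outside_splitting_saturated[OF saturated_up[OF D] SE(2,1)])
      (use S in \<open>simp_all add: Int_commute Un_commute add.commute\<close>)
  have upE: "up E' = E" using up_saturated[OF saturated_E] unfolding E'_def by (simp add: Int_absorb1)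
  show ?thesis
    unfolding splits_outside_def
  proof (intro exI conjI)
    have "S \<inter> E' \<noteq> E'" using up_saturated[OF sat] upE S(1) by auto
    then show "S \<inter> E' \<subset> E'" by blast
    have "S' \<inter> E' \<noteq> E'" using up_saturated[OF sat'] upE S(2) by auto
    then show "S' \<inter> E' \<subset> E'" by blast
    have "(S \<inter> E') \<inter> (S' \<inter> E') = up D \<inter> E'" using S(3) by blast
    then show "(S \<inter> E') \<inter> (S' \<inter> E') = D" using up_Int_E'[OF D] by simp
    have "E' \<subseteq> E" unfolding E'_def by blast
    then show "(S \<inter> E') \<union> (S' \<inter> E') = E'" using S(4) by blast
    show "f (up (S \<inter> E')) + f (up (S' \<inter> E')) = f (up D)"
      unfolding up_saturated[OF sat] up_saturated[OF sat'] by (rule S(5))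
  qed
qed

text \<open>An inside splitting that cuts an ear makes all elements of the ear coloops of the restriction.\<close>

lemma ear_splits_off:
  assumes A: "A \<in> \<A>" "A \<subseteq> Z" and Z: "Z \<subseteq> E"
    and S: "S \<union> S' = Z" "S \<inter> S' = {}" "f S + f S' = f Z" and xy: "x \<in> A" "x \<in> S" "y \<in> A" "y \<notin> S"
  shows "f A + f (Z - A) = f Z"
proof -
  have SE: "S \<subseteq> E" "S' \<subseteq> E" "A \<subseteq> E" "Z - A \<subseteq> E" using S(1) Z A(2) by blast+
  have fA: "finite A" by (rule finite_sub[OF SE(3)])
  have f0: "f {} = 0" using gorenstein_blockD(1)[OF block] .
  have "f S = f (S - {x}) + 1" by (rule f_series[OF A(1) xy(1,3,2,4) SE(1)])
  moreover have "f (Z - {x}) \<le> f (S - {x}) + f S'"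
  proof -
    have "x \<notin> S'" using S(2) xy(2) by blast
    then have "(S - {x}) \<union> S' = Z - {x}" "(S - {x}) \<inter> S' = {}" using S(1,2) by blast+
    then show ?thesis using f_sub[of "S - {x}" S'] SE f0 by auto
  qed
  moreover have "f (Z - {x}) = f (Z - A) + (int \<delta> - 2)"
  proof -
    let ?B = "A - {x}"
    have u: "(Z - A) \<union> ?B = Z - {x}" using A(2) xy(1) by blast
    have cB: "card ?B = \<delta> - 2" using xy(1) fA ear(2)[OF A(1)] by simp
    have "r ((Z - A) \<union> ?B) = r (Z - A) + card ?B"
    proof (rule series_add)
      show "finite ?B" using fA by simp
      show "?B \<subseteq> E" "?B \<inter> (Z - A) = {}" "Z - A \<subseteq> E" using SE by blast+
      fix z assume z: "z \<in> ?B"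
      show "\<exists>B\<in>\<A>. \<exists>y\<in>B. z \<in> B \<and> y \<noteq> z \<and> y \<notin> (Z - A) \<union> ?B"
        by (rule bexI[OF _ A(1)], rule bexI[OF _ xy(1)]) (use z xy(1) in auto)
    qed
    moreover have "card ((Z - A) \<union> ?B) = card (Z - A) + card ?B"
      by (rule card_Un_disjoint) (use finite_sub[OF SE(4)] fA in auto)
    ultimately show ?thesis unfolding u slack_def using cB d by (simp add: algebra_simps of_nat_diff)
  qed
  moreover have "f A \<le> int \<delta> - 1"
  proof -
    have "r A \<le> \<delta> - 1" using rank_function_le_card[OF R SE(3)] ear(2)[OF A(1)] by simp
    then have "int \<delta> * int (r A) \<le> int \<delta> * (int \<delta> - 1)" using d by (intro mult_left_mono) auto
    then show ?thesis unfolding slack_def using ear(2)[OF A(1)] d by (simp add: of_nat_diff algebra_simps)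
  qed
  moreover have "f Z \<le> f A + f (Z - A)"
  proof -
    have "A \<union> (Z - A) = Z" "A \<inter> (Z - A) = {}" using A(2) by blast+
    then show ?thesis using f_sub[OF SE(3,4)] f0 by simp
  qed
  ultimately show ?thesis using S(3) by linarith
qed

text \<open>The only sets that could violate the conditions after the contraction are the single remaining
  elements of the ears, and these split from the outside since the ears are good.\<close>

lemma up_block: "gorenstein_block (\<lambda>D. f (up D)) E'"
  unfolding gorenstein_block_def
proof (intro conjI allI impI)
  note B = gorenstein_blockD[OF block]
  have "up {} = {}" unfolding up_def by blast
  then show "f (up {}) = 0" using B(1) by simp
  have upE: "up E' = E" using up_saturated[OF saturated_E] unfolding E'_def by (simp add: Int_absorb1)
  then show "f (up E') = 0" using B(2) by simp
  fix D assume D: "D \<noteq> {}" "D \<subset> E'"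
  have DE: "D \<subseteq> E'" using D(2) by blast
  have ne: "up D \<noteq> {}" using D(1) unfolding up_def by blast
  have "up D \<noteq> E" using up_Int_E'[OF DE] D(2) unfolding E'_def by blast
  then have pr: "up D \<subset> E" using up_E[OF DE] by blast
  show "1 \<le> f (up D)" by (rule B(3)[OF ne pr])
  show "f (up D) = 1 \<or> splits_inside (\<lambda>D. f (up D)) D \<or> splits_outside (\<lambda>D. f (up D)) E' D"
  proof (cases "\<exists>A\<in>\<A>. D = {\<rho> A}")
    case True
    then obtain A where A: "A \<in> \<A>" "D = {\<rho> A}" by blast
    have upD: "up D = A" using up_saturated[OF saturated_ear[OF A(1)]] ear_Int_E'[OF A(1)] A(2) by simp
    obtain S S' where S: "S \<subset> E" "S' \<subset> E" "S \<inter> S' = A" "S \<union> S' = E" "r S + r S' = r E + r A"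
      using good[OF A(1)] by blast
    have fin: "finite S" "finite S'" using finite_sub S(1,2) by blast+
    have "f S + f S' = f A"
      using slack_modular_iff[OF fin, of \<delta> "\<lambda>_. int \<delta> - 1" r] S(3-5) d B(2) by simp
    then have "splits_outside (\<lambda>D. f (up D)) E' D"
      by (intro outside_splitting_down[OF DE S(1,2)]) (use upD S in auto)
    then show ?thesis by blast
  next
    case False
    consider "f (up D) = 1" | "splits_inside f (up D)" | "splits_outside f E (up D)"
      using B(4)[OF ne pr] by blast
    then show ?thesis
    proof cases
      case 3
      then obtain S S' where S: "S \<subset> E" "S' \<subset> E" "S \<inter> S' = up D" "S \<union> S' = E" "f S + f S' = f (up D)"
        unfolding splits_outside_def by blast
      then show ?thesis using outside_splitting_down[OF DE S] by blast
    next
      case 2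
      then obtain S S' where S: "S \<noteq> {}" "S' \<noteq> {}" "S \<inter> S' = {}" "S \<union> S' = up D" "f S + f S' = f (up D)"
        unfolding splits_inside_def by blast
      have SE: "S \<subseteq> E" "S' \<subseteq> E" using S(4) pr by blast+
      have "splits_inside (\<lambda>D. f (up D)) D"
      proof (cases "saturated S")
        case True
        have sat': "saturated S'"
          unfolding saturated_def
        proof (intro conjI ballI)
          show "S' \<subseteq> E" by (rule SE(2))
          fix A assume A: "A \<in> \<A>"
          then have "A \<subseteq> S \<or> A \<inter> S = {}" "A \<subseteq> up D \<or> A \<inter> up D = {}"
            using True saturated_up[OF DE] unfolding saturated_def by blast+
          then show "A \<subseteq> S' \<or> A \<inter> S' = {}" using S(3,4) by blast
        qed
        show ?thesis
          unfolding splits_inside_def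
        proof (intro exI conjI)
          show "S \<inter> E' \<noteq> {}" using up_saturated[OF True] S(1) \<open>up {} = {}\<close> by auto
          show "S' \<inter> E' \<noteq> {}" using up_saturated[OF sat'] S(2) \<open>up {} = {}\<close> by auto
          show "(S \<inter> E') \<inter> (S' \<inter> E') = {}" using S(3) by blast
          have "(S \<inter> E') \<union> (S' \<inter> E') = up D \<inter> E'" using S(4) by blast
          then show "(S \<inter> E') \<union> (S' \<inter> E') = D" using up_Int_E'[OF DE] by simp
          show "f (up (S \<inter> E')) + f (up (S' \<inter> E')) = f (up D)"
            unfolding up_saturated[OF True] up_saturated[OF sat'] by (rule S(5))
        qed
      next
        case nsat: False
        then obtain A x y where A: "A \<in> \<A>" "x \<in> A" "x \<in> S" "y \<in> A" "y \<notin> S"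
          using SE(1) unfolding saturated_def by blast
        have AD: "A \<subseteq> up D"
          using saturated_up[OF DE] A(1-3) S(4) unfolding saturated_def by blast
        have sp: "f A + f (up D - A) = f (up D)"
          by (rule ear_splits_off[OF A(1) AD up_E[OF DE] S(4,3,5) A(2-5)])
        have rD: "\<rho> A \<in> D" using AD rho[OF A(1)] rho_E'[OF A(1)] up_Int_E'[OF DE] by blast
        have upA: "up {\<rho> A} = A" using up_saturated[OF saturated_ear[OF A(1)]] ear_Int_E'[OF A(1)] by simp
        have satD: "saturated (up D - A)"
          unfolding saturated_def
        proof (intro conjI ballI)
          show "up D - A \<subseteq> E" using up_E[OF DE] by blast
          fix B assume B: "B \<in> \<A>"
          have "B \<subseteq> up D \<or> B \<inter> up D = {}" using saturated_up[OF DE] B unfolding saturated_def by blast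
          moreover have "B = A \<or> B \<inter> A = {}" using disjointD[OF ears_disjoint B A(1)] by blast
          ultimately show "B \<subseteq> up D - A \<or> B \<inter> (up D - A) = {}" by blast
        qed
        have "(up D - A) \<inter> E' = D - {\<rho> A}" using up_Int_E'[OF DE] ear_Int_E'[OF A(1)] by blast
        then have upDA: "up (D - {\<rho> A}) = up D - A" using up_saturated[OF satD] by simp
        have "D \<noteq> {\<rho> A}" using False A(1) by blast
        then have ne: "D - {\<rho> A} \<noteq> {}" using rD by blast
        show ?thesis
          unfolding splits_inside_def
        proof (intro exI conjI)
          show "{\<rho> A} \<noteq> {}" by simp
          show "D - {\<rho> A} \<noteq> {}" by (rule ne)
          show "{\<rho> A} \<inter> (D - {\<rho> A}) = {}" by blast
          show "{\<rho> A} \<union> (D - {\<rho> A}) = D" using rD by blast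
          show "f (up {\<rho> A}) + f (up (D - {\<rho> A})) = f (up D)" unfolding upA upDA by (rule sp)
        qed
      qed
      then show ?thesis by blast
    qed blast
  qed
qed

definition contracted_point :: "'a \<Rightarrow> int" where
  "contracted_point x = (if x \<in> \<rho> ` \<A> then 1 else int \<delta> - 1)"

text \<open>The contracted elements of the ears outside \<open>D\<close> cancel, since they are independent modulo everything
  else. An ear \<open>A\<close> with \<open>\<rho> A \<in> D\<close> contributes \<open>(\<delta> - 1) * (\<delta> - 1)\<close> to the original point and the
  contraction lowers the rank by \<open>\<delta> - 2\<close>; the value \<open>1\<close> of \<open>\<rho> A\<close> is the difference
  \<open>(\<delta> - 1) * (\<delta> - 1) - \<delta> * (\<delta> - 2)\<close>.\<close>

lemma slack_contracted:
  assumes D: "D \<subseteq> E'"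
  shows "slack \<delta> contracted_point (\<lambda>D. r (D \<union> K) - r K) D = f (up D)"
proof -
  let ?T = "{A \<in> \<A>. \<rho> A \<in> D}"
  let ?U = "\<Union>A\<in>?T. A - {\<rho> A}" and ?L = "\<Union>A\<in>\<A> - ?T. A - {\<rho> A}"
  have finA: "finite \<A>" using ear(1) finE by (meson Pow_iff finite_Pow_iff finite_subset subsetI)
  have rinj: "inj_on \<rho> \<A>"
    by (rule inj_onI) (use ear_unique rho in metis)
  have DK: "D \<inter> K = {}" using D unfolding E'_def by blast
  have UK: "?U \<subseteq> K" "?L \<subseteq> K" "K = ?U \<union> ?L" unfolding K_def by blast+
  have UL: "?U \<inter> ?L = {}" using disjointD[OF ears_disjoint] by blast
  have fin: "finite D" "finite ?U" "finite ?L" "finite K"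
    using finite_sub D KE UK unfolding E'_def by (meson Diff_subset order_trans)+
  have upD: "up D = D \<union> ?U" unfolding up_def by blast
  have rK: "r K = card K"
  proof -
    have "r ({} \<union> K) = r {} + card K"
    proof (rule series_add[OF fin(4) KE])
      fix x assume "x \<in> K"
      then obtain A where A: "A \<in> \<A>" "x \<in> A" "x \<noteq> \<rho> A" unfolding K_def by blast
      have nK: "\<rho> A \<notin> K" using rho_E'[OF A(1)] unfolding E'_def by blast
      show "\<exists>A\<in>\<A>. \<exists>y\<in>A. x \<in> A \<and> y \<noteq> x \<and> y \<notin> {} \<union> K"
        by (rule bexI[OF _ A(1)], rule bexI[OF _ rho[OF A(1)]]) (use A(2,3) nK in simp)
    qed auto
    then show ?thesis using rank_functionD(2)[OF R] by simp
  qed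
  have "r (up D \<union> ?L) = r (up D) + card ?L"
  proof (rule series_add[OF fin(3)])
    show "?L \<subseteq> E" using UK(2) KE by blast
    show "?L \<inter> up D = {}" unfolding upD using UL UK(2) DK by blast
    show "up D \<subseteq> E" by (rule up_E[OF D])
    fix x assume "x \<in> ?L"
    then obtain A where A: "A \<in> \<A>" "\<rho> A \<notin> D" "x \<in> A" "x \<noteq> \<rho> A" by blast
    have "\<rho> A \<notin> K" using rho_E'[OF A(1)] unfolding E'_def by blast
    then have nU: "\<rho> A \<notin> up D \<union> ?L" unfolding upD using A(2) UK(1,2) by blast
    show "\<exists>A\<in>\<A>. \<exists>y\<in>A. x \<in> A \<and> y \<noteq> x \<and> y \<notin> up D \<union> ?L"
      by (rule bexI[OF _ A(1)], rule bexI[OF _ rho[OF A(1)]]) (intro conjI A(3) A(4)[symmetric] nU)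
  qed
  moreover have "up D \<union> ?L = D \<union> K" unfolding upD using UK(3) by blast
  ultimately have rDK: "r (D \<union> K) = r (up D) + card ?L" by simp
  have cK: "card K = card ?U + card ?L"
    unfolding arg_cong[OF UK(3), of card] by (rule card_Un_disjoint[OF fin(2,3) UL])
  have cU: "card ?U = card ?T * (\<delta> - 2)"
  proof -
    have "card ?U = (\<Sum>A\<in>?T. card (A - {\<rho> A}))"
    proof (rule card_UN_disjoint)
      show "finite ?T" using finA by simp
      show "\<forall>A\<in>?T. finite (A - {\<rho> A})" using finite_sub ear(1) by blast
      show "\<forall>A\<in>?T. \<forall>B\<in>?T. A \<noteq> B \<longrightarrow> (A - {\<rho> A}) \<inter> (B - {\<rho> B}) = {}"
        using disjointD[OF ears_disjoint] by blast
    qed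
    also have "\<dots> = (\<Sum>A\<in>?T. \<delta> - 2)"
      by (rule sum.cong) (use ear rho finite_sub in auto)
    finally show ?thesis by simp
  qed
  have cup: "card (up D) = card D + card ?U"
    unfolding upD by (rule card_Un_disjoint[OF fin(1,2)]) (use DK UK(1) in blast)
  have ge: "r K \<le> r (D \<union> K)"
    by (rule rank_function_mono[OF R]) (use D KE in \<open>auto simp: E'_def\<close>)
  have sp: "sum contracted_point D = (int \<delta> - 1) * int (card D) - (int \<delta> - 2) * int (card ?T)"
  proof -
    have "contracted_point x = (int \<delta> - 1) - (if x \<in> \<rho> ` \<A> then int \<delta> - 2 else 0)" for x
      unfolding contracted_point_def by simp
    then have "sum contracted_point D = (\<Sum>x\<in>D. int \<delta> - 1) - (\<Sum>x\<in>D. if x \<in> \<rho> ` \<A> then int \<delta> - 2 else 0)"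
      by (simp add: sum_subtractf)
    also have "(\<Sum>x\<in>D. if x \<in> \<rho> ` \<A> then int \<delta> - 2 else 0) = (int \<delta> - 2) * int (card (D \<inter> \<rho> ` \<A>))"
      using fin(1) by (simp add: sum.If_cases Int_def)
    also have "D \<inter> \<rho> ` \<A> = \<rho> ` ?T" by blast
    also have "card (\<rho> ` ?T) = card ?T" by (rule card_image) (use rinj in \<open>auto intro: inj_on_subset\<close>)
    finally show ?thesis by (simp add: algebra_simps)
  qed
  have "int (r (D \<union> K) - r K) = int (r (up D)) - int (card ?U)"
    using ge rDK rK cK by linarith
  then have 1: "slack \<delta> contracted_point (\<lambda>D. r (D \<union> K) - r K) D =
      int \<delta> * (int (r (up D)) - int (card ?U)) - ((int \<delta> - 1) * int (card D) - (int \<delta> - 2) * int (card ?T))"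
    unfolding slack_def sp by simp
  have 2: "int (card ?U) = (int \<delta> - 2) * int (card ?T)" unfolding cU using d by (simp add: of_nat_diff)
  have 3: "f (up D) = int \<delta> * int (r (up D)) - (int \<delta> - 1) * (int (card D) + int (card ?U))"
    unfolding slack_def by (simp only: sum_constant cup of_nat_add mult.commute)
  have "\<And>a x u t y :: int. u = (a - 2) * t \<Longrightarrow>
      a * (x - u) - ((a - 1) * y - (a - 2) * t) = a * x - (a - 1) * (y + u)"
    by (simp add: algebra_simps)
  then show ?thesis unfolding 1 3 using 2 by blast
qed

lemma contracted_block: "gorenstein_block (slack \<delta> contracted_point (\<lambda>D. r (D \<union> K) - r K)) E'"
  by (rule gorenstein_block_cong[OF slack_contracted[symmetric] up_block])

end

section \<open>Isomorphisms and direct sums of blocks\<close>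

lemma gorenstein_block_bij:
  assumes phi: "bij_betw \<phi> E E'" and block: "gorenstein_block g E'"
  shows "gorenstein_block (\<lambda>A. g (\<phi> ` A)) E"
proof -
  note B = gorenstein_blockD[OF block]
  have inj: "inj_on \<phi> E" and img: "\<phi> ` E = E'" using phi unfolding bij_betw_def by auto
  define \<psi> where "\<psi> S = E \<inter> \<phi> -` S" for S
  have image_psi: "\<phi> ` \<psi> S = S" if "S \<subseteq> E'" for S using that img unfolding \<psi>_def by blast
  have psi: "\<psi> (\<phi> ` A) = A" if "A \<subseteq> E" for A
    using that inj unfolding \<psi>_def inj_on_def by blast
  have psi_Int: "\<psi> (S \<inter> T) = \<psi> S \<inter> \<psi> T" and psi_Un: "\<psi> (S \<union> T) = \<psi> S \<union> \<psi> T"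
    and psi_empty: "\<psi> {} = {}" for S T unfolding \<psi>_def by blast+
  have psi_E: "\<psi> E' = E" using psi[of E] img by simp
  show ?thesis
    unfolding gorenstein_block_def
  proof (intro conjI allI impI)
    show "g (\<phi> ` {}) = 0" "g (\<phi> ` E) = 0" using B(1,2) img by simp_all
    fix A assume A: "A \<noteq> {}" "A \<subset> E"
    have AE: "A \<subseteq> E" using A(2) by blast
    have ne: "\<phi> ` A \<noteq> {}" using A(1) by simp
    have "\<phi> ` A \<subseteq> E'" using AE img by blast
    moreover have "\<phi> ` A \<noteq> E'" using psi[OF AE] psi_E A(2) by auto
    ultimately have pr: "\<phi> ` A \<subset> E'" by blast
    show "1 \<le> g (\<phi> ` A)" by (rule B(3)[OF ne pr])
    consider "g (\<phi> ` A) = 1" | "splits_inside g (\<phi> ` A)" | "splits_outside g E' (\<phi> ` A)"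
      using B(4)[OF ne pr] by blast
    then show "g (\<phi> ` A) = 1 \<or> splits_inside (\<lambda>A. g (\<phi> ` A)) A \<or> splits_outside (\<lambda>A. g (\<phi> ` A)) E A"
    proof cases
      case 2
      then obtain S S' where S: "S \<noteq> {}" "S' \<noteq> {}" "S \<inter> S' = {}" "S \<union> S' = \<phi> ` A" "g S + g S' = g (\<phi> ` A)"
        unfolding splits_inside_def by blast
      have SE: "S \<subseteq> E'" "S' \<subseteq> E'" using S(4) pr by blast+
      have "splits_inside (\<lambda>A. g (\<phi> ` A)) A"
        unfolding splits_inside_def
      proof (intro exI conjI)
        show "\<psi> S \<noteq> {}" "\<psi> S' \<noteq> {}" using image_psi[OF SE(1)] image_psi[OF SE(2)] S(1,2) by auto
        show "\<psi> S \<inter> \<psi> S' = {}" using psi_Int[of S S'] S(3) psi_empty by simp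
        show "\<psi> S \<union> \<psi> S' = A" using psi_Un[of S S'] S(4) psi[OF AE] by simp
        show "g (\<phi> ` \<psi> S) + g (\<phi> ` \<psi> S') = g (\<phi> ` A)" unfolding image_psi[OF SE(1)] image_psi[OF SE(2)] by (rule S(5))
      qed
      then show ?thesis by blast
    next
      case 3
      then obtain S S' where S: "S \<subset> E'" "S' \<subset> E'" "S \<inter> S' = \<phi> ` A" "S \<union> S' = E'" "g S + g S' = g (\<phi> ` A)"
        unfolding splits_outside_def by blast
      have SE: "S \<subseteq> E'" "S' \<subseteq> E'" using S(1,2) by blast+
      have "splits_outside (\<lambda>A. g (\<phi> ` A)) E A"
        unfolding splits_outside_def
      proof (intro exI conjI)
        have "\<psi> S \<noteq> E" using image_psi[OF SE(1)] S(1) img by auto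
        then show "\<psi> S \<subset> E" unfolding \<psi>_def by blast
        have "\<psi> S' \<noteq> E" using image_psi[OF SE(2)] S(2) img by auto
        then show "\<psi> S' \<subset> E" unfolding \<psi>_def by blast
        show "\<psi> S \<inter> \<psi> S' = A" using psi_Int[of S S'] S(3) psi[OF AE] by simp
        show "\<psi> S \<union> \<psi> S' = E" using psi_Un[of S S'] S(4) psi_E by simp
        show "g (\<phi> ` \<psi> S) + g (\<phi> ` \<psi> S') = g (\<phi> ` A)" unfolding image_psi[OF SE(1)] image_psi[OF SE(2)] by (rule S(5))
      qed
      then show ?thesis by blast
    qed blast
  qed
qed

lemma rk_iso:
  assumes phi: "bij_betw \<phi> (ground M) (ground N)"
    and iso: "\<And>X. X \<subseteq> ground M \<Longrightarrow> X \<in> indeps M \<longleftrightarrow> \<phi> ` X \<in> indeps N"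
    and A: "A \<subseteq> ground M"
  shows "rk M A = rk N (\<phi> ` A)"
proof -
  have inj: "inj_on \<phi> (ground M)" using phi unfolding bij_betw_def by blast
  have c: "card (\<phi> ` I) = card I" if "I \<subseteq> A" for I
    by (rule card_image) (rule inj_on_subset[OF inj order_trans[OF that A]])
  have "card ` {I \<in> indeps M. I \<subseteq> A} = card ` {J \<in> indeps N. J \<subseteq> \<phi> ` A}"
  proof
    show "card ` {I \<in> indeps M. I \<subseteq> A} \<subseteq> card ` {J \<in> indeps N. J \<subseteq> \<phi> ` A}"
    proof
      fix n assume "n \<in> card ` {I \<in> indeps M. I \<subseteq> A}"
      then obtain I where I: "I \<in> indeps M" "I \<subseteq> A" "n = card I" by blast
      have "\<phi> ` I \<in> indeps N" using iso[OF order_trans[OF I(2) A]] I(1) by simp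
      moreover have "\<phi> ` I \<subseteq> \<phi> ` A" using I(2) by blast
      moreover have "n = card (\<phi> ` I)" using c[OF I(2)] I(3) by simp
      ultimately show "n \<in> card ` {J \<in> indeps N. J \<subseteq> \<phi> ` A}" by blast
    qed
    show "card ` {J \<in> indeps N. J \<subseteq> \<phi> ` A} \<subseteq> card ` {I \<in> indeps M. I \<subseteq> A}"
    proof
      fix n assume "n \<in> card ` {J \<in> indeps N. J \<subseteq> \<phi> ` A}"
      then obtain J where J: "J \<in> indeps N" "J \<subseteq> \<phi> ` A" "n = card J" by blast
      then obtain I where I: "I \<subseteq> A" "J = \<phi> ` I" using subset_imageE by metis
      have "I \<in> indeps M" using iso[OF order_trans[OF I(1) A]] J(1) I(2) by simp
      moreover have "n = card I" using c[OF I(1)] J(3) I(2) by simp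
      ultimately show "n \<in> card ` {I \<in> indeps M. I \<subseteq> A}" using I(1) by blast
    qed
  qed
  then show ?thesis unfolding rk_def by simp
qed

lemma rank_function_subset:
  assumes "rank_function E r" "P \<subseteq> E" shows "rank_function P r"
proof -
  have "finite P" using assms rank_functionD(1) finite_subset by blast
  moreover have "submodular_on P r"
    unfolding submodular_on_def
  proof (intro allI impI)
    fix A B assume "A \<subseteq> P" "B \<subseteq> P"
    then have "A \<subseteq> E" "B \<subseteq> E" using assms(2) by blast+
    then show "r (A \<union> B) + r (A \<inter> B) \<le> r A + r B" by (rule submodular_onD[OF rank_functionD(3)[OF assms(1)]])
  qed
  moreover have "r A \<le> r (insert e A) \<and> r (insert e A) \<le> Suc (r A)" if "A \<subseteq> P" "e \<in> P" for A e
  proof -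
    have "A \<subseteq> E" "e \<in> E" using that assms(2) by blast+
    then show ?thesis using rank_functionD(4,5)[OF assms(1)] by blast
  qed
  ultimately show ?thesis unfolding rank_function_def using rank_functionD(2)[OF assms(1)] by blast
qed

lemma restricted_eq_matroid_of_rank:
  assumes M: "is_matroid M" and P: "P \<subseteq> ground M"
  shows "restricted M P = matroid_of_rank P (rk M)"
proof (rule matroid_eqI)
  show "ground (restricted M P) = ground (matroid_of_rank P (rk M))" by (simp add: matroid_of_rank_def)
  fix I
  show "I \<in> indeps (restricted M P) \<longleftrightarrow> I \<in> indeps (matroid_of_rank P (rk M))"
    using indep_iff_rk[OF M, of I] P by (auto simp: matroid_of_rank_def)
qed

lemma restricted_singleton:
  assumes M: "is_matroid M"
  shows "is_loop (restricted M {e}) \<or> is_coloop (restricted M {e})"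
proof (cases "{e} \<in> indeps M")
  case True
  then have "{I \<in> indeps M. I \<subseteq> {e}} = {{}, {e}}" using matroidD(2)[OF M] by auto
  then show ?thesis unfolding is_coloop_def restricted_def by simp
next
  case False
  then have "{I \<in> indeps M. I \<subseteq> {e}} = {{}}" using matroidD(2)[OF M] by (auto simp: subset_singleton_iff)
  then show ?thesis unfolding is_loop_def restricted_def by simp
qed

lemma contracted_G'_matroid_block:
  assumes N: "G'_matroid \<delta> N" and C: "good_ears_contracted (\<delta> - 1) N N'" and d: "2 < \<delta>"
  shows "\<exists>v. gorenstein_block (slack \<delta> v (rk N')) (ground N')"
proof -
  obtain E \<G> where G: "G'_family \<delta> E \<G>" "N = family_matroid \<delta> E \<G>" using N unfolding G'_matroid_def by blast
  obtain r where R: "rank_function E r" and Nr: "N = matroid_of_rank E r"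
    and block: "gorenstein_block (slack \<delta> (\<lambda>_. int \<delta> - 1) r) E"
    using G'_family_matroid[OF G(1)] G(2) by metis
  have M: "is_matroid N" unfolding Nr by (rule is_matroid_matroid_of_rank[OF R])
  have gN: "ground N = E" unfolding Nr by (simp add: matroid_of_rank_def)
  have rkN: "rk N A = r A" if "A \<subseteq> E" for A unfolding Nr by (rule rk_matroid_of_rank[OF R that])
  obtain \<A> \<rho> where A: "disjoint \<A>" "\<And>A. A \<in> \<A> \<Longrightarrow> good_ear N (\<delta> - 1) A" "\<And>A. A \<in> \<A> \<Longrightarrow> \<rho> A \<in> A"
    "N' = contraction N (\<Union>A\<in>\<A>. A - {\<rho> A})"
    using C unfolding good_ears_contracted_def by blast
  have ear: "is_ear N (\<delta> - 1) A" if "A \<in> \<A>" for A using A(2)[OF that] unfolding good_ear_def by blast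
  interpret ears_in_block \<delta> E r \<A> \<rho>
  proof
    show "2 < \<delta>" "rank_function E r" "gorenstein_block (slack \<delta> (\<lambda>_. int \<delta> - 1) r) E" "disjoint \<A>"
      by (rule d R block A(1))+
    show AE: "A \<subseteq> E" if "A \<in> \<A>" for A using ear[OF that] gN unfolding is_ear_def by blast
    show "card A = \<delta> - 1" if "A \<in> \<A>" for A using ear[OF that] unfolding is_ear_def by blast
    show "\<rho> A \<in> A" if "A \<in> \<A>" for A by (rule A(3)[OF that])
    show "r (insert x X) = Suc (r X)"
      if h: "A \<in> \<A>" "x \<in> A" "y \<in> A" "x \<noteq> y" "X \<subseteq> E" "x \<notin> X" "y \<notin> X" for A x y X
    proof -
      have "insert x X \<subseteq> E" using AE[OF h(1)] h(2,5) by blast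
      then show ?thesis
        using ear_in_series[OF M ear[OF h(1)] h(2-4), of X] h(5-7) gN rkN[of X] rkN[of "insert x X"] by simp
    qed
    show "\<exists>S S'. S \<subset> E \<and> S' \<subset> E \<and> S \<inter> S' = A \<and> S \<union> S' = E \<and> r S + r S' = r E + r A" if h: "A \<in> \<A>" for A
    proof -
      obtain S S' where S: "S \<subset> E" "S' \<subset> E" "S \<inter> S' = A" "S \<union> S' = E" "rk N S + rk N S' = rk N E + rk N A"
        using good_ear_splits[OF M A(2)[OF h]] unfolding gN by metis
      have "S \<subseteq> E" "S' \<subseteq> E" using S(1,2) by blast+
      then have "r S + r S' = r E + r A" using S(5) rkN[of S] rkN[of S'] rkN[of E] rkN[OF AE[OF h]] by simp
      then show ?thesis using S(1-4) by blast
    qed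
  qed
  have N': "N' = contraction N K" using A(4) unfolding K_def .
  have KN: "K \<subseteq> ground N" using KE gN by simp
  have g': "ground N' = E'" unfolding N' E'_def using gN by simp
  have "slack \<delta> contracted_point (\<lambda>D. r (D \<union> K) - r K) D = slack \<delta> contracted_point (rk N') D" if D: "D \<subseteq> E'" for D
  proof -
    have s: "D \<union> K \<subseteq> E" using D KE unfolding E'_def by blast
    have "rk N' D = r (D \<union> K) - r K"
      unfolding N' using rk_contraction[OF M KN, of D] D gN rkN[OF s] rkN[OF KE] unfolding E'_def by simp
    then show ?thesis unfolding slack_def by simp
  qed
  then have "gorenstein_block (slack \<delta> contracted_point (rk N')) E'"
    by (rule gorenstein_block_cong[OF _ contracted_block])
  then show ?thesis using g' by auto
qed

lemma contracted_G'_matroid_iso_block: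
  fixes N :: "'e matroid"
  assumes G: "G'_matroid_good_ears_contracted \<delta> N" and d: "2 < \<delta>"
  shows "\<exists>v. gorenstein_block (slack \<delta> v (rk N)) (ground N)"
proof -
  obtain L N' :: "nat matroid" where L: "G'_matroid \<delta> L" "good_ears_contracted (\<delta> - 1) L N'" "matroid_iso N N'"
    using G unfolding G'_matroid_good_ears_contracted_def by blast
  obtain \<phi> where phi: "bij_betw \<phi> (ground N) (ground N')"
    "\<And>X. X \<subseteq> ground N \<Longrightarrow> X \<in> indeps N \<longleftrightarrow> \<phi> ` X \<in> indeps N'"
    using L(3) unfolding matroid_iso_def by blast
  obtain v where v: "gorenstein_block (slack \<delta> v (rk N')) (ground N')"
    using contracted_G'_matroid_block[OF L(1,2) d] by blast
  have "slack \<delta> v (rk N') (\<phi> ` A) = slack \<delta> (v \<circ> \<phi>) (rk N) A" if A: "A \<subseteq> ground N" for A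
  proof -
    have "inj_on \<phi> A" using phi(1) A unfolding bij_betw_def by (blast intro: inj_on_subset)
    then have "sum v (\<phi> ` A) = sum (v \<circ> \<phi>) A" by (rule sum.reindex)
    then show ?thesis unfolding slack_def using rk_iso[OF phi A] by simp
  qed
  then have "gorenstein_block (slack \<delta> (v \<circ> \<phi>) (rk N)) (ground N)"
    by (rule gorenstein_block_cong[OF _ gorenstein_block_bij[OF phi(1) v]])
  then show ?thesis by blast
qed

lemma G'2_matroid_block:
  assumes "G'2_matroid N" shows "\<exists>v. gorenstein_block (slack 2 v (rk N)) (ground N)"
proof -
  obtain E \<G> where G: "G'2_family E \<G>" "N = family_matroid 2 E \<G>" using assms unfolding G'2_matroid_def by blast
  obtain r where R: "rank_function E r" and Nr: "N = matroid_of_rank E r"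
    and block: "gorenstein_block (slack 2 (\<lambda>_. 1) r) E"
    using G'2_family_matroid[OF G(1)] G(2) by metis
  have gN: "ground N = E" unfolding Nr by (simp add: matroid_of_rank_def)
  have "slack 2 (\<lambda>_. 1) r A = slack 2 (\<lambda>_. 1) (rk N) A" if "A \<subseteq> E" for A
    unfolding Nr slack_def using rk_matroid_of_rank[OF R that] by simp
  then have "gorenstein_block (slack 2 (\<lambda>_. 1) (rk N)) E" by (rule gorenstein_block_cong[OF _ block])
  then show ?thesis using gN by auto
qed

lemma singleton_block:
  assumes "r {} = 0" shows "\<exists>v. gorenstein_block (slack \<delta> v r) {e}"
proof (intro exI)
  show "gorenstein_block (slack \<delta> (\<lambda>_. int \<delta> * int (r {e})) r) {e}"
    unfolding gorenstein_block_def slack_def using assms by auto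
qed

text \<open>The points of the summands are glued to one point. If all summands with elements are loops or coloops,
  the polytope is a point, which is Gorenstein of index one only.\<close>

lemma gorenstein_of_summands:
  fixes M :: "'e::finite matroid"
  assumes M: "is_matroid M" and D: "is_direct_sum M \<N>" and d: "0 < \<delta>"
    and summand: "\<And>N. N \<in> \<N> \<Longrightarrow> is_loop N \<or> is_coloop N \<or> (\<exists>v. gorenstein_block (slack \<delta> v (rk N)) (ground N))"
  shows "gorenstein (base_polytope M)"
proof -
  let ?\<P> = "ground ` \<N> - {{}}"
  interpret matroid_polytope M ?\<P>
    using direct_sum_rk[OF M D] M by unfold_locales
  have rkN: "rk N A = rk M A" if "N \<in> \<N>" "A \<subseteq> ground N" for N A
    by (rule rk_cong_indeps) (use direct_sum_summand[OF M D that(1)] that(2) in blast)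
  have "\<exists>v. gorenstein_block (slack \<delta> v (rk M)) P" if P: "P \<in> ?\<P>" for P
  proof -
    obtain N where N: "N \<in> \<N>" "P = ground N" using P by blast
    consider "is_loop N \<or> is_coloop N" | v where "gorenstein_block (slack \<delta> v (rk N)) (ground N)"
      using summand[OF N(1)] by blast
    then show ?thesis
    proof cases
      case 1
      then obtain e where "ground N = {e}" unfolding is_loop_def is_coloop_def by auto
      then show ?thesis using singleton_block[of "rk M" \<delta> e, OF rk_empty] N(2) by simp
    next
      case 2
      have "slack \<delta> v (rk N) A = slack \<delta> v (rk M) A" if "A \<subseteq> P" for A
        unfolding slack_def using rkN[OF N(1)] that N(2) by simp
      then have "gorenstein_block (slack \<delta> v (rk M)) P"
        by (rule gorenstein_block_cong[OF _ 2[folded N(2)]])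
      then show ?thesis by blast
    qed
  qed
  then have "\<exists>V. \<forall>P\<in>?\<P>. gorenstein_block (slack \<delta> (V P) (rk M)) P" by (intro bchoice) blast
  then obtain V where V: "\<And>P. P \<in> ?\<P> \<Longrightarrow> gorenstein_block (slack \<delta> (V P) (rk M)) P" by blast
  define v where "v e = V (THE P. P \<in> ?\<P> \<and> e \<in> P) e" for e
  have block: "gorenstein_block (slack \<delta> v (rk M)) P" if P: "P \<in> ?\<P>" for P
  proof (rule gorenstein_block_cong[OF _ V[OF P]])
    fix A assume A: "A \<subseteq> P"
    have "sum (V P) A = sum v A"
    proof (rule sum.cong[OF refl])
      fix e assume e: "e \<in> A"
      have "(THE Q. Q \<in> ?\<P> \<and> e \<in> Q) = P"
      proof (rule the_equality)
        show "P \<in> ?\<P> \<and> e \<in> P" using P A e by blast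
        show "Q = P" if "Q \<in> ?\<P> \<and> e \<in> Q" for Q
          using parts_disjoint[of Q P] that P A e by blast
      qed
      then show "V P e = v e" unfolding v_def by simp
    qed
    then show "slack \<delta> (V P) (rk M) A = slack \<delta> v (rk M) A" unfolding slack_def by simp
  qed
  show ?thesis
  proof (cases "\<exists>P\<in>?\<P>. 2 \<le> card P")
    case True
    then obtain P0 where P0: "P0 \<in> ?\<P>" "2 \<le> card P0" by blast
    show ?thesis unfolding gorenstein_def using gorenstein_of_blocks[OF d block P0] d by blast
  next
    case False
    have "card P \<le> 1" if "P \<in> ?\<P>" for P
    proof -
      have "\<not> 2 \<le> card P" using False that by blast
      then show ?thesis by simp
    qed
    then have "gorenstein_of_index 1 (base_polytope M)" by (rule gorenstein_of_singletons)
    then show ?thesis unfolding gorenstein_def by (intro exI[of _ 1]) simp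
  qed
qed

theorem theorem1p2:
  fixes M :: "'e::finite matroid"
  assumes "is_matroid M"
  shows "gorenstein (base_polytope M) \<longleftrightarrow>
    (\<exists>\<delta>::nat. 2 \<le> \<delta> \<and>
      (2 < \<delta> \<longrightarrow> (\<exists>\<N>. is_direct_sum M \<N> \<and>
         (\<forall>N\<in>\<N>. is_loop N \<or> is_coloop N \<or> G'_matroid_good_ears_contracted \<delta> N))) \<and>
      (\<delta> = 2 \<longrightarrow> (\<exists>\<N>. is_direct_sum M \<N> \<and>
         (\<forall>N\<in>\<N>. is_loop N \<or> is_coloop N \<or> G'2_matroid N))))"
  (is "?L \<longleftrightarrow> ?R")
proof
  note M = assms
  assume ?L
  then obtain \<delta> where d: "0 < \<delta>" and G: "gorenstein_of_index \<delta> (base_polytope M)"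
    unfolding gorenstein_def by blast
  obtain \<P> where P: "partition_on (ground M) \<P>" "(\<Sum>P\<in>\<P>. rk M P) = rk M (ground M)"
    and irr: "\<And>P X. P \<in> \<P> \<Longrightarrow> X \<noteq> {} \<Longrightarrow> X \<subset> P \<Longrightarrow> rk M P < rk M X + rk M (P - X)"
    using connected_partition[OF M] by blast
  interpret matroid_polytope M \<P> using M P by unfold_locales
  obtain v where block: "\<And>P. P \<in> \<P> \<Longrightarrow> gorenstein_block (slack \<delta> v (rk M)) P"
    using blocks_of_gorenstein[OF irr d G] by blast
  have sum: "is_direct_sum M (restricted M ` \<P>)" by (rule is_direct_sum_restricted[OF M P])
  have res: "restricted M P = matroid_of_rank P (rk M)" "rank_function P (rk M)" if "P \<in> \<P>" for P
    using restricted_eq_matroid_of_rank[OF M part_subset[OF that]]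
      rank_function_subset[OF rank_function_rk[OF M] part_subset[OF that]] by auto
  have small: "is_loop (restricted M P) \<or> is_coloop (restricted M P)" if PP: "P \<in> \<P>" and "\<not> 2 \<le> card P" for P
  proof -
    have "P \<noteq> {}" using P(1) PP unfolding partition_on_def by blast
    then have "0 < card P" using finite_part[OF PP] by (simp add: card_gt_0_iff)
    then have "card P = 1" using that(2) by simp
    then obtain e where "P = {e}" by (auto simp: card_1_singleton_iff)
    then show ?thesis using restricted_singleton[OF M] by simp
  qed
  show ?R
  proof (cases "\<exists>P\<in>\<P>. 2 \<le> card P")
    case False
    then have "\<forall>N\<in>restricted M ` \<P>. is_loop N \<or> is_coloop N \<or> G'2_matroid N" using small by blast
    then have "\<exists>\<N>. is_direct_sum M \<N> \<and> (\<forall>N\<in>\<N>. is_loop N \<or> is_coloop N \<or> G'2_matroid N)" using sum by blast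
    then show ?thesis by (intro exI[of _ 2]) simp
  next
    case True
    then obtain P0 where P0: "P0 \<in> \<P>" "2 \<le> card P0" by blast
    obtain e0 where e0: "e0 \<in> P0" using P0(2) by fastforce
    have d2: "2 \<le> \<delta>" using block_element_value(2,3)[OF res(2)[OF P0(1)] block[OF P0(1)] P0(2) e0] by linarith
    have "\<exists>\<N>. is_direct_sum M \<N> \<and> (\<forall>N\<in>\<N>. is_loop N \<or> is_coloop N \<or> G'_matroid_good_ears_contracted \<delta> N)"
      if lt: "2 < \<delta>"
    proof -
      have "is_loop (restricted M P) \<or> is_coloop (restricted M P) \<or> G'_matroid_good_ears_contracted \<delta> (restricted M P)"
        if PP: "P \<in> \<P>" for P
      proof (cases "2 \<le> card P")
        case True
        then show ?thesis using block_is_contracted_G'_matroid[OF res(2)[OF PP] block[OF PP] True lt] res(1)[OF PP] by simp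
      next
        case False
        then show ?thesis using small[OF PP] by blast
      qed
      then show ?thesis using sum by blast
    qed
    moreover have "\<exists>\<N>. is_direct_sum M \<N> \<and> (\<forall>N\<in>\<N>. is_loop N \<or> is_coloop N \<or> G'2_matroid N)"
      if eq: "\<delta> = 2"
    proof -
      have "is_loop (restricted M P) \<or> is_coloop (restricted M P) \<or> G'2_matroid (restricted M P)"
        if PP: "P \<in> \<P>" for P
      proof (cases "2 \<le> card P")
        case True
        note val = block_element_value[OF res(2)[OF PP] block[OF PP] True]
        have "slack \<delta> v (rk M) A = slack \<delta> (\<lambda>_. int \<delta> - 1) (rk M) A" if A: "A \<subseteq> P" for A
        proof -
          have "sum v A = sum (\<lambda>_. int \<delta> - 1) A"
            by (rule sum.cong[OF refl]) (use val(4) A eq in auto)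
          then show ?thesis unfolding slack_def by simp
        qed
        then have "gorenstein_block (slack \<delta> (\<lambda>_. int \<delta> - 1) (rk M)) P"
          by (rule gorenstein_block_cong[OF _ block[OF PP]])
        then interpret U: uniform_block \<delta> P "rk M"
          using d2 res(2)[OF PP] True by unfold_locales
        show ?thesis
          using U.G'2_family_flacets[OF eq] res(1)[OF PP] unfolding G'2_matroid_def by metis
      next
        case False
        then show ?thesis using small[OF PP] by blast
      qed
      then show ?thesis using sum by blast
    qed
    ultimately show ?thesis using d2 by blast
  qed
next
  note M = assms
  assume ?R
  then obtain \<delta> where d: "2 \<le> \<delta>"
    and gt: "2 < \<delta> \<Longrightarrow> \<exists>\<N>. is_direct_sum M \<N> \<and>
      (\<forall>N\<in>\<N>. is_loop N \<or> is_coloop N \<or> G'_matroid_good_ears_contracted \<delta> N)"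
    and eq: "\<delta> = 2 \<Longrightarrow> \<exists>\<N>. is_direct_sum M \<N> \<and> (\<forall>N\<in>\<N>. is_loop N \<or> is_coloop N \<or> G'2_matroid N)"
    by blast
  show ?L
  proof (cases "2 < \<delta>")
    case True
    then obtain \<N> where N: "is_direct_sum M \<N>"
      "\<And>N. N \<in> \<N> \<Longrightarrow> is_loop N \<or> is_coloop N \<or> G'_matroid_good_ears_contracted \<delta> N"
      using gt by blast
    show ?thesis
    proof (rule gorenstein_of_summands[OF M N(1)])
      show "0 < \<delta>" using d by simp
      show "is_loop N \<or> is_coloop N \<or> (\<exists>v. gorenstein_block (slack \<delta> v (rk N)) (ground N))" if "N \<in> \<N>" for N
        using N(2)[OF that] contracted_G'_matroid_iso_block[OF _ True] by blast
    qed
  next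
    case False
    then have two: "\<delta> = 2" using d by simp
    then obtain \<N> where N: "is_direct_sum M \<N>"
      "\<And>N. N \<in> \<N> \<Longrightarrow> is_loop N \<or> is_coloop N \<or> G'2_matroid N"
      using eq by blast
    show ?thesis
    proof (rule gorenstein_of_summands[OF M N(1)])
      show "0 < \<delta>" using d by simp
      show "is_loop N \<or> is_coloop N \<or> (\<exists>v. gorenstein_block (slack \<delta> v (rk N)) (ground N))" if "N \<in> \<N>" for N
        using N(2)[OF that] G'2_matroid_block two by blast
    qed
  qed
qed

end
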